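(* Let $H\in(0,1)$ and let $(B_t)_{t\ge 0}$ be the one-dimensional fractional Brownian motion with Hurst parameter $H$, realised on the classical Wiener space $(\boldsymbol{W},\mathcal{H},P)$ by $B_t=\int_0^t K(t,s)\,d\omega(s)$. Then, quasi-surely, $$\limsup_{h\downarrow0}\frac{|B_{t+h}-B_t|}{h}=\infty\quad\text{for all }t\in[0,1].$$
   Context: Classical Wiener space: $\boldsymbol{W}$ is the space of continuous paths $\omega:[0,\infty)\to\mathbb{R}$ with $\omega(0)=0$, with the topology of uniform convergence on compact sets; $P$ is Wiener measure, under which the coordinate process $(\omega(t))_{t\ge0}$ is a standard Brownian motion; $\mathcal{H}$ is the Hilbert space of absolutely continuous $h\in\boldsymbol{W}$ with $\dot h\in L^2([0,\infty))$, $\|h\|_{\mathcal H}^2=\int_0^\infty|\dot h(t)|^2dt$. For $h\in\mathcal H$ let $[h]=\int_0^\infty\dot h\,d\omega$ (Itô/Wiener integral). Sobolev spaces: for smooth $F=f([h_1],\dots,[h_n])$ with $f$ smooth with partial derivatives of polynomial growth, $DF=\sum_i\partial_if([h_1],\dots,[h_n])h_i$, and $D^kF$ ($\mathcal H^{\otimes k}$-valued) is defined inductively. For $r\in\mathbb{N}=\{1,2,\dots\}$ and $1<p<\infty$, $\mathbb{D}^p_r$ is the completion of the smooth functionals under $\|F\|_{\mathbb D^p_r}=\big(\mathbb E[|F|^p]+\sum_{k=1}^r\mathbb E[\|D^kF\|_{\mathcal H^{\otimes k}}^p]\big)^{1/p}$. Capacity: for open $O\subset\boldsymbol W$, $c_{p,r}(O)=\inf\{\|\varphi\|_{\mathbb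 D^p_r}:\varphi\in\mathbb D^p_r,\ \varphi\ge1\text{ a.e. on }O,\ \varphi\ge0\text{ a.e. on }\boldsymbol W\}$; for arbitrary $A\subset\boldsymbol W$, $c_{p,r}(A)=\inf\{c_{p,r}(O):A\subset O,\ O\text{ open}\}$. A set $A$ is slim if $c_{p,r}(A)=0$ for all $r\in\mathbb N$ and $1<p<\infty$. A property holds quasi-surely (q.s.) if the set of $\omega$ where it fails is slim. Kernel: for $t>s\ge0$ ($s>0$ where needed), with $\beta(\cdot,\cdot)$ the Beta function, if $H>\frac12$: $K(t,s)=\sqrt{\frac{H(2H-1)}{\beta(2-2H,H-\frac12)}}\,s^{\frac12-H}\int_s^t(u-s)^{H-\frac32}u^{H-\frac12}du$; if $H<\frac12$: $K(t,s)=\sqrt{\frac{2H}{(1-2H)\beta(1-2H,H+\frac12)}}\Big[\big(\tfrac ts\big)^{H-\frac12}(t-s)^{H-\frac12}-(H-\tfrac12)s^{\frac12-H}\int_s^tu^{H-\frac32}(u-s)^{H-\frac12}du\Big]$; if $H=\frac12$: $K=1$. Then $B$ is a centred Gaussian process with $\mathbb E[B_tB_s]=\frac12(t^{2H}+s^{2H}-|t-s|^{2H})$ and $B_t\in\mathbb D^p_r$ for all $p,r$. Choice of version: $B$ denotes a version such that each $B_t$ is quasi-continuous (for all $r\in\mathbb N$, $1<p<\infty$, $\varepsilon>0$ there is an open $O_\varepsilon\subset\boldsymbol W$ with $c_{p,r}(O_\varepsilon)<\varepsilon$ and $B_t$ continuous on $\boldsymbol W\setminus O_\varepsilon$) and $t\mapsto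 B_t(\omega)$ is continuous for every $\omega$ outside a slim set. *)

theory Defs
  imports "HOL-Probability.Probability"
begin

section \<open>Classical Wiener space\<close>

text \<open>
  A continuous path on the half-line starting at 0 is represented by its unique extension to a
  function on the whole real line that vanishes on the negative half-line.
\<close>

typedef path = "{w :: real \<Rightarrow> real. continuous_on UNIV w \<and> (\<forall>t\<le>0. w t = 0)}"
  morphisms coord Abs_path
  by (rule exI[of _ "\<lambda>_. 0"]) auto

text \<open>The topology of uniform convergence on compact subsets of the half-line.\<close>

instantiation path :: topological_space
begin

definition open_path :: "path set \<Rightarrow> bool" where
  "open_path U \<longleftrightarrow>
     (\<forall>w\<in>U. \<exists>T e. e > 0 \<and> {v. \<forall>t\<in>{0..T}. \<bar>coord v t - coord w t\<bar> < e} \<subseteq> U)"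

instance
proof
  show "open (UNIV :: path set)"
    unfolding open_path_def by (auto intro: exI[of _ "1::real"])
next
  fix U V :: "path set"
  assume U: "open U" and V: "open V"
  show "open (U \<inter> V)"
    unfolding open_path_def
  proof
    fix w assume w: "w \<in> U \<inter> V"
    obtain S d where S: "d > 0" "{v. \<forall>t\<in>{0..S}. \<bar>coord v t - coord w t\<bar> < d} \<subseteq> U"
      using U w unfolding open_path_def by blast
    obtain T e where T: "e > 0" "{v. \<forall>t\<in>{0..T}. \<bar>coord v t - coord w t\<bar> < e} \<subseteq> V"
      using V w unfolding open_path_def by blast
    have "{v. \<forall>t\<in>{0..max S T}. \<bar>coord v t - coord w t\<bar> < min d e} \<subseteq> U \<inter> V"
      using S(2) T(2) by fastforce
    then show "\<exists>T e. e > 0 \<and> {v. \<forall>t\<in>{0..T}. \<bar>coord v t - coord w t\<bar> < e} \<subseteq> U \<inter> V"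
      using S(1) T(1) by (intro exI[of _ "max S T"] exI[of _ "min d e"]) auto
  qed
next
  fix K :: "path set set"
  assume K: "\<forall>U\<in>K. open U"
  show "open (\<Union>K)"
    unfolding open_path_def
  proof
    fix w assume "w \<in> \<Union>K"
    then obtain U where U: "U \<in> K" "w \<in> U" by blast
    then obtain T e where "e > 0" "{v. \<forall>t\<in>{0..T}. \<bar>coord v t - coord w t\<bar> < e} \<subseteq> U"
      using K unfolding open_path_def by blast
    then show "\<exists>T e. e > 0 \<and> {v. \<forall>t\<in>{0..T}. \<bar>coord v t - coord w t\<bar> < e} \<subseteq> \<Union>K"
      using U(1) by blast
  qed
qed

end

text \<open>
  Wiener measure: the Borel probability measure under which the coordinate process is a standard
  Brownian motion. Continuity of paths and the start at 0 are part of the type.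
\<close>

definition wiener_measure :: "path measure \<Rightarrow> bool" where
  "wiener_measure P \<longleftrightarrow>
     prob_space P \<and> sets P = sets borel \<and>
     (\<forall>s t. 0 \<le> s \<longrightarrow> s < t \<longrightarrow>
        distributed P lborel (\<lambda>w. coord w t - coord w s) (normal_density 0 (sqrt (t - s)))) \<and>
     (\<forall>n. \<forall>\<tau> :: nat \<Rightarrow> real. 0 \<le> \<tau> 0 \<longrightarrow> mono \<tau> \<longrightarrow>
        prob_space.indep_vars P (\<lambda>_. borel)
          (\<lambda>i w. coord w (\<tau> (Suc i)) - coord w (\<tau> i)) {..<n})"


section \<open>Cameron--Martin space and Wiener integral\<close>

definition abs_cont_on :: "real set \<Rightarrow> (real \<Rightarrow> real) \<Rightarrow> bool" where
  "abs_cont_on I f \<longleftrightarrow>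
     (\<forall>e>0. \<exists>d>0. \<forall>n. \<forall>a b :: nat \<Rightarrow> real.
        (\<forall>i<n. a i \<le> b i \<and> {a i..b i} \<subseteq> I) \<longrightarrow>
        disjoint_family_on (\<lambda>i. {a i<..<b i}) {..<n} \<longrightarrow>
        (\<Sum>i<n. b i - a i) < d \<longrightarrow>
        (\<Sum>i<n. \<bar>f (b i) - f (a i)\<bar>) < e)"

text \<open>
  An absolutely continuous function is differentiable almost everywhere, and the value of
  \<^const>\<open>deriv\<close> on the exceptional null set is irrelevant.
\<close>

definition cameron_martin :: "path set" where
  "cameron_martin =
     {h. (\<forall>T>0. abs_cont_on {0..T} (coord h)) \<and>
         set_integrable lborel {0..} (\<lambda>t. (deriv (coord h) t)\<^sup>2)}"

definition cm_inner :: "path \<Rightarrow> path \<Rightarrow> real" where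
  "cm_inner h g = (LINT t:{0..}|lborel. deriv (coord h) t * deriv (coord g) t)"

text \<open>
  A triple \<open>(c, a, b)\<close> stands for the elementary integrand equal to \<open>c\<close> on \<open>{a<..b}\<close> and 0 elsewhere;
  a list of triples stands for the sum. The Wiener integral is the L2-limit of the integrals of step
  functions, hence is determined only almost surely, which is why it is a relation between an
  integrand and a random variable.
\<close>

definition step_fun :: "(real \<times> real \<times> real) list \<Rightarrow> real \<Rightarrow> real" where
  "step_fun l s = (\<Sum>(c, a, b)\<leftarrow>l. c * indicator {a<..b} s)"

definition step_int :: "(real \<times> real \<times> real) list \<Rightarrow> path \<Rightarrow> real" where
  "step_int l w = (\<Sum>(c, a, b)\<leftarrow>l. c * (coord w b - coord w a))"

definition wiener_integral :: "path measure \<Rightarrow> (real \<Rightarrow> real) \<Rightarrow> (path \<Rightarrow> real) \<Rightarrow> bool" where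
  "wiener_integral P g X \<longleftrightarrow>
     set_borel_measurable lborel {0..} g \<and> set_integrable lborel {0..} (\<lambda>s. (g s)\<^sup>2) \<and>
     X \<in> borel_measurable P \<and> integrable P (\<lambda>w. (X w)\<^sup>2) \<and>
     (\<exists>l. (\<forall>n. \<forall>(c, a, b)\<in>set (l n). 0 \<le> a \<and> a \<le> b) \<and>
        (\<lambda>n. LINT s:{0..}|lborel. (step_fun (l n) s - g s)\<^sup>2) \<longlonglongrightarrow> 0 \<and>
        (\<lambda>n. LINT w|P. (step_int (l n) w - X w)\<^sup>2) \<longlonglongrightarrow> 0)"


section \<open>Smooth functionals and their derivatives\<close>

text \<open>
  A function of \<open>n\<close> real variables is a function on sequences that depends only on the coordinates
  with index below \<open>n\<close>.
\<close>

definition partial :: "nat \<Rightarrow> ((nat \<Rightarrow> real) \<Rightarrow> real) \<Rightarrow> (nat \<Rightarrow> real) \<Rightarrow> real" where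
  "partial i f x = deriv (\<lambda>t. f (x(i := t))) (x i)"

definition iter_partial :: "nat list \<Rightarrow> ((nat \<Rightarrow> real) \<Rightarrow> real) \<Rightarrow> (nat \<Rightarrow> real) \<Rightarrow> real" where
  "iter_partial is f = foldr partial is f"

definition smooth_poly_growth :: "nat \<Rightarrow> ((nat \<Rightarrow> real) \<Rightarrow> real) \<Rightarrow> bool" where
  "smooth_poly_growth n f \<longleftrightarrow>
     (\<forall>x y. (\<forall>i<n. x i = y i) \<longrightarrow> f x = f y) \<and>
     (\<forall>is. set is \<subseteq> {..<n} \<longrightarrow>
        continuous_on UNIV (iter_partial is f) \<and>
        (\<forall>i<n. \<forall>x. (\<lambda>t. iter_partial is f (x(i := t))) differentiable (at (x i))) \<and>
        (\<exists>C N. \<forall>x. \<bar>iter_partial is f x\<bar> \<le> C * (1 + (\<Sum>i<n. \<bar>x i\<bar>)) ^ N))"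

text \<open>
  Data of a smooth functional \<open>f([h\<^sub>1], \<dots>, [h\<^sub>n])\<close>: the number \<open>n\<close>, the function \<open>f\<close>, the
  directions \<open>h\<^sub>i\<close>, and versions of the Wiener integrals \<open>[h\<^sub>i]\<close>.
\<close>

record smooth_data =
  arity :: nat
  outer :: "(nat \<Rightarrow> real) \<Rightarrow> real"
  dir :: "nat \<Rightarrow> path"
  gauss :: "nat \<Rightarrow> path \<Rightarrow> real"

definition smooth_functional :: "path measure \<Rightarrow> smooth_data \<Rightarrow> bool" where
  "smooth_functional P F \<longleftrightarrow>
     smooth_poly_growth (arity F) (outer F) \<and>
     (\<forall>i<arity F. dir F i \<in> cameron_martin \<and>
        wiener_integral P (deriv (coord (dir F i))) (gauss F i))"

definition sval :: "smooth_data \<Rightarrow> path \<Rightarrow> real" where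
  "sval F w = outer F (\<lambda>i. gauss F i w)"

text \<open>
  An element of the algebraic \<open>k\<close>-fold tensor power of the Cameron--Martin space is given as a
  formal sum of terms \<open>c \<cdot> h\<^sub>1 \<otimes> \<dots> \<otimes> h\<^sub>k\<close>, each encoded as \<open>(c, [h\<^sub>1, \<dots>, h\<^sub>k])\<close>, with the Hilbert
  tensor product inner product, which is multiplicative on elementary tensors.
\<close>

type_synonym tensor = "(real \<times> path list) list"

definition tensor_inner :: "tensor \<Rightarrow> tensor \<Rightarrow> real" where
  "tensor_inner u v = (\<Sum>(c, x)\<leftarrow>u. \<Sum>(d, y)\<leftarrow>v. c * d * prod_list (map2 cm_inner x y))"

definition tensor_norm :: "tensor \<Rightarrow> real" where
  "tensor_norm u = sqrt (tensor_inner u u)"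

definition tensor_diff :: "tensor \<Rightarrow> tensor \<Rightarrow> tensor" where
  "tensor_diff u v = u @ map (\<lambda>(c, x). (- c, x)) v"

text \<open>
  A tensor-valued smooth functional \<open>\<Sum>\<^sub>j g\<^sub>j([h\<^sub>1], \<dots>, [h\<^sub>n]) u\<^sub>j\<close> is encoded by the list of its terms
  \<open>(g\<^sub>j, u\<^sub>j)\<close>; its derivative is \<open>\<Sum>\<^sub>j \<Sum>\<^sub>i \<partial>\<^sub>i g\<^sub>j([h\<^sub>1], \<dots>, [h\<^sub>n]) h\<^sub>i \<otimes> u\<^sub>j\<close>.
\<close>

definition malliavin_step ::
    "nat \<Rightarrow> (nat \<Rightarrow> path) \<Rightarrow> (((nat \<Rightarrow> real) \<Rightarrow> real) \<times> path list) list
       \<Rightarrow> (((nat \<Rightarrow> real) \<Rightarrow> real) \<times> path list) list" where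
  "malliavin_step n h G =
     concat (map (\<lambda>(g, u). map (\<lambda>i. (partial i g, h i # u)) [0..<n]) G)"

definition malliavin_deriv :: "nat \<Rightarrow> smooth_data \<Rightarrow> path \<Rightarrow> tensor" where
  "malliavin_deriv k F w =
     map (\<lambda>(g, u). (g (\<lambda>i. gauss F i w), u))
       ((malliavin_step (arity F) (dir F) ^^ k) [(outer F, [])])"


section \<open>Sobolev spaces and capacities\<close>

definition smooth_norm :: "path measure \<Rightarrow> real \<Rightarrow> nat \<Rightarrow> smooth_data \<Rightarrow> real" where
  "smooth_norm P p r F =
     ((LINT w|P. \<bar>sval F w\<bar> powr p) +
      (\<Sum>k=1..r. LINT w|P. tensor_norm (malliavin_deriv k F w) powr p)) powr (1 / p)"

definition smooth_dist :: "path measure \<Rightarrow> real \<Rightarrow> nat \<Rightarrow> smooth_data \<Rightarrow> smooth_data \<Rightarrow> real" where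
  "smooth_dist P p r F G =
     ((LINT w|P. \<bar>sval F w - sval G w\<bar> powr p) +
      (\<Sum>k=1..r. LINT w|P.
         tensor_norm (tensor_diff (malliavin_deriv k F w) (malliavin_deriv k G w)) powr p))
     powr (1 / p)"

text \<open>
  \<open>sobolev P p r \<phi> c\<close>: \<open>\<phi>\<close> represents an element of norm \<open>c\<close> of the completion of the smooth
  functionals. Since the iterated derivatives are closable, the completion embeds into the space of
  \<open>p\<close>-integrable functions: an element is the \<open>p\<close>-th mean limit of a Cauchy sequence of smooth
  functionals, and its norm is the limit of their norms.
\<close>

definition sobolev :: "path measure \<Rightarrow> real \<Rightarrow> nat \<Rightarrow> (path \<Rightarrow> real) \<Rightarrow> real \<Rightarrow> bool" where
  "sobolev P p r \<phi> c \<longleftrightarrow>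
     \<phi> \<in> borel_measurable P \<and> integrable P (\<lambda>w. \<bar>\<phi> w\<bar> powr p) \<and>
     (\<exists>F. (\<forall>n. smooth_functional P (F n)) \<and>
        (\<forall>e>0. \<exists>N. \<forall>m\<ge>N. \<forall>n\<ge>N. smooth_dist P p r (F m) (F n) < e) \<and>
        (\<lambda>n. LINT w|P. \<bar>sval (F n) w - \<phi> w\<bar> powr p) \<longlonglongrightarrow> 0 \<and>
        (\<lambda>n. smooth_norm P p r (F n)) \<longlonglongrightarrow> c)"

definition open_capacity :: "path measure \<Rightarrow> real \<Rightarrow> nat \<Rightarrow> path set \<Rightarrow> ennreal" where
  "open_capacity P p r U =
     Inf {ennreal c | c \<phi>. sobolev P p r \<phi> c \<and>
        (AE w in P. w \<in> U \<longrightarrow> \<phi> w \<ge> 1) \<and> (AE w in P. \<phi> w \<ge> 0)}"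

definition capacity :: "path measure \<Rightarrow> real \<Rightarrow> nat \<Rightarrow> path set \<Rightarrow> ennreal" where
  "capacity P p r A = (INF U\<in>{U. open U \<and> A \<subseteq> U}. open_capacity P p r U)"

definition slim :: "path measure \<Rightarrow> path set \<Rightarrow> bool" where
  "slim P A \<longleftrightarrow> (\<forall>r\<ge>1. \<forall>p>1. capacity P p r A = 0)"

definition quasi_surely :: "path measure \<Rightarrow> (path \<Rightarrow> bool) \<Rightarrow> bool" where
  "quasi_surely P Q \<longleftrightarrow> slim P {w. \<not> Q w}"

definition quasi_continuous :: "path measure \<Rightarrow> (path \<Rightarrow> real) \<Rightarrow> bool" where
  "quasi_continuous P X \<longleftrightarrow>
     (\<forall>r\<ge>1. \<forall>p>1. \<forall>e>0. \<exists>U. open U \<and> capacity P p r U < ennreal e \<and> continuous_on (- U) X)"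


section \<open>Fractional Brownian motion\<close>

text \<open>The formulas are meaningful for \<open>0 < s < t\<close>.\<close>

definition fbm_kernel :: "real \<Rightarrow> real \<Rightarrow> real \<Rightarrow> real" where
  "fbm_kernel H t s =
     (if H > 1/2 then
        sqrt (H * (2 * H - 1) / Beta (2 - 2 * H) (H - 1/2)) * s powr (1/2 - H) *
        (LBINT u=ereal s..ereal t. (u - s) powr (H - 3/2) * u powr (H - 1/2))
      else if H < 1/2 then
        sqrt (2 * H / ((1 - 2 * H) * Beta (1 - 2 * H) (H + 1/2))) *
        ((t / s) powr (H - 1/2) * (t - s) powr (H - 1/2) -
         (H - 1/2) * s powr (1/2 - H) *
         (LBINT u=ereal s..ereal t. u powr (H - 3/2) * (u - s) powr (H - 1/2)))
      else 1)"

text \<open>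
  \<open>B\<close> is only required to be almost surely equal to the (Borel measurable) Wiener integral, since a
  quasi-continuous version need be measurable only up to null sets.
\<close>

definition fbm_version :: "real \<Rightarrow> path measure \<Rightarrow> (real \<Rightarrow> path \<Rightarrow> real) \<Rightarrow> bool" where
  "fbm_version H P B \<longleftrightarrow>
     (\<forall>t\<ge>0. \<exists>Y. wiener_integral P (\<lambda>s. indicator {0<..<t} s * fbm_kernel H t s) Y \<and>
        (AE w in P. B t w = Y w)) \<and>
     (\<forall>t\<ge>0. quasi_continuous P (B t)) \<and>
     quasi_surely P (\<lambda>w. continuous_on {0..} (\<lambda>t. B t w))"

end

theory Submission
  imports Defs
begin

text \<open>
  If \<open>B\<close> has a finite upper derivate at \<open>t\<close>, then for some \<open>L\<close> and all large \<open>n\<close> the \<open>J\<close> consecutive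
  increments of \<open>B\<close> over the grid \<open>\<int>/n\<close> to the right of \<open>t\<close> are at most \<open>L/n\<close>.  Where the increments
  \<open>X\<^sub>1, \<dots>, X\<^sub>J\<close> are at most \<open>1/\<lambda>\<close>, the smooth functional \<open>\<Prod>\<^sub>j exp(1 - (\<lambda> X\<^sub>j)\<^sup>2)\<close> is at least 1.
  Its derivatives up to order \<open>r\<close> cost a factor \<open>\<lambda>\<^sup>r\<close> and keep the Gaussian decay, and the kernel puts
  variance at least \<open>c n\<^bsup>-2H\<^esup>\<close> of each increment on its own time interval, so that conditioning
  successively on the past bounds the expectation by \<open>\<Prod>\<^sub>j C n\<^sup>H/\<lambda>\<close>.  With \<open>\<lambda> = n/L\<close> the \<open>O(n)\<close> grid
  positions together have capacity of order \<open>n\<^bsup>1 + r - J(1 - H)/p\<^esup>\<close>, which tends to 0 once \<open>J\<close> is large.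
  Quasi-continuity of the \<open>B\<^sub>t\<close> makes the sets of small increments open up to sets of small capacity.
\<close>

section \<open>Minkowski's inequality\<close>

text \<open>The pattern is the Dvoretzky-Erdos-Kakutani proof of nowhere differentiability, with
  capacity in place of probability. Capacity is subadditive but has no product rule for independent
  events, so smallness of several increments at once must come from one smooth functional of all of
  them, whose norm is controlled by an ordinary expectation. For H \<noteq> 1/2 the increments are
  not independent either; what replaces independence is a bound on conditional densities that is
  uniform in the shift contributed by the past. Slimness is tested for one pair (r, p) at a time, so
  J may depend on both.

  The encoding of the Sobolev spaces shapes the rest. Tensors and smooth functionals are formal
  data, so the triangle inequality, convergence of series and countable subadditivity are derived by
  way of functions of the path and of k times. A smooth functional takes its Gaussians from
  derivatives of Cameron-Martin paths, so the increments of B, given as integrals of kernels, first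
  need primitives as directions; continuity of the kernel off finitely many points supplies
  them.\<close>

lemma powr_add_convex:
  fixes x y a b p :: real
  assumes "1 \<le> p" "0 \<le> x" "0 \<le> y" "0 < a" "0 < b"
  shows "((x + y) / (a + b)) powr p \<le> a / (a + b) * (x / a) powr p + b / (a + b) * (y / b) powr p"
proof -
  \<comment> \<open>Convexity is invoked for positive x and y only; where one of them is 0, the
    inequality comes from u^p \<le> u on [0,1].\<close>
  have small: "(u * z) powr p \<le> u * z powr p" if "0 \<le> u" "u \<le> 1" "0 \<le> z" for u z :: real
  proof (cases "u = 0")
    case False
    have "u powr p \<le> u powr 1" using that False assms(1) by (intro powr_mono') auto
    then show ?thesis using that False by (simp add: powr_mult mult_right_mono)
  qed simp
  consider "x = 0" | "y = 0" | "x > 0" "y > 0" using assms by linarith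
  then show ?thesis
  proof cases
    case 1
    have "(b / (a + b) * (y / b)) powr p \<le> b / (a + b) * (y / b) powr p"
      using assms by (intro small) (auto simp: divide_simps)
    moreover have "b / (a + b) * (y / b) = y / (a + b)" using assms by auto
    ultimately show ?thesis using 1 by simp
  next
    case 2
    have "(a / (a + b) * (x / a)) powr p \<le> a / (a + b) * (x / a) powr p"
      using assms by (intro small) (auto simp: divide_simps)
    moreover have "a / (a + b) * (x / a) = x / (a + b)" using assms by auto
    ultimately show ?thesis using 2 by simp
  next
    case 3
    have eq: "1 - b / (a + b) = a / (a + b)" using assms by (simp add: field_simps)
    have "((1 - b / (a + b)) *\<^sub>R (x / a) + (b / (a + b)) *\<^sub>R (y / b)) powr p
        \<le> (1 - b / (a + b)) * (x / a) powr p + (b / (a + b)) * (y / b) powr p"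
      using assms 3 by (intro convex_onD[OF powr_convex]) auto
    moreover have "a / (a + b) * (x / a) + b / (a + b) * (y / b) = (x + y) / (a + b)"
      using assms by (simp add: add_divide_distrib)
    ultimately show ?thesis unfolding eq by simp
  qed
qed

text \<open>The Sobolev norm adds p-th powers over the orders of derivatives before the root is
  taken, so the triangle inequality is wanted for M times a counting measure; k stands for the
  order. Integrating the weighted convexity bound, with a and b just above the two norms, gives (a +
  b)^p.\<close>

lemma sum_minkowski:
  fixes f g :: "'i \<Rightarrow> 'a \<Rightarrow> real" and p :: real
  assumes p: "1 \<le> p"
    and f: "\<And>k. k \<in> A \<Longrightarrow> f k \<in> borel_measurable M" "\<And>k x. k \<in> A \<Longrightarrow> 0 \<le> f k x"
           "\<And>k. k \<in> A \<Longrightarrow> integrable M (\<lambda>x. f k x powr p)"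
    and g: "\<And>k. k \<in> A \<Longrightarrow> g k \<in> borel_measurable M" "\<And>k x. k \<in> A \<Longrightarrow> 0 \<le> g k x"
           "\<And>k. k \<in> A \<Longrightarrow> integrable M (\<lambda>x. g k x powr p)"
  shows sum_minkowski_integrable: "\<And>k. k \<in> A \<Longrightarrow> integrable M (\<lambda>x. (f k x + g k x) powr p)"
    and "(\<Sum>k\<in>A. \<integral>x. (f k x + g k x) powr p \<partial>M) powr (1 / p) \<le>
         (\<Sum>k\<in>A. \<integral>x. f k x powr p \<partial>M) powr (1 / p) + (\<Sum>k\<in>A. \<integral>x. g k x powr p \<partial>M) powr (1 / p)"
proof -
  have pw: "(f k x + g k x) powr p \<le>
      (a + b) powr p * (a / (a + b) * (f k x powr p / a powr p) + b / (a + b) * (g k x powr p / b powr p))"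
    if "k \<in> A" "0 < a" "0 < b" for k x a b
  proof -
    have "((f k x + g k x) / (a + b)) powr p \<le>
        a / (a + b) * (f k x / a) powr p + b / (a + b) * (g k x / b) powr p"
      using that p f(2) g(2) by (intro powr_add_convex) auto
    moreover have "((f k x + g k x) / (a + b)) powr p = (f k x + g k x) powr p / (a + b) powr p"
      "(f k x / a) powr p = f k x powr p / a powr p" "(g k x / b) powr p = g k x powr p / b powr p"
      using that f(2)[of k x] g(2)[of k x] by (auto intro!: powr_divide)
    moreover have "0 < (a + b) powr p" using that by simp
    ultimately show ?thesis by (simp only: pos_divide_le_eq mult.commute)
  qed
  have int: "integrable M (\<lambda>x. (a + b) powr p *
      (a / (a + b) * (f k x powr p / a powr p) + b / (a + b) * (g k x powr p / b powr p)))"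
    if "k \<in> A" for k a b
    using f(3)[OF that] g(3)[OF that] by auto
  show I: "integrable M (\<lambda>x. (f k x + g k x) powr p)" if k: "k \<in> A" for k
    by (rule Bochner_Integration.integrable_bound[OF int[OF k, of 1 1]])
       (use f(1)[OF k] g(1)[OF k] order_trans[OF pw[OF k, of 1 1] abs_ge_self] in simp_all)
  define F where "F = (\<Sum>k\<in>A. \<integral>x. f k x powr p \<partial>M)"
  define G where "G = (\<Sum>k\<in>A. \<integral>x. g k x powr p \<partial>M)"
  have F0: "0 \<le> F" and G0: "0 \<le> G" by (auto simp: F_def G_def intro!: sum_nonneg)
  show "(\<Sum>k\<in>A. \<integral>x. (f k x + g k x) powr p \<partial>M) powr (1 / p) \<le> F powr (1 / p) + G powr (1 / p)"
  proof (rule field_le_epsilon)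
    fix e :: real assume e: "0 < e"
    \<comment> \<open>The margin e / 2 keeps a and b positive when a norm vanishes.\<close>
    define a where "a = F powr (1 / p) + e / 2"
    define b where "b = G powr (1 / p) + e / 2"
    have ab: "0 < a" "0 < b" using e by (auto simp: a_def b_def add_nonneg_pos)
    have aF: "F \<le> a powr p"
    proof -
      have "F = (F powr (1 / p)) powr p" using p F0 by (simp add: powr_powr)
      also have "\<dots> \<le> a powr p" using e p by (intro powr_mono2) (auto simp: a_def)
      finally show ?thesis .
    qed
    have bG: "G \<le> b powr p"
    proof -
      have "G = (G powr (1 / p)) powr p" using p G0 by (simp add: powr_powr)
      also have "\<dots> \<le> b powr p" using e p by (intro powr_mono2) (auto simp: b_def)
      finally show ?thesis .
    qed
    have "(\<Sum>k\<in>A. \<integral>x. (f k x + g k x) powr p \<partial>M) \<le>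
       (\<Sum>k\<in>A. \<integral>x. (a + b) powr p *
        (a / (a + b) * (f k x powr p / a powr p) + b / (a + b) * (g k x powr p / b powr p)) \<partial>M)"
      by (intro sum_mono integral_mono I int pw ab)
    also have "\<dots> = (\<Sum>k\<in>A. (a + b) powr p * (a / (a + b) * ((\<integral>x. f k x powr p \<partial>M) / a powr p) +
         b / (a + b) * ((\<integral>x. g k x powr p \<partial>M) / b powr p)))"
      using f(3) g(3) by (intro sum.cong refl) auto
    also have "\<dots> = (a + b) powr p * (a / (a + b) * (F / a powr p) + b / (a + b) * (G / b powr p))"
      by (simp add: F_def G_def sum.distrib sum_distrib_left sum_divide_distrib distrib_left)
    also have "\<dots> \<le> (a + b) powr p * (a / (a + b) * 1 + b / (a + b) * 1)"
      using ab aF bG by (intro mult_left_mono add_mono) (auto simp: divide_simps)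
    also have "\<dots> = (a + b) powr p" using ab by (simp add: add_divide_distrib[symmetric])
    finally have "(\<Sum>k\<in>A. \<integral>x. (f k x + g k x) powr p \<partial>M) powr (1 / p) \<le> ((a + b) powr p) powr (1 / p)"
      using p by (intro powr_mono2) (auto intro!: sum_nonneg)
    also have "\<dots> = a + b" using ab p by (simp add: powr_powr)
    finally show "(\<Sum>k\<in>A. \<integral>x. (f k x + g k x) powr p \<partial>M) powr (1 / p) \<le>
        F powr (1 / p) + G powr (1 / p) + e" by (simp add: a_def b_def)
  qed
qed

lemma L2_triangle:
  fixes f g :: "'a \<Rightarrow> real"
  assumes [measurable]: "f \<in> borel_measurable M" "g \<in> borel_measurable M"
    and "integrable M (\<lambda>x. (f x)\<^sup>2)" "integrable M (\<lambda>x. (g x)\<^sup>2)"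
  shows "integrable M (\<lambda>x. (f x + g x)\<^sup>2)"
    and "sqrt (\<integral>x. (f x + g x)\<^sup>2 \<partial>M) \<le> sqrt (\<integral>x. (f x)\<^sup>2 \<partial>M) + sqrt (\<integral>x. (g x)\<^sup>2 \<partial>M)"
proof -
  have sq: "\<bar>t\<bar> powr 2 = t\<^sup>2" for t :: real by (cases "t = 0") auto
  have I: "integrable M (\<lambda>x. (\<bar>f x\<bar> + \<bar>g x\<bar>) powr 2)"
    using assms by (intro sum_minkowski_integrable[where A="{()}" and f="\<lambda>_ x. \<bar>f x\<bar>" and g="\<lambda>_ x. \<bar>g x\<bar>"])
      (auto simp: sq)
  have le: "(f x + g x)\<^sup>2 \<le> (\<bar>f x\<bar> + \<bar>g x\<bar>) powr 2" for x
    by (subst (2) abs_of_nonneg[symmetric], simp)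
      (simp only: sq, intro abs_le_square_iff[THEN iffD1], linarith)
  show I2: "integrable M (\<lambda>x. (f x + g x)\<^sup>2)"
    by (rule Bochner_Integration.integrable_bound[OF I]) (use le in auto)
  have "sqrt (\<integral>x. (f x + g x)\<^sup>2 \<partial>M) \<le> sqrt (\<integral>x. (\<bar>f x\<bar> + \<bar>g x\<bar>) powr 2 \<partial>M)"
    by (intro real_sqrt_le_mono integral_mono I I2 le)
  also have "\<dots> = (\<Sum>k\<in>{()}. \<integral>x. (\<bar>f x\<bar> + \<bar>g x\<bar>) powr 2 \<partial>M) powr (1 / 2)"
    by (simp add: powr_half_sqrt)
  also have "\<dots> \<le> (\<Sum>k\<in>{()}. \<integral>x. \<bar>f x\<bar> powr 2 \<partial>M) powr (1 / 2) + (\<Sum>k\<in>{()}. \<integral>x. \<bar>g x\<bar> powr 2 \<partial>M) powr (1 / 2)"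
    using assms by (intro sum_minkowski) (auto simp: sq)
  also have "\<dots> = sqrt (\<integral>x. (f x)\<^sup>2 \<partial>M) + sqrt (\<integral>x. (g x)\<^sup>2 \<partial>M)"
    by (simp add: powr_half_sqrt sq)
  finally show "sqrt (\<integral>x. (f x + g x)\<^sup>2 \<partial>M) \<le> sqrt (\<integral>x. (f x)\<^sup>2 \<partial>M) + sqrt (\<integral>x. (g x)\<^sup>2 \<partial>M)" .
qed

lemma integrable_mult_L2:
  fixes f g :: "'a \<Rightarrow> real"
  assumes [measurable]: "f \<in> borel_measurable M" "g \<in> borel_measurable M"
    and "integrable M (\<lambda>x. (f x)\<^sup>2)" "integrable M (\<lambda>x. (g x)\<^sup>2)"
  shows "integrable M (\<lambda>x. f x * g x)"
proof (rule Bochner_Integration.integrable_bound)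
  show "integrable M (\<lambda>x. (f x)\<^sup>2 + (g x)\<^sup>2)" using assms by auto
  have "\<bar>a * b\<bar> \<le> a\<^sup>2 + b\<^sup>2" for a b :: real
  proof -
    have "2 * \<bar>a * b\<bar> \<le> a\<^sup>2 + b\<^sup>2" using sum_squares_bound[of "\<bar>a\<bar>" "\<bar>b\<bar>"] by (simp add: abs_mult)
    moreover have "0 \<le> \<bar>a * b\<bar>" by simp
    ultimately show ?thesis by linarith
  qed
  then show "AE x in M. norm (f x * g x) \<le> norm ((f x)\<^sup>2 + (g x)\<^sup>2)" by auto
qed measurable

section \<open>Tensors as square-integrable functions\<close>

definition cm_density :: "path \<Rightarrow> real \<Rightarrow> real" where
  "cm_density h s = indicator {0..} s * deriv (coord h) s"

text \<open>Integrability of the square by itself says nothing about measurability of the density,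
  so that is asked separately; for the directions of a smooth functional it comes from their Wiener
  integrals.\<close>

definition L2_density :: "path \<Rightarrow> bool" where
  "L2_density h \<longleftrightarrow> cm_density h \<in> borel_measurable lborel \<and> integrable lborel (\<lambda>s. (cm_density h s)\<^sup>2)"

lemma cm_inner_eq: "cm_inner h g = (\<integral>s. cm_density h s * cm_density g s \<partial>lborel)"
  unfolding cm_inner_def cm_density_def set_lebesgue_integral_def
  by (intro Bochner_Integration.integral_cong) (auto simp: indicator_def)

definition tensor_fun :: "nat \<Rightarrow> tensor \<Rightarrow> (nat \<Rightarrow> real) \<Rightarrow> real" where
  "tensor_fun k u s = (\<Sum>(c, x)\<leftarrow>u. c * (\<Prod>j<k. cm_density (x ! j) (s j)))"

text \<open>\<open>map2\<close> in \<open>tensor_inner\<close> stops at the shorter list, so the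
  formula is the Hilbert inner product only between tensors of one common length k.\<close>

definition tensor_wf :: "nat \<Rightarrow> tensor \<Rightarrow> bool" where
  "tensor_wf k u \<longleftrightarrow> (\<forall>(c, x)\<in>set u. length x = k \<and> (\<forall>h\<in>set x. L2_density h))"

abbreviation lborel_k :: "nat \<Rightarrow> (nat \<Rightarrow> real) measure" where
  "lborel_k k \<equiv> PiM {..<k} (\<lambda>_. lborel)"

lemma tensor_fun_measurable:
  assumes "tensor_wf k u"
  shows "tensor_fun k u \<in> borel_measurable (lborel_k k)"
  using assms
proof (induction u)
  case (Cons a u)
  obtain c x where a: "a = (c, x)" by force
  have [measurable]: "tensor_fun k u \<in> borel_measurable (lborel_k k)"
    using Cons by (auto simp: tensor_wf_def)
  have [measurable]: "cm_density (x ! j) \<in> borel_measurable lborel" if "j < k" for j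
    using Cons.prems that by (auto simp: tensor_wf_def a L2_density_def)
  have "(\<lambda>s. c * (\<Prod>j<k. cm_density (x ! j) (s j)) + tensor_fun k u s) \<in> borel_measurable (lborel_k k)"
    by (intro borel_measurable_add borel_measurable_times borel_measurable_prod) 
       (auto intro!: measurable_compose[OF measurable_component_singleton])
  then show ?case by (simp add: tensor_fun_def[abs_def] a)
qed (simp add: tensor_fun_def[abs_def])

lemma prod_list_map2_nth:
  "length x = length y \<Longrightarrow> prod_list (map2 f x y) = (\<Prod>j<length x. f (x ! j) (y ! j))"
  by (induction x y rule: list_induct2) (simp_all add: prod.lessThan_Suc_shift del: prod.lessThan_Suc)

lemma elementary_tensor_integral:
  assumes "length x = k" "length y = k" "\<forall>h\<in>set x \<union> set y. L2_density h"
  shows "integrable (lborel_k k) (\<lambda>s. (\<Prod>j<k. cm_density (x ! j) (s j)) * (\<Prod>j<k. cm_density (y ! j) (s j)))"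
    and "(\<integral>s. (\<Prod>j<k. cm_density (x ! j) (s j)) * (\<Prod>j<k. cm_density (y ! j) (s j)) \<partial>lborel_k k)
       = prod_list (map2 cm_inner x y)"
proof -
  interpret product_sigma_finite "\<lambda>_::nat. lborel::real measure" by standard
  have I: "integrable lborel (\<lambda>t. cm_density (x ! j) t * cm_density (y ! j) t)" if "j < k" for j
    using assms that by (intro integrable_mult_L2) (auto simp: L2_density_def)
  show "integrable (lborel_k k) (\<lambda>s. (\<Prod>j<k. cm_density (x ! j) (s j)) * (\<Prod>j<k. cm_density (y ! j) (s j)))"
    unfolding prod.distrib[symmetric] using I by (intro product_integrable_prod) auto
  show "(\<integral>s. (\<Prod>j<k. cm_density (x ! j) (s j)) * (\<Prod>j<k. cm_density (y ! j) (s j)) \<partial>lborel_k k)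
       = prod_list (map2 cm_inner x y)"
    unfolding prod.distrib[symmetric] using I assms
    by (subst product_integral_prod) (auto simp: prod_list_map2_nth cm_inner_eq)
qed

text \<open>Fubini gives the identity for elementary tensors, and both sides are bilinear.\<close>

lemma tensor_inner_integral:
  assumes "tensor_wf k u" "tensor_wf k v"
  shows "integrable (lborel_k k) (\<lambda>s. tensor_fun k u s * tensor_fun k v s)"
    and "tensor_inner u v = (\<integral>s. tensor_fun k u s * tensor_fun k v s \<partial>lborel_k k)"
proof -
  let ?e = "\<lambda>x s. \<Prod>j<k. cm_density (x ! j) (s j)"
  have eq: "tensor_fun k u s * tensor_fun k v s =
     (\<Sum>i<length u. \<Sum>j<length v. fst (u ! i) * fst (v ! j) * (?e (snd (u ! i)) s * ?e (snd (v ! j)) s))"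
       for s
    unfolding tensor_fun_def sum_list_sum_nth sum_product atLeast0LessThan
    by (simp add: case_prod_beta ac_simps)
  have wf: "length (snd (u ! i)) = k" "length (snd (v ! j)) = k"
     "\<forall>h\<in>set (snd (u ! i)) \<union> set (snd (v ! j)). L2_density h" if "i < length u" "j < length v" for i j
    using assms nth_mem[OF that(1)] nth_mem[OF that(2)] unfolding tensor_wf_def
      by (auto simp: case_prod_beta)
  note el = elementary_tensor_integral[OF wf]
  show "integrable (lborel_k k) (\<lambda>s. tensor_fun k u s * tensor_fun k v s)"
    unfolding eq by (intro Bochner_Integration.integrable_sum integrable_mult_right el(1)) auto
  have "(\<integral>s. tensor_fun k u s * tensor_fun k v s \<partial>lborel_k k) =
     (\<Sum>i<length u. \<Sum>j<length v. fst (u ! i) * fst (v ! j)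
       * prod_list (map2 cm_inner (snd (u ! i)) (snd (v ! j))))"
    unfolding eq
    apply (subst Bochner_Integration.integral_sum)
     apply (intro Bochner_Integration.integrable_sum integrable_mult_right el(1); simp)
    apply (intro sum.cong refl)
    apply (subst Bochner_Integration.integral_sum)
     apply (intro integrable_mult_right el(1); simp)
    apply (intro sum.cong refl)
    apply (simp add: el(2))
    done
  then show "tensor_inner u v = (\<integral>s. tensor_fun k u s * tensor_fun k v s \<partial>lborel_k k)"
    unfolding tensor_inner_def sum_list_sum_nth atLeast0LessThan by (simp add: case_prod_beta)
qed

lemma tensor_norm_integral:
  assumes "tensor_wf k u"
  shows "integrable (lborel_k k) (\<lambda>s. (tensor_fun k u s)\<^sup>2)"
    and "tensor_norm u = sqrt (\<integral>s. (tensor_fun k u s)\<^sup>2 \<partial>lborel_k k)"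
  using tensor_inner_integral[OF assms assms] by (auto simp: tensor_norm_def power2_eq_square)

lemma tensor_fun_diff: "tensor_fun k (tensor_diff u v) s = tensor_fun k u s - tensor_fun k v s"
  unfolding tensor_fun_def tensor_diff_def
  by (simp add: o_def case_prod_beta sum_list_subtractf[symmetric] uminus_sum_list_map)

lemma tensor_wf_diff: "tensor_wf k u \<Longrightarrow> tensor_wf k v \<Longrightarrow> tensor_wf k (tensor_diff u v)"
  unfolding tensor_wf_def tensor_diff_def by auto

text \<open>Two elementary tensors with factors in D have inner product at most V^k in modulus, so
  the double sum is at most V^k times the squared l1 norm of the coefficients. A bound on the Gram
  matrix of the directions is all that enters.\<close>

lemma tensor_norm_le:
  assumes V: "\<forall>(c, x)\<in>set u. length x = k \<and> set x \<subseteq> D" "\<forall>h\<in>D. \<forall>g\<in>D. \<bar>cm_inner h g\<bar> \<le> V" "0 \<le> V"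
  shows "tensor_norm u \<le> sqrt (V ^ k) * (\<Sum>(c, x)\<leftarrow>u. \<bar>c\<bar>)"
proof -
  have el: "\<bar>prod_list (map2 cm_inner x y)\<bar> \<le> V ^ k"
    if "length x = k" "length y = k" "set x \<subseteq> D" "set y \<subseteq> D" for x y
  proof -
    have "\<bar>\<Prod>j<k. cm_inner (x ! j) (y ! j)\<bar> \<le> (\<Prod>j<k. V)"
      unfolding abs_prod using that V(2) by (intro prod_mono) (auto simp: subset_iff)
    then show ?thesis using that by (simp add: prod_list_map2_nth)
  qed
  have "tensor_inner u u =
     (\<Sum>i<length u. \<Sum>j<length u. fst (u ! i) * fst (u ! j)
       * prod_list (map2 cm_inner (snd (u ! i)) (snd (u ! j))))"
    unfolding tensor_inner_def sum_list_sum_nth atLeast0LessThan by (simp add: case_prod_beta)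
  also have "\<dots> \<le> (\<Sum>i<length u. \<Sum>j<length u. \<bar>fst (u ! i)\<bar> * \<bar>fst (u ! j)\<bar> * V ^ k)"
  proof (intro sum_mono)
    fix i j assume ij: "i \<in> {..<length u}" "j \<in> {..<length u}"
    have x: "length (snd (u ! i)) = k" "set (snd (u ! i)) \<subseteq> D"
      "length (snd (u ! j)) = k" "set (snd (u ! j)) \<subseteq> D"
      using V(1) nth_mem[of i u] nth_mem[of j u] ij by (auto simp: case_prod_beta)
    have "fst (u ! i) * fst (u ! j) * prod_list (map2 cm_inner (snd (u ! i)) (snd (u ! j)))
        \<le> \<bar>fst (u ! i)\<bar> * \<bar>fst (u ! j)\<bar> * \<bar>prod_list (map2 cm_inner (snd (u ! i)) (snd (u ! j)))\<bar>"
      by (simp add: abs_mult[symmetric])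
    also have "\<dots> \<le> \<bar>fst (u ! i)\<bar> * \<bar>fst (u ! j)\<bar> * V ^ k" using x by (intro mult_left_mono el) auto
    finally show "fst (u ! i) * fst (u ! j) * prod_list (map2 cm_inner (snd (u ! i)) (snd (u ! j)))
        \<le> \<bar>fst (u ! i)\<bar> * \<bar>fst (u ! j)\<bar> * V ^ k" .
  qed
  also have "\<dots> = V ^ k * (\<Sum>(c, x)\<leftarrow>u. \<bar>c\<bar>)\<^sup>2"
    unfolding power2_eq_square sum_list_sum_nth atLeast0LessThan length_map sum_product
    by (simp add: sum_distrib_left case_prod_beta ac_simps)
  finally have "sqrt (tensor_inner u u) \<le> sqrt (V ^ k * (\<Sum>(c, x)\<leftarrow>u. \<bar>c\<bar>)\<^sup>2)"
    by (rule real_sqrt_le_mono)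
  then have "tensor_norm u \<le> sqrt (V ^ k * (\<Sum>(c, x)\<leftarrow>u. \<bar>c\<bar>)\<^sup>2)"
    unfolding tensor_norm_def .
  also have "\<dots> = sqrt (V ^ k) * \<bar>\<Sum>(c, x)\<leftarrow>u. \<bar>c\<bar>\<bar>" by (simp add: real_sqrt_mult)
  also have "\<bar>\<Sum>(c, x)\<leftarrow>u. \<bar>c\<bar>\<bar> = (\<Sum>(c, x)\<leftarrow>u. \<bar>c\<bar>)" by (intro abs_of_nonneg sum_list_nonneg) auto
  finally show ?thesis .
qed

section \<open>Algebra of smooth functionals\<close>

text \<open>Ordered as \<open>malliavin_step\<close> produces its terms, so that its k-fold iterate
  is literally a \<open>map\<close> over this list. Distinctness then turns list sums into sums over
  the set of multi-indices.\<close>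

primrec index_lists :: "nat \<Rightarrow> nat \<Rightarrow> nat list list" where
  "index_lists n 0 = [[]]"
| "index_lists n (Suc k) = concat (map (\<lambda>is. map (\<lambda>i. i # is) [0..<n]) (index_lists n k))"

lemma set_index_lists: "set (index_lists n k) = {is. set is \<subseteq> {..<n} \<and> length is = k}"
proof (induction k)
  case (Suc k)
  show ?case
  proof (intro set_eqI iffI)
    fix xs assume "xs \<in> {is. set is \<subseteq> {..<n} \<and> length is = Suc k}"
    then show "xs \<in> set (index_lists n (Suc k))" using Suc by (cases xs) auto
  qed (use Suc in auto)
qed auto

lemma distinct_index_lists: "distinct (index_lists n k)"
proof (induction k)
  case (Suc k)
  show ?case
  \<comment> \<open>For n = 0 all inner lists are empty and the map producing them is not injective,
    so this case is seen directly.\<close>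
  proof (cases "n = 0")
    case False
    have inj: "inj_on (\<lambda>is. map (\<lambda>i. i # is) [0..<n]) (set (index_lists n k))"
      using False by (auto simp: inj_on_def map_eq_conv)
    have "distinct (map (\<lambda>i. i # is) [0..<n])" for "is"
      by (simp add: distinct_map inj_on_def)
    then show ?thesis using Suc inj
      by (auto simp: distinct_map intro!: distinct_concat)
  next
    case True
    have "distinct (concat (map (\<lambda>_. []) xs))" for xs :: "nat list list" by (induction xs) auto
    then show ?thesis using True by simp
  qed
qed auto

lemma finite_index_set: "finite {is. set is \<subseteq> {..<n::nat} \<and> length is = k}"
  using List.finite_set[of "index_lists n k"] unfolding set_index_lists .

lemma malliavin_step_iter:
  "(malliavin_step n h ^^ k) [(f, [])] = map (\<lambda>is. (iter_partial is f, map h is)) (index_lists n k)"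
proof (induction k)
  case (Suc k)
  then show ?case
    by (simp add: malliavin_step_def map_concat o_def iter_partial_def)
qed (simp add: iter_partial_def)

text \<open>
  \<open>D\<^sup>kF\<close> is realised as a function of \<open>k\<close> time variables: the tensor norm becomes the \<open>L\<^sup>2\<close> norm, which
  makes Minkowski's inequality available.
\<close>

definition deriv_fun :: "nat \<Rightarrow> smooth_data \<Rightarrow> path \<Rightarrow> (nat \<Rightarrow> real) \<Rightarrow> real" where
  "deriv_fun k F w s = (\<Sum>is | set is \<subseteq> {..<arity F} \<and> length is = k.
     iter_partial is (outer F) (\<lambda>i. gauss F i w) * (\<Prod>j<k. cm_density (dir F (is ! j)) (s j)))"

lemma tensor_fun_malliavin: "tensor_fun k (malliavin_deriv k F w) s = deriv_fun k F w s"
  unfolding tensor_fun_def malliavin_deriv_def malliavin_step_iter deriv_fun_def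
  by (simp add: o_def case_prod_beta sum_list_distinct_conv_sum_set distinct_index_lists set_index_lists)


lemma smooth_functional_L2_density:
  assumes "smooth_functional P F" "i < arity F"
  shows "L2_density (dir F i)"
proof -
  let ?d = "deriv (coord (dir F i))"
  have 2: "(\<lambda>s. (cm_density (dir F i) s)\<^sup>2) = (\<lambda>s. indicator {0..} s *\<^sub>R (?d s)\<^sup>2)"
    by (auto simp: cm_density_def indicator_def)
  have 1: "cm_density (dir F i) = (\<lambda>s. indicator {0..} s *\<^sub>R ?d s)"
    by (auto simp: cm_density_def)
  have "wiener_integral P ?d (gauss F i)" using assms unfolding smooth_functional_def by auto
  then show ?thesis
    unfolding wiener_integral_def L2_density_def 2 set_borel_measurable_def set_integrable_def
    unfolding 1 by auto
qed

lemma tensor_wf_malliavin: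
  assumes "smooth_functional P F"
  shows "tensor_wf k (malliavin_deriv k F w)"
  unfolding tensor_wf_def malliavin_deriv_def malliavin_step_iter
  using smooth_functional_L2_density[OF assms] by (auto simp: set_index_lists)

section \<open>Iterated partial derivatives of functions of finitely many coordinates\<close>

lemma smooth_poly_growth_dep:
  "smooth_poly_growth n f \<Longrightarrow> \<forall>x y. (\<forall>i<n. x i = y i) \<longrightarrow> f x = f y"
  unfolding smooth_poly_growth_def by auto

lemma smooth_poly_growth_bound:
  assumes "smooth_poly_growth n f" "set is \<subseteq> {..<n}"
  obtains C N where "\<forall>x. \<bar>iter_partial is f x\<bar> \<le> C * (1 + (\<Sum>i<n. \<bar>x i\<bar>)) ^ N"
  using assms unfolding smooth_poly_growth_def by metis

lemma smooth_poly_growth_cont: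
  "smooth_poly_growth n f \<Longrightarrow> set is \<subseteq> {..<n} \<Longrightarrow> continuous_on UNIV (iter_partial is f)"
  unfolding smooth_poly_growth_def by simp

lemma smooth_poly_growth_diff:
  "smooth_poly_growth n f \<Longrightarrow> set is \<subseteq> {..<n} \<Longrightarrow> i < n \<Longrightarrow>
    (\<lambda>t. iter_partial is f (x(i := t))) differentiable (at (x i))"
  unfolding smooth_poly_growth_def by simp

lemma smooth_poly_growthI:
  assumes "\<And>x y. (\<And>i. i < n \<Longrightarrow> x i = y i) \<Longrightarrow> f x = f y"
    and "\<And>is. set is \<subseteq> {..<n} \<Longrightarrow> continuous_on UNIV (iter_partial is f)"
    and "\<And>is i x. set is \<subseteq> {..<n} \<Longrightarrow> i < n \<Longrightarrow> (\<lambda>t. iter_partial is f (x(i := t))) differentiable (at (x i))"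
    and "\<And>is. set is \<subseteq> {..<n} \<Longrightarrow> \<exists>C N. \<forall>x. \<bar>iter_partial is f x\<bar> \<le> C * (1 + (\<Sum>i<n. \<bar>x i\<bar>)) ^ N"
  shows "smooth_poly_growth n f"
  unfolding smooth_poly_growth_def
  by (intro conjI allI impI assms) auto

lemma partial_cong_coord:
  assumes "\<forall>x y. (\<forall>i<n. x i = y i) \<longrightarrow> f x = f y" "i < n" "\<forall>i<n. x i = y i"
  shows "partial i f x = partial i f y"
proof -
  have "(\<lambda>t. f (x(i := t))) = (\<lambda>t. f (y(i := t)))" using assms by (intro ext assms(1)[rule_format]) auto
  then show ?thesis using assms by (simp add: partial_def)
qed

lemma partial_zero: "partial i (\<lambda>x. 0) = (\<lambda>x. 0)"
  by (auto simp: partial_def)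

lemma partial_other_coord:
  assumes "\<And>x t. f (x(i := t)) = f x"
  shows "partial i f = (\<lambda>x. 0)"
  using assms by (auto simp: partial_def)

lemma iter_partial_Cons: "iter_partial (i # is) f = partial i (iter_partial is f)"
  by (simp add: iter_partial_def)

lemma iter_partial_Nil: "iter_partial [] f = f"
  by (simp add: iter_partial_def)

lemma iter_partial_cong_coord:
  assumes "\<forall>x y. (\<forall>i<n. x i = y i) \<longrightarrow> f x = f y" "set is \<subseteq> {..<n}"
  shows "(\<forall>i<n. x i = y i) \<Longrightarrow> iter_partial is f x = iter_partial is f y"
  using assms(2)
proof (induction "is" arbitrary: x y)
  case (Cons i "is")
  then show ?case unfolding iter_partial_Cons
    by (intro partial_cong_coord[where n=n]) auto
qed (use assms in \<open>auto simp: iter_partial_Nil\<close>)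

text \<open>The first foreign index meets a function that still depends on the first n coordinates
  only and gives zero; further derivatives keep it zero. This disposes of the mixed terms when two
  functionals are put side by side.\<close>

lemma iter_partial_outside:
  assumes "\<forall>x y. (\<forall>i<n. x i = y i) \<longrightarrow> f x = f y" "\<not> set is \<subseteq> {..<n}"
  shows "iter_partial is f = (\<lambda>x. 0)"
  using assms(2)
proof (induction "is")
  case (Cons i "is")
  show ?case
  proof (cases "set is \<subseteq> {..<n}")
    case True
    then have "i \<ge> n" using Cons by auto
    then show ?thesis unfolding iter_partial_Cons
      by (intro partial_other_coord iter_partial_cong_coord[OF assms(1) True]) auto
  next
    case False
    then show ?thesis using Cons by (simp add: iter_partial_Cons partial_zero)
  qed
qed simp

lemma iter_partial_shift:
  "iter_partial (map (\<lambda>i. i + n) is) (\<lambda>x. g (\<lambda>i. x (i + n))) = (\<lambda>x. iter_partial is g (\<lambda>i. x (i + n)))"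
proof (induction "is")
  case (Cons i "is")
  have "(\<lambda>j. (x(i + n := t)) (j + n)) = (\<lambda>j. x (j + n))(i := t)" for x :: "nat \<Rightarrow> real" and t
    by auto
  then show ?case by (simp add: iter_partial_Cons Cons partial_def)
qed (simp add: iter_partial_Nil)

lemma iter_partial_shift_outside:
  assumes "\<not> set is \<subseteq> {n..}"
  shows "iter_partial is (\<lambda>x. g (\<lambda>i. x (i + n))) = (\<lambda>x. 0)"
  using assms
proof (induction "is")
  case (Cons i "is")
  show ?case
  proof (cases "set is \<subseteq> {n..}")
    case True
    then have "i < n" using Cons by auto
    have "is = map (\<lambda>i. i + n) (map (\<lambda>i. i - n) is)" using True by (auto simp: map_idI subset_iff)
    then obtain js where js: "is = map (\<lambda>i. i + n) js" by blast
    show ?thesis unfolding iter_partial_Cons js iter_partial_shift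
      using \<open>i < n\<close> by (intro partial_other_coord arg_cong[where f="iter_partial js g"]) auto
  next
    case False
    then show ?thesis using Cons by (simp add: iter_partial_Cons partial_zero)
  qed
qed simp

lemma partial_add:
  assumes "(\<lambda>t. f (x(i := t))) differentiable (at (x i))" "(\<lambda>t. g (x(i := t))) differentiable (at (x i))"
  shows "partial i (\<lambda>x. f x + g x) x = partial i f x + partial i g x"
proof -
  have "(\<lambda>t. f (x(i := t))) field_differentiable at (x i)"
      "(\<lambda>t. g (x(i := t))) field_differentiable at (x i)"
    using assms real_differentiableE field_differentiable_def by metis+
  then show ?thesis by (simp add: partial_def)
qed

lemma iter_partial_add:
  assumes "smooth_poly_growth n f" "smooth_poly_growth n g" "set is \<subseteq> {..<n}"
  shows "iter_partial is (\<lambda>x. f x + g x) = (\<lambda>x. iter_partial is f x + iter_partial is g x)"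
  using assms(3)
proof (induction "is")
  case (Cons i "is")
  show ?case
  proof
    fix x
    have "(\<lambda>t. iter_partial is f (x(i := t))) differentiable (at (x i))"
      "(\<lambda>t. iter_partial is g (x(i := t))) differentiable (at (x i))"
      using assms Cons.prems unfolding smooth_poly_growth_def by auto
    then show "iter_partial (i # is) (\<lambda>x. f x + g x) x = iter_partial (i # is) f x
        + iter_partial (i # is) g x"
      using Cons by (simp add: iter_partial_Cons partial_add)
  qed
qed (simp add: iter_partial_Nil)

lemma iter_partial_minus:
  assumes "smooth_poly_growth n f" "set is \<subseteq> {..<n}"
  shows "iter_partial is (\<lambda>x. - f x) = (\<lambda>x. - iter_partial is f x)"
  using assms(2)
proof (induction "is")
  case (Cons i "is")
  show ?case
  proof
    fix x
    have "(\<lambda>t. iter_partial is f (x(i := t))) differentiable (at (x i))"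
      using assms Cons.prems unfolding smooth_poly_growth_def by auto
    then have "(\<lambda>t. iter_partial is f (x(i := t))) field_differentiable at (x i)"
      using real_differentiableE field_differentiable_def by metis
    then show "iter_partial (i # is) (\<lambda>x. - f x) x = - iter_partial (i # is) f x"
      using Cons by (simp add: iter_partial_Cons partial_def)
  qed
qed (simp add: iter_partial_Nil)

lemma smooth_poly_growth_add:
  assumes "smooth_poly_growth n f" "smooth_poly_growth n g"
  shows "smooth_poly_growth n (\<lambda>x. f x + g x)"
proof -
  have bound: "\<exists>C N. \<forall>x. \<bar>iter_partial is f x + iter_partial is g x\<bar> \<le> C * (1 + (\<Sum>i<n. \<bar>x i\<bar>)) ^ N"
    if "is": "set is \<subseteq> {..<n}" for "is"
  proof -
    obtain C N where b1: "\<forall>x. \<bar>iter_partial is f x\<bar> \<le> C * (1 + (\<Sum>i<n. \<bar>x i\<bar>)) ^ N"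
      by (rule smooth_poly_growth_bound[OF assms(1) "is"])
    obtain D L where b2: "\<forall>x. \<bar>iter_partial is g x\<bar> \<le> D * (1 + (\<Sum>i<n. \<bar>x i\<bar>)) ^ L"
      by (rule smooth_poly_growth_bound[OF assms(2) "is"])
    \<comment> \<open>As the base is at least 1, both powers are below the one with exponent N + L;
      absolute values guard against negative C and D.\<close>
    have "\<bar>iter_partial is f x + iter_partial is g x\<bar> \<le> (\<bar>C\<bar> + \<bar>D\<bar>) * (1 + (\<Sum>i<n. \<bar>x i\<bar>)) ^ (N + L)" for x
    proof -
      let ?S = "1 + (\<Sum>i<n. \<bar>x i\<bar>)"
      have S: "1 \<le> ?S" by (simp add: sum_nonneg)
      have "C * ?S ^ N \<le> \<bar>C\<bar> * ?S ^ (N + L)" using S by (intro mult_mono power_increasing) auto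
      moreover have "D * ?S ^ L \<le> \<bar>D\<bar> * ?S ^ (N + L)" using S by (intro mult_mono power_increasing) auto
      ultimately show ?thesis using b1[rule_format, of x] b2[rule_format, of x]
        unfolding distrib_right by linarith
    qed
    then show ?thesis by blast
  qed
  have dep: "f x + g x = f y + g y" if "\<And>i. i < n \<Longrightarrow> x i = y i" for x y
    using assms[THEN smooth_poly_growth_dep, rule_format, OF that] by simp
  show ?thesis
  proof (rule smooth_poly_growthI)
    fix "is" assume "is": "set is \<subseteq> {..<n}"
    show "\<exists>C N. \<forall>x. \<bar>iter_partial is (\<lambda>x. f x + g x) x\<bar> \<le> C * (1 + (\<Sum>i<n. \<bar>x i\<bar>)) ^ N"
      unfolding iter_partial_add[OF assms "is"] by (rule bound[OF "is"])
    show "continuous_on UNIV (iter_partial is (\<lambda>x. f x + g x))"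
      unfolding iter_partial_add[OF assms "is"]
      by (intro continuous_on_add smooth_poly_growth_cont[OF _ "is"] assms)
    show "(\<lambda>t. iter_partial is (\<lambda>x. f x + g x) (x(i := t))) differentiable (at (x i))" if "i < n" for i x
      unfolding iter_partial_add[OF assms "is"]
      by (intro differentiable_add smooth_poly_growth_diff[OF _ "is" that] assms)
  qed (rule dep)
qed

lemma smooth_poly_growth_minus:
  assumes "smooth_poly_growth n f"
  shows "smooth_poly_growth n (\<lambda>x. - f x)"
proof -
  have dep: "- f x = - f y" if "\<And>i. i < n \<Longrightarrow> x i = y i" for x y
    using smooth_poly_growth_dep[OF assms, rule_format, OF that] by simp
  show ?thesis
  proof (rule smooth_poly_growthI)
    fix "is" assume "is": "set is \<subseteq> {..<n}"
    show "\<exists>C N. \<forall>x. \<bar>iter_partial is (\<lambda>x. - f x) x\<bar> \<le> C * (1 + (\<Sum>i<n. \<bar>x i\<bar>)) ^ N"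
      unfolding iter_partial_minus[OF assms "is"] abs_minus_cancel
      using smooth_poly_growth_bound[OF assms "is"] by metis
    show "continuous_on UNIV (iter_partial is (\<lambda>x. - f x))"
      unfolding iter_partial_minus[OF assms "is"]
      by (intro continuous_on_minus smooth_poly_growth_cont[OF assms "is"])
    show "(\<lambda>t. iter_partial is (\<lambda>x. - f x) (x(i := t))) differentiable (at (x i))" if "i < n" for i x
      unfolding iter_partial_minus[OF assms "is"]
      by (intro differentiable_minus smooth_poly_growth_diff[OF assms "is" that])
  qed (rule dep)
qed

lemma smooth_poly_growth_mono:
  assumes "smooth_poly_growth n f" "n \<le> m"
  shows "smooth_poly_growth m f"
proof -
  note dep = smooth_poly_growth_dep[OF assms(1)]
  have *: "continuous_on UNIV (iter_partial is f) \<and>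
        (\<forall>i<m. \<forall>x. (\<lambda>t. iter_partial is f (x(i := t))) differentiable (at (x i))) \<and>
        (\<exists>C N. \<forall>x. \<bar>iter_partial is f x\<bar> \<le> C * (1 + (\<Sum>i<m. \<bar>x i\<bar>)) ^ N)" for "is"
  proof (cases "set is \<subseteq> {..<n}")
    case True
    have d: "(\<lambda>t. iter_partial is f (x(i := t))) differentiable (at (x i))" for i x
    proof (cases "i < n")
      case False
      then have "(\<lambda>t. iter_partial is f (x(i := t))) = (\<lambda>t. iter_partial is f x)"
        by (intro ext iter_partial_cong_coord[OF dep True]) auto
      then show ?thesis by simp
    qed (use smooth_poly_growth_diff[OF assms(1) True] in simp)
    obtain C N where CN: "\<forall>x. \<bar>iter_partial is f x\<bar> \<le> C * (1 + (\<Sum>i<n. \<bar>x i\<bar>)) ^ N"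
      by (rule smooth_poly_growth_bound[OF assms(1) True])
    have "\<bar>iter_partial is f x\<bar> \<le> \<bar>C\<bar> * (1 + (\<Sum>i<m. \<bar>x i\<bar>)) ^ N" for x
    proof -
      have "C * (1 + (\<Sum>i<n. \<bar>x i\<bar>)) ^ N \<le> \<bar>C\<bar> * (1 + (\<Sum>i<m. \<bar>x i\<bar>)) ^ N"
        using assms(2) by (intro mult_mono power_mono add_left_mono sum_mono2)
          (auto intro!: add_nonneg_nonneg sum_nonneg)
      then show ?thesis using CN[rule_format, of x] by linarith
    qed
    then show ?thesis using d smooth_poly_growth_cont[OF assms(1) True] by (intro conjI) auto
  next
    case False
    show ?thesis unfolding iter_partial_outside[OF dep False] by (auto intro!: exI[of _ 0])
  qed
  have "f x = f y" if "\<And>i. i < m \<Longrightarrow> x i = y i" for x y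
    by (rule dep[rule_format]) (use that assms(2) in simp)
  then show ?thesis by (rule smooth_poly_growthI) (use * in blast)+
qed

lemma smooth_poly_growth_shift:
  assumes "smooth_poly_growth m g"
  shows "smooth_poly_growth (n + m) (\<lambda>x. g (\<lambda>i. x (i + n)))"
proof -
  note dep = smooth_poly_growth_dep[OF assms]
  let ?g = "\<lambda>x. g (\<lambda>i. x (i + n))"
  have *: "continuous_on UNIV (iter_partial is ?g) \<and>
        (\<forall>i<n + m. \<forall>x. (\<lambda>t. iter_partial is ?g (x(i := t))) differentiable (at (x i))) \<and>
        (\<exists>C N. \<forall>x. \<bar>iter_partial is ?g x\<bar> \<le> C * (1 + (\<Sum>i<n + m. \<bar>x i\<bar>)) ^ N)" if "is": "set is
          \<subseteq> {..<n + m}" for "is"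
  proof (cases "set is \<subseteq> {n..}")
    case True
    have "is = map (\<lambda>i. i + n) (map (\<lambda>i. i - n) is)" using True by (auto simp: map_idI subset_iff)
    then obtain js where js: "is = map (\<lambda>i. i + n) js" by blast
    have jm: "set js \<subseteq> {..<m}" using "is" js by auto
    have eq: "iter_partial is ?g = (\<lambda>x. iter_partial js g (\<lambda>i. x (i + n)))" unfolding js
        iter_partial_shift ..
    have cont: "continuous_on UNIV (\<lambda>x. iter_partial js g (\<lambda>i. x (i + n)))"
    proof (rule continuous_on_compose2[of UNIV "iter_partial js g"])
      show "continuous_on UNIV (iter_partial js g)" by (rule smooth_poly_growth_cont[OF assms jm])
    qed (auto intro!: continuous_on_coordinatewise_then_product)
    have d: "(\<lambda>t. iter_partial js g (\<lambda>j. (x(i := t)) (j + n))) differentiable (at (x i))" for i x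
    proof (cases "n \<le> i \<and> i < n + m")
      case False
      then have "(\<lambda>t. iter_partial js g (\<lambda>j. (x(i := t)) (j + n)))
          = (\<lambda>t. iter_partial js g (\<lambda>j. x (j + n)))"
        by (intro ext iter_partial_cong_coord[OF dep jm]) auto
      then show ?thesis by simp
    next
      case True
      then obtain k where k: "i = k + n" "k < m"
          by (metis le_add_diff_inverse2 add_less_cancel_left add.commute)
      have "(\<lambda>j. (x(i := t)) (j + n)) = (\<lambda>j. x (j + n))(k := t)" for t using k by auto
      moreover have "(\<lambda>t. iter_partial js g ((\<lambda>j. x (j + n))(k := t))) differentiable
          (at ((\<lambda>j. x (j + n)) k))"
        by (rule smooth_poly_growth_diff[OF assms jm k(2)])
      ultimately show ?thesis using k by simp
    qed
    obtain C N where CN: "\<forall>x. \<bar>iter_partial js g x\<bar> \<le> C * (1 + (\<Sum>i<m. \<bar>x i\<bar>)) ^ N"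
      by (rule smooth_poly_growth_bound[OF assms jm])
    have "\<bar>iter_partial js g (\<lambda>i. x (i + n))\<bar> \<le> \<bar>C\<bar> * (1 + (\<Sum>i<n + m. \<bar>x i\<bar>)) ^ N" for x
    proof -
      have "(\<Sum>i<m. \<bar>x (i + n)\<bar>) = (\<Sum>i\<in>{n..<n+m}. \<bar>x i\<bar>)"
        by (rule sum.reindex_bij_witness[of _ "\<lambda>i. i - n" "\<lambda>i. i + n"]) auto
      also have "\<dots> \<le> (\<Sum>i<n + m. \<bar>x i\<bar>)" by (intro sum_mono2) auto
      finally have "C * (1 + (\<Sum>i<m. \<bar>x (i + n)\<bar>)) ^ N \<le> \<bar>C\<bar> * (1 + (\<Sum>i<n + m. \<bar>x i\<bar>)) ^ N"
        by (intro mult_mono power_mono add_left_mono) (auto intro!: add_nonneg_nonneg sum_nonneg)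
      then show ?thesis using CN[rule_format, of "\<lambda>i. x (i + n)"] by linarith
    qed
    then show ?thesis using d cont unfolding eq by (intro conjI) auto
  next
    case False
    show ?thesis unfolding iter_partial_shift_outside[OF False] by (auto intro!: exI[of _ 0])
  qed
  have "?g x = ?g y" if "\<And>i. i < n + m \<Longrightarrow> x i = y i" for x y
    by (rule dep[rule_format]) (use that in simp)
  then show ?thesis by (rule smooth_poly_growthI) (use * in blast)+
qed

section \<open>Zero, negatives and sums of smooth functionals\<close>

definition data_zero :: smooth_data where
  "data_zero = \<lparr>arity = 0, outer = (\<lambda>_. 0), dir = undefined, gauss = undefined\<rparr>"

definition data_neg :: "smooth_data \<Rightarrow> smooth_data" where
  "data_neg F = F\<lparr>outer := (\<lambda>x. - outer F x)\<rparr>"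

text \<open>The Gaussians of G form a fresh block behind those of F even where directions coincide,
  so no common list of directions has to be found.\<close>

definition data_add :: "smooth_data \<Rightarrow> smooth_data \<Rightarrow> smooth_data" where
  "data_add F G = \<lparr>arity = arity F + arity G,
     outer = (\<lambda>x. outer F x + outer G (\<lambda>i. x (i + arity F))),
     dir = (\<lambda>i. if i < arity F then dir F i else dir G (i - arity F)),
     gauss = (\<lambda>i. if i < arity F then gauss F i else gauss G (i - arity F))\<rparr>"

lemma iter_partial_const0: "iter_partial is (\<lambda>_. 0) = (\<lambda>_. 0)"
  by (induction "is") (auto simp: iter_partial_Nil iter_partial_Cons partial_zero)

lemma smooth_data_zero: "smooth_functional P data_zero"
  by (auto simp: smooth_functional_def data_zero_def smooth_poly_growth_def iter_partial_const0)

lemma sval_zero: "sval data_zero w = 0"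
  by (simp add: sval_def data_zero_def)

lemma deriv_fun_zero: "deriv_fun k data_zero w s = 0"
  by (simp add: deriv_fun_def data_zero_def iter_partial_const0)

lemma smooth_data_neg: "smooth_functional P F \<Longrightarrow> smooth_functional P (data_neg F)"
  by (auto simp: smooth_functional_def data_neg_def smooth_poly_growth_minus)

lemma sval_neg: "sval (data_neg F) w = - sval F w"
  by (simp add: sval_def data_neg_def)

lemma deriv_fun_neg: "smooth_functional P F \<Longrightarrow> deriv_fun k (data_neg F) w s = - deriv_fun k F w s"
  unfolding deriv_fun_def smooth_functional_def sum_negf[symmetric]
  by (intro sum.cong refl) (auto simp: data_neg_def iter_partial_minus)

lemma smooth_data_add:
  assumes "smooth_functional P F" "smooth_functional P G"
  shows "smooth_functional P (data_add F G)"
proof -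
  have "smooth_poly_growth (arity F + arity G) (\<lambda>x. outer F x + outer G (\<lambda>i. x (i + arity F)))"
    using assms unfolding smooth_functional_def
    by (intro smooth_poly_growth_add smooth_poly_growth_shift smooth_poly_growth_mono[OF _ le_add1])
      simp_all
  then show ?thesis using assms unfolding smooth_functional_def data_add_def by auto
qed

lemma sval_add:
  assumes "smooth_functional P F"
  shows "sval (data_add F G) w = sval F w + sval G w"
proof -
  have "\<forall>x y. (\<forall>i<arity F. x i = y i) \<longrightarrow> outer F x = outer F y"
    using assms unfolding smooth_functional_def smooth_poly_growth_def by auto
  then have "outer F (\<lambda>i. (if i < arity F then gauss F i else gauss G (i - arity F)) w)
      = outer F (\<lambda>i. gauss F i w)"
    by auto
  then show ?thesis by (simp add: sval_def data_add_def)
qed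

text \<open>The outer function is a sum of one function of the first block and one of the second, so
  multi-indices that mix the blocks contribute nothing. Lists within the first block give the
  derivatives of F, and lists within the second, shifted back, those of G.\<close>

lemma deriv_fun_add:
  assumes F: "smooth_functional P F" and G: "smooth_functional P G"
  shows "deriv_fun k (data_add F G) w s = deriv_fun k F w s + deriv_fun k G w s"
proof -
  let ?n = "arity F" and ?m = "arity G"
  let ?I = "\<lambda>n. {is. set is \<subseteq> {..<n} \<and> length is = k}"
  let ?d = "\<lambda>i. if i < ?n then dir F i else dir G (i - ?n)"
  let ?x = "\<lambda>i. (if i < ?n then gauss F i else gauss G (i - ?n)) w"
  let ?D = "\<lambda>is. \<Prod>j<k. cm_density (?d (is ! j)) (s j)"
  have sF: "smooth_poly_growth ?n (outer F)" and sG: "smooth_poly_growth ?m (outer G)"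
    using F G unfolding smooth_functional_def by auto
  have depF: "\<forall>x y. (\<forall>i<?n. x i = y i) \<longrightarrow> outer F x = outer F y" using sF unfolding smooth_poly_growth_def
      by auto
  have depG: "\<forall>x y. (\<forall>i<?m. x i = y i) \<longrightarrow> outer G x = outer G y" using sG unfolding smooth_poly_growth_def
      by auto
  have "deriv_fun k (data_add F G) w s =
     (\<Sum>is\<in>?I (?n + ?m). iter_partial is (\<lambda>x. outer F x + outer G (\<lambda>i. x (i + ?n))) ?x * ?D is)"
    by (simp add: deriv_fun_def data_add_def)
  also have "\<dots> = (\<Sum>is\<in>?I (?n + ?m). iter_partial is (outer F) ?x * ?D is) +
      (\<Sum>is\<in>?I (?n + ?m). iter_partial is (\<lambda>x. outer G (\<lambda>i. x (i + ?n))) ?x * ?D is)"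
    unfolding sum.distrib[symmetric]
    using iter_partial_add[OF smooth_poly_growth_mono[OF sF, of "?n + ?m"] smooth_poly_growth_shift[OF sG]]
    by (intro sum.cong refl) (simp add: distrib_right)
  also have "(\<Sum>is\<in>?I (?n + ?m). iter_partial is (outer F) ?x * ?D is) =
      (\<Sum>is\<in>?I ?n. iter_partial is (outer F) ?x * ?D is)"
  proof (rule sum.mono_neutral_right[OF finite_index_set], force, rule ballI)
    fix "is" assume "is \<in> ?I (?n + ?m) - ?I ?n"
    then have "\<not> set is \<subseteq> {..<?n}" by auto
    then show "iter_partial is (outer F) ?x * ?D is = 0" by (simp add: iter_partial_outside[OF depF])
  qed
  also have "\<dots> = deriv_fun k F w s"
    unfolding deriv_fun_def
  proof (rule sum.cong[OF refl])
    fix "is" assume "is": "is \<in> ?I ?n"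
    have "iter_partial is (outer F) ?x = iter_partial is (outer F) (\<lambda>i. gauss F i w)"
      using "is" by (intro iter_partial_cong_coord[OF depF]) auto
    moreover have "?D is = (\<Prod>j<k. cm_density (dir F (is ! j)) (s j))"
      using "is" by (intro prod.cong) (auto simp: subset_iff)
    ultimately show "iter_partial is (outer F) ?x * ?D is =
       iter_partial is (outer F) (\<lambda>i. gauss F i w) * (\<Prod>j<k. cm_density (dir F (is ! j)) (s j))" by simp
  qed
  also have "(\<Sum>is\<in>?I (?n + ?m). iter_partial is (\<lambda>x. outer G (\<lambda>i. x (i + ?n))) ?x * ?D is) =
      (\<Sum>is\<in>map (\<lambda>i. i + ?n) ` ?I ?m. iter_partial is (\<lambda>x. outer G (\<lambda>i. x (i + ?n))) ?x * ?D is)"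
  proof (rule sum.mono_neutral_right[OF finite_index_set], force, rule ballI)
    fix "is" assume "is \<in> ?I (?n + ?m) - map (\<lambda>i. i + ?n) ` ?I ?m"
    then have "is": "set is \<subseteq> {..<?n + ?m}" "length is = k" "is \<notin> map (\<lambda>i. i + ?n) ` ?I ?m" by auto
    have "\<not> set is \<subseteq> {?n..}"
    proof
      assume *: "set is \<subseteq> {?n..}"
      have "is = map (\<lambda>i. i + ?n) (map (\<lambda>i. i - ?n) is)" using * by (auto simp: map_idI subset_iff)
      moreover have "map (\<lambda>i. i - ?n) is \<in> ?I ?m" using * "is"(1,2) by (fastforce simp: subset_iff)
      ultimately show False using "is"(3) by blast
    qed
    then show "iter_partial is (\<lambda>x. outer G (\<lambda>i. x (i + ?n))) ?x * ?D is = 0"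
      by (simp add: iter_partial_shift_outside)
  qed
  also have "\<dots> = (\<Sum>is\<in>?I ?m. iter_partial (map (\<lambda>i. i + ?n) is) (\<lambda>x. outer G (\<lambda>i. x (i + ?n))) ?x
      * ?D (map (\<lambda>i. i + ?n) is))"
    by (subst sum.reindex) (auto intro!: inj_on_subset[OF inj_mapI] simp: inj_def)
  also have "\<dots> = deriv_fun k G w s"
    unfolding deriv_fun_def iter_partial_shift by (intro sum.cong refl) auto
  finally show ?thesis .
qed

section \<open>Wiener integrals of step functions\<close>

definition step_valid :: "(real \<times> real \<times> real) list \<Rightarrow> bool" where
  "step_valid l \<longleftrightarrow> (\<forall>(c, a, b)\<in>set l. 0 \<le> a \<and> a \<le> b)"

definition grid :: "nat \<Rightarrow> (nat \<Rightarrow> real) \<Rightarrow> bool" where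
  "grid N \<tau> \<longleftrightarrow> (\<forall>i<N. \<tau> i < \<tau> (Suc i))"

lemma grid_less_iff:
  fixes \<tau> :: "nat \<Rightarrow> real"
  assumes "grid N \<tau>" "i \<le> N" "j \<le> N"
  shows "\<tau> i < \<tau> j \<longleftrightarrow> i < j"
proof -
  have less: "\<tau> i < \<tau> j" if "i < j" "j \<le> N" for i j
    using that
  proof (induction rule: less_Suc_induct)
    case (1 i) then show ?case using assms(1) by (simp add: grid_def)
  next
    case (2 i j k) then show ?case by simp
  qed
  show ?thesis using less[of i j] less[of j i] assms(2,3) by (cases i j rule: linorder_cases) auto
qed

lemma grid_le_iff:
  fixes \<tau> :: "nat \<Rightarrow> real"
  assumes "grid N \<tau>" "i \<le> N" "j \<le> N"
  shows "\<tau> i \<le> \<tau> j \<longleftrightarrow> i \<le> j"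
  using grid_less_iff[OF assms(1,3,2)] by (simp add: not_less[symmetric])

text \<open>The free function \<phi> serves twice: taken to be a path it rewrites the step integral,
  taken to be b \<mapsto> indicator of {..b} at s it rewrites the integrand. Each term telescopes
  over the cells between its end points. Cells are half-open on the left, so the value on a cell is
  the value at its right end point.\<close>

lemma step_grid_sum:
  fixes \<phi> :: "real \<Rightarrow> real"
  assumes \<tau>: "grid N \<tau>"
    and l: "\<forall>(c, a, b)\<in>set l. a \<le> b \<and> a \<in> \<tau> ` {..N} \<and> b \<in> \<tau> ` {..N}"
  shows "(\<Sum>(c, a, b)\<leftarrow>l. c * (\<phi> b - \<phi> a)) = (\<Sum>i<N. step_fun l (\<tau> (Suc i)) * (\<phi> (\<tau> (Suc i)) - \<phi> (\<tau> i)))"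
  using l
proof (induction l)
  case (Cons x l)
  obtain c a b where x: "x = (c, a, b)" by (cases x) auto
  obtain p q where pq: "a = \<tau> p" "b = \<tau> q" "p \<le> N" "q \<le> N" "p \<le> q"
    using Cons.prems grid_le_iff[OF \<tau>] by (auto simp: x)
  have ind: "indicator {a<..b} (\<tau> (Suc i)) = (if i \<in> {p..<q} then 1 else (0::real))" if "i < N" for i
    using grid_less_iff[OF \<tau>, of p "Suc i"] grid_le_iff[OF \<tau>, of "Suc i" q] that pq
      by (auto simp: indicator_def)
  have "(\<Sum>i<N. c * indicator {a<..b} (\<tau> (Suc i)) * (\<phi> (\<tau> (Suc i)) - \<phi> (\<tau> i))) =
      (\<Sum>i<N. if i \<in> {p..<q} then c * (\<phi> (\<tau> (Suc i)) - \<phi> (\<tau> i)) else 0)"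
    by (intro sum.cong refl) (simp add: ind)
  also have "\<dots> = (\<Sum>i\<in>{..<N} \<inter> {p..<q}. c * (\<phi> (\<tau> (Suc i)) - \<phi> (\<tau> i)))"
    by (rule sum.inter_restrict[symmetric]) simp
  also have "{..<N} \<inter> {p..<q} = {p..<q}" using pq by auto
  also have "(\<Sum>i\<in>{p..<q}. c * (\<phi> (\<tau> (Suc i)) - \<phi> (\<tau> i))) = c * (\<phi> b - \<phi> a)"
    unfolding sum_distrib_left[symmetric] using pq sum_Suc_diff'[of p q "\<lambda>i. \<phi> (\<tau> i)"] by simp
  finally have "c * (\<phi> b - \<phi> a) = (\<Sum>i<N. c * indicator {a<..b} (\<tau> (Suc i)) * (\<phi> (\<tau> (Suc i)) - \<phi> (\<tau> i)))" ..
  then show ?case using Cons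
    by (simp add: x step_fun_def distrib_right sum.distrib)
qed (simp add: step_fun_def)

lemma step_int_grid:
  assumes "grid N \<tau>"
    and "\<forall>(c, a, b)\<in>set l. a \<le> b \<and> a \<in> \<tau> ` {..N} \<and> b \<in> \<tau> ` {..N}"
  shows "step_int l w = (\<Sum>i<N. step_fun l (\<tau> (Suc i)) * (coord w (\<tau> (Suc i)) - coord w (\<tau> i)))"
  unfolding step_int_def by (rule step_grid_sum[OF assms])

lemma step_fun_grid:
  assumes \<tau>: "grid N \<tau>"
    and l: "\<forall>(c, a, b)\<in>set l. a \<le> b \<and> a \<in> \<tau> ` {..N} \<and> b \<in> \<tau> ` {..N}"
  shows "step_fun l s = (\<Sum>i<N. step_fun l (\<tau> (Suc i)) * indicator {\<tau> i<..\<tau> (Suc i)} s)"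
proof -
  have ind: "indicator {a<..b} s = indicator {..b} s - (indicator {..a} s :: real)" if "a \<le> b" for a b
    using that by (auto simp: indicator_def)
  have "step_fun l s = (\<Sum>(c, a, b)\<leftarrow>l. c * (indicator {..b} s - indicator {..a} s))"
    unfolding step_fun_def using l by (intro arg_cong[where f=sum_list] map_cong refl) (auto simp: ind)
  also have "\<dots> = (\<Sum>i<N. step_fun l (\<tau> (Suc i)) * (indicator {..\<tau> (Suc i)} s - indicator {..\<tau> i} s))"
    using step_grid_sum[OF assms, of "\<lambda>b. indicator {..b} s"] by simp
  also have "\<dots> = (\<Sum>i<N. step_fun l (\<tau> (Suc i)) * indicator {\<tau> i<..\<tau> (Suc i)} s)"
    using \<tau> by (intro sum.cong refl) (simp add: ind less_imp_le grid_def)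
  finally show ?thesis .
qed

text \<open>Disjointness of the cells kills the cross terms. The window from \<open>p\<close> to
  \<open>q\<close> is kept free because later the energy on one time interval, not only the total
  energy, is needed.\<close>

lemma step_fun_sq_grid:
  assumes \<tau>: "grid N \<tau>"
    and l: "\<forall>(c, a, b)\<in>set l. a \<le> b \<and> a \<in> \<tau> ` {..N} \<and> b \<in> \<tau> ` {..N}"
    and pq: "p \<le> q" "q \<le> N"
  shows "indicator {\<tau> p<..\<tau> q} s * (step_fun l s)\<^sup>2 =
    (\<Sum>i=p..<q. (step_fun l (\<tau> (Suc i)))\<^sup>2 * indicator {\<tau> i<..\<tau> (Suc i)} s)"
proof -
  let ?I = "\<lambda>i. indicator {\<tau> i<..\<tau> (Suc i)} s :: real" and ?v = "\<lambda>i. step_fun l (\<tau> (Suc i))"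
  have disj: "?I i * ?I j = (if i = j then ?I i else 0)" if "i < N" "j < N" for i j
  proof (cases i j rule: linorder_cases)
    case less
    then have "\<tau> (Suc i) \<le> \<tau> j" using grid_le_iff[OF \<tau>, of "Suc i" j] that by auto
    then show ?thesis using less by (auto simp: indicator_def)
  next
    case greater
    then have "\<tau> (Suc j) \<le> \<tau> i" using grid_le_iff[OF \<tau>, of "Suc j" i] that by auto
    then show ?thesis using greater by (auto simp: indicator_def)
  qed (auto simp: indicator_def)
  have sq: "(step_fun l s)\<^sup>2 = (\<Sum>i<N. (?v i)\<^sup>2 * ?I i)"
  proof -
    have "(step_fun l s)\<^sup>2 = (\<Sum>i<N. \<Sum>j<N. ?v i * ?v j * (?I i * ?I j))"
      unfolding step_fun_grid[OF \<tau> l, of s] power2_eq_square sum_product by (simp add: ac_simps)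
    also have "\<dots> = (\<Sum>i<N. \<Sum>j<N. if i = j then (?v i)\<^sup>2 * ?I i else 0)"
      by (intro sum.cong refl) (simp add: disj power2_eq_square)
    finally show ?thesis by simp
  qed
  have res: "indicator {\<tau> p<..\<tau> q} s * ?I i = (if i \<in> {p..<q} then ?I i else 0)" if "i < N" for i
  proof -
    have "\<tau> p \<le> \<tau> i \<longleftrightarrow> p \<le> i" "\<tau> (Suc i) \<le> \<tau> q \<longleftrightarrow> Suc i \<le> q" "\<tau> (Suc i) \<le> \<tau> p \<longleftrightarrow> Suc i \<le> p" "\<tau> q \<le> \<tau> i \<longleftrightarrow> q \<le> i"
      using that pq by (auto intro!: grid_le_iff[OF \<tau>])
    then show ?thesis by (auto simp: indicator_def)
  qed
  have "indicator {\<tau> p<..\<tau> q} s * (step_fun l s)\<^sup>2 = (\<Sum>i<N. (?v i)\<^sup>2 * (indicator {\<tau> p<..\<tau> q} s * ?I i))"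
    unfolding sq sum_distrib_left by (simp add: ac_simps)
  also have "\<dots> = (\<Sum>i<N. if i \<in> {p..<q} then (?v i)\<^sup>2 * ?I i else 0)"
    by (intro sum.cong refl) (simp add: res)
  also have "\<dots> = (\<Sum>i\<in>{..<N} \<inter> {p..<q}. (?v i)\<^sup>2 * ?I i)"
    by (rule sum.inter_restrict[symmetric]) simp
  also have "{..<N} \<inter> {p..<q} = {p..<q}" using pq by auto
  finally show ?thesis .
qed

lemma step_fun_sq_integral:
  assumes \<tau>: "grid N \<tau>"
    and l: "\<forall>(c, a, b)\<in>set l. a \<le> b \<and> a \<in> \<tau> ` {..N} \<and> b \<in> \<tau> ` {..N}"
    and pq: "p \<le> q" "q \<le> N"
  shows "(\<integral>s. indicator {\<tau> p<..\<tau> q} s * (step_fun l s)\<^sup>2 \<partial>lborel) =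
    (\<Sum>i=p..<q. (step_fun l (\<tau> (Suc i)))\<^sup>2 * (\<tau> (Suc i) - \<tau> i))"
proof -
  have "\<tau> i \<le> \<tau> (Suc i)" if "i < q" for i using \<tau> that pq by (simp add: grid_def less_imp_le)
  then show ?thesis
    unfolding step_fun_sq_grid[OF assms]
    using pq by (subst Bochner_Integration.integral_sum)
      (auto simp: integrable_indicator_iff intro!: sum.cong)
qed

lemma step_fun_measurable [measurable]: "step_fun l \<in> borel_measurable borel"
proof (induction l)
  case (Cons x l)
  obtain c a b where "x = (c, a, b)" by (cases x) auto
  then have "step_fun (x # l) = (\<lambda>s. c * indicator {a<..b} s + step_fun l s)"
    by (auto simp: step_fun_def)
  then show ?case using Cons by simp
qed (simp add: step_fun_def[abs_def])

lemma grid_exists: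
  fixes S :: "real set"
  assumes "finite S" "S \<noteq> {}"
  obtains \<tau> N where "\<tau> ` {..N} = S" "grid N \<tau>" "mono \<tau>" "range \<tau> \<subseteq> S"
proof -
  define xs where "xs = sorted_list_of_set S"
  define N where "N = length xs - 1"
  have xs: "set xs = S" "sorted xs" "distinct xs" using assms by (auto simp: xs_def)
  have ne: "xs \<noteq> []" using xs assms by auto
  then have len: "length xs = Suc N" by (simp add: N_def)
  \<comment> \<open>Constant from index N on: the independence clause of
    \<open>wiener_measure\<close> asks for a monotone sequence on all of nat, while
    \<open>grid\<close> is strict up to N only.\<close>
  define \<tau> where "\<tau> i = xs ! min i N" for i
  have 1: "\<tau> ` {..N} = S"
    unfolding xs(1)[symmetric] set_conv_nth \<tau>_def using len by (auto simp: less_Suc_eq_le)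
  have 2: "grid N \<tau>"
    using xs len sorted_wrt_nth_less[of "(<)" xs] by (auto simp: grid_def \<tau>_def strict_sorted_iff)
  have 3: "mono \<tau>"
    using xs len by (auto simp: \<tau>_def mono_def intro!: sorted_nth_mono)
  have 4: "range \<tau> \<subseteq> S"
    unfolding xs(1)[symmetric] using len by (auto simp: \<tau>_def)
  show ?thesis by (rule that[OF 1 2 3 4])
qed

section \<open>Gaussian law of the step integrals\<close>

lemma (in prob_space) normal_sum:
  fixes D :: "nat \<Rightarrow> 'a \<Rightarrow> real"
  assumes indep: "indep_vars (\<lambda>_. borel) D {..<N}"
    and dist: "\<And>i. i < N \<Longrightarrow> distributed M lborel (D i) (normal_density 0 (sqrt (\<delta> i)))"
    and \<delta>: "\<And>i. i < N \<Longrightarrow> 0 < \<delta> i" and I: "I \<subseteq> {..<N}"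
    and pos: "0 < (\<Sum>i\<in>I. (v i)\<^sup>2 * \<delta> i)"
  shows "distributed M lborel (\<lambda>x. \<Sum>i\<in>I. v i * D i x) (normal_density 0 (sqrt (\<Sum>i\<in>I. (v i)\<^sup>2 * \<delta> i)))"
proof -
  \<comment> \<open>Vanishing coefficients would give degenerate normal laws and are removed;
    positive total variance leaves at least one index.\<close>
  define A where "A = {i\<in>I. v i \<noteq> 0}"
  have fin: "finite I" "finite A" using finite_subset[OF I] by (auto simp: A_def)
  have eq: "(\<Sum>i\<in>I. f i) = (\<Sum>i\<in>A. f i)" if "\<And>i. v i = 0 \<Longrightarrow> f i = 0" for f :: "nat \<Rightarrow> real"
    using fin that by (intro sum.mono_neutral_right) (auto simp: A_def)
  have ne: "A \<noteq> {}" using pos eq[of "\<lambda>i. (v i)\<^sup>2 * \<delta> i"] by auto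
  have AN: "A \<subseteq> {..<N}" using I by (auto simp: A_def)
  have "distributed M lborel (\<lambda>x. \<Sum>i\<in>A. v i * D i x)
      (normal_density (\<Sum>i\<in>A. 0) (sqrt (\<Sum>i\<in>A. (\<bar>v i\<bar> * sqrt (\<delta> i))\<^sup>2)))"
  proof (rule sum_indep_normal[OF fin(2) ne])
    show "indep_vars (\<lambda>_. borel) (\<lambda>i x. v i * D i x) A"
      using indep_vars_compose2[OF indep_vars_subset[OF indep AN], of "\<lambda>i x. v i * x" "\<lambda>_. borel"] by simp
    fix i assume i: "i \<in> A"
    show "0 < \<bar>v i\<bar> * sqrt (\<delta> i)" using i \<delta> AN by (auto simp: A_def)
    show "distributed M lborel (\<lambda>x. v i * D i x) (normal_density 0 (\<bar>v i\<bar> * sqrt (\<delta> i)))"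
      using normal_density_affine[OF dist[of i], of "v i" 0] i \<delta> AN by (auto simp: A_def subset_iff)
  qed
  moreover have "(\<Sum>i\<in>A. (\<bar>v i\<bar> * sqrt (\<delta> i))\<^sup>2) = (\<Sum>i\<in>A. (v i)\<^sup>2 * \<delta> i)"
    using \<delta> AN by (intro sum.cong refl) (auto simp: power_mult_distrib subset_iff less_imp_le)
  ultimately show ?thesis by (simp add: eq)
qed

text \<open>The moment of order 2m of the standard normal law, that is (2m - 1)!!.\<close>

definition gauss_moment :: "nat \<Rightarrow> real" where
  "gauss_moment m = fact (2 * m) / (2 ^ m * fact m)"

lemma (in prob_space) normal_even_moment:
  assumes "distributed M lborel X (normal_density 0 \<sigma>)" "0 < \<sigma>"
  shows "integrable M (\<lambda>x. X x ^ (2 * m))" "expectation (\<lambda>x. X x ^ (2 * m)) = (\<sigma>\<^sup>2) ^ m * gauss_moment m"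
proof -
  have h: "has_bochner_integral lborel (\<lambda>x. normal_density 0 \<sigma> x * x ^ (2 * m))
      (fact (2 * m) / ((2 / \<sigma>\<^sup>2) ^ m * fact m))"
    using normal_moment_even[OF assms(2), of 0 m] by simp
  then show "integrable M (\<lambda>x. X x ^ (2 * m))"
    using distributed_integrable[OF assms(1), of "\<lambda>x. x ^ (2 * m)"] by (simp add: has_bochner_integral_iff)
  have "expectation (\<lambda>x. X x ^ (2 * m)) = fact (2 * m) / ((2 / \<sigma>\<^sup>2) ^ m * fact m)"
    using distributed_integral[OF assms(1), of "\<lambda>x. x ^ (2 * m)"] h by (simp add: has_bochner_integral_iff)
  then show "expectation (\<lambda>x. X x ^ (2 * m)) = (\<sigma>\<^sup>2) ^ m * gauss_moment m"
    by (simp add: gauss_moment_def power_divide)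
qed

section \<open>Increments and step integrals under Wiener measure\<close>

locale wiener_space =
  fixes P :: "path measure"
  assumes wiener: "wiener_measure P"
begin

sublocale prob_space P using wiener by (simp add: wiener_measure_def)

lemma increment_law:
  "0 \<le> s \<Longrightarrow> s < t \<Longrightarrow> distributed P lborel (\<lambda>w. coord w t - coord w s) (normal_density 0 (sqrt (t - s)))"
  using wiener by (simp add: wiener_measure_def)

lemma increments_indep:
  "0 \<le> \<tau> 0 \<Longrightarrow> mono \<tau> \<Longrightarrow> indep_vars (\<lambda>_. borel) (\<lambda>i w. coord w (\<tau> (Suc i)) - coord w (\<tau> i)) {..<n}"
  using wiener by (simp add: wiener_measure_def)

lemma increment_measurable: "0 \<le> s \<Longrightarrow> s \<le> t \<Longrightarrow> (\<lambda>w. coord w t - coord w s) \<in> borel_measurable P"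
  using distributed_measurable[OF increment_law[of s t]] by (cases "s = t") auto

lemma step_int_measurable: "step_valid l \<Longrightarrow> step_int l \<in> borel_measurable P"
proof (induction l)
  case (Cons x l)
  obtain c a b where x: "x = (c, a, b)" by (cases x) auto
  then have "step_int (x # l) = (\<lambda>w. c * (coord w b - coord w a) + step_int l w)"
    by (auto simp: step_int_def)
  then show ?case using Cons increment_measurable[of a b] by (auto simp: step_valid_def x)
qed (simp add: step_int_def[abs_def])

text \<open>On a grid the integral is a linear form in independent Gaussian increments, hence
  centred Gaussian with variance the squared L2 norm of the integrand. The case m = 1 is the Ito
  isometry.\<close>

lemma step_moment:
  assumes "step_valid l"
  shows "integrable lborel (\<lambda>s. (step_fun l s)\<^sup>2)"
    and "integrable P (\<lambda>w. step_int l w ^ (2 * m))"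
    and "expectation (\<lambda>w. step_int l w ^ (2 * m)) = (\<integral>s. (step_fun l s)\<^sup>2 \<partial>lborel) ^ m * gauss_moment m"
proof -
  \<comment> \<open>The point 0 makes the grid nonempty when l is the empty list.\<close>
  let ?S = "insert 0 ((\<lambda>(c, a, b). a) ` set l \<union> (\<lambda>(c, a, b). b) ` set l)"
  obtain \<tau> N where \<tau>: "\<tau> ` {..N} = ?S" "grid N \<tau>" "mono \<tau>" "range \<tau> \<subseteq> ?S"
    by (rule grid_exists[of ?S]) auto
  have l: "\<forall>(c, a, b)\<in>set l. a \<le> b \<and> a \<in> \<tau> ` {..N} \<and> b \<in> \<tau> ` {..N}"
  proof (rule ballI, clarify)
    fix c a b assume *: "(c, a, b) \<in> set l"
    then have "a \<in> ?S" "b \<in> ?S" by (auto intro!: rev_image_eqI[OF *])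
    moreover have "a \<le> b" using assms * by (auto simp: step_valid_def)
    ultimately show "a \<le> b \<and> a \<in> \<tau> ` {..N} \<and> b \<in> \<tau> ` {..N}" unfolding \<tau>(1) by blast
  qed
  have nn: "0 \<le> a \<and> 0 \<le> b" if "(c, a, b) \<in> set l" for c a b
  proof -
    have "0 \<le> a \<and> a \<le> b" using assms that unfolding step_valid_def by (auto dest!: bspec)
    then show ?thesis by linarith
  qed
  have S0: "0 \<le> x" if "x \<in> ?S" for x using that nn by auto
  have pos: "0 \<le> \<tau> i" for i by (rule S0[OF subsetD[OF \<tau>(4) rangeI]])
  let ?v = "\<lambda>i. step_fun l (\<tau> (Suc i))" and ?\<delta> = "\<lambda>i. \<tau> (Suc i) - \<tau> i"
  have out: "indicator {\<tau> 0<..\<tau> N} s * (step_fun l s)\<^sup>2 = (step_fun l s)\<^sup>2" for s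
  proof (cases "s \<in> {\<tau> 0<..\<tau> N}")
    case False
    have "step_fun l s = 0"
    proof (subst step_fun_grid[OF \<tau>(2) l], intro sum.neutral ballI)
      fix i assume "i \<in> {..<N}"
      then have "\<tau> 0 \<le> \<tau> i" "\<tau> (Suc i) \<le> \<tau> N" using \<tau>(3) by (auto simp: mono_def)
      then show "step_fun l (\<tau> (Suc i)) * indicator {\<tau> i<..\<tau> (Suc i)} s = 0"
        using False by (auto simp: indicator_def)
    qed
    then show ?thesis by simp
  qed simp
  have sq: "(\<lambda>s. (step_fun l s)\<^sup>2) = (\<lambda>s. \<Sum>i=0..<N. (?v i)\<^sup>2 * indicator {\<tau> i<..\<tau> (Suc i)} s)"
    by (rule ext) (rule trans[OF out[symmetric] step_fun_sq_grid[OF \<tau>(2) l le0 order_refl]])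
  show "integrable lborel (\<lambda>s. (step_fun l s)\<^sup>2)"
    unfolding sq using \<tau>(3)
    by (intro Bochner_Integration.integrable_sum integrable_mult_right)
      (auto simp: integrable_indicator_iff mono_def)
  have int: "(\<integral>s. (step_fun l s)\<^sup>2 \<partial>lborel) = (\<Sum>i<N. (?v i)\<^sup>2 * ?\<delta> i)"
    using step_fun_sq_integral[OF \<tau>(2) l, of 0 N] unfolding out by (simp add: atLeast0LessThan)
  have eq: "step_int l = (\<lambda>w. \<Sum>i<N. ?v i * (coord w (\<tau> (Suc i)) - coord w (\<tau> i)))"
    by (rule ext) (rule step_int_grid[OF \<tau>(2) l])
  have "integrable P (\<lambda>w. step_int l w ^ (2 * m)) \<and>
    expectation (\<lambda>w. step_int l w ^ (2 * m)) = (\<integral>s. (step_fun l s)\<^sup>2 \<partial>lborel) ^ m * gauss_moment m"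
  proof (cases "0 < (\<Sum>i<N. (?v i)\<^sup>2 * ?\<delta> i)")
    case True
    have "distributed P lborel (step_int l) (normal_density 0 (sqrt (\<Sum>i<N. (?v i)\<^sup>2 * ?\<delta> i)))"
      unfolding eq
      by (rule normal_sum[OF increments_indep[OF pos \<tau>(3), of N] increment_law[OF pos] _ _ True])
         (use \<tau>(2) in \<open>auto simp: grid_def\<close>)
    from normal_even_moment[OF this] True show ?thesis unfolding int by simp
  next
    \<comment> \<open>Degenerate case: all cell values vanish, so the integral is identically 0; for
      m = 0 both sides are 1 by 0^0 = 1.\<close>
    case False
    have nn: "0 \<le> (?v i)\<^sup>2 * ?\<delta> i" if "i < N" for i using \<tau>(2) that by (simp add: grid_def less_imp_le)
    then have z: "(\<Sum>i<N. (?v i)\<^sup>2 * ?\<delta> i) = 0" using False by (intro antisym sum_nonneg) auto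
    then have "\<forall>i\<in>{..<N}. (?v i)\<^sup>2 * ?\<delta> i = 0" using nn by (subst (asm) sum_nonneg_eq_0_iff) auto
    then have "?v i = 0" if "i < N" for i using that \<tau>(2) by (force simp: grid_def)
    then have "step_int l = (\<lambda>w. 0)" unfolding eq by simp
    then show ?thesis unfolding int z by (cases m) (simp_all add: gauss_moment_def prob_space)
  qed
  then show "integrable P (\<lambda>w. step_int l w ^ (2 * m))"
    "expectation (\<lambda>w. step_int l w ^ (2 * m)) = (\<integral>s. (step_fun l s)\<^sup>2 \<partial>lborel) ^ m * gauss_moment m" by auto
qed

end

section \<open>Gaussian smoothing along independent blocks\<close>

lemma gauss_kernel_integral:
  fixes u l :: real
  assumes "0 < l"
  shows "(\<integral>\<^sup>+v. ennreal (exp (- (l * (u + v))\<^sup>2 / 2)) \<partial>lborel) = ennreal (sqrt (2 * pi) / l)"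
proof -
  have eq: "exp (- (l * (u + v))\<^sup>2 / 2) = sqrt (2 * pi) / l * normal_density (- u) (1 / l) v" for v
    using assms by (simp add: normal_density_def real_sqrt_divide real_sqrt_mult power_divide divide_simps
      power_mult_distrib ac_simps)
  have "(\<integral>\<^sup>+v. ennreal (normal_density (- u) (1 / l) v) \<partial>lborel) = 1"
    using assms by (subst nn_integral_eq_integral)
      (auto simp: integrable_normal_density integral_normal_density)
  then show ?thesis
  proof -
    assume 1: "(\<integral>\<^sup>+v. ennreal (normal_density (- u) (1 / l) v) \<partial>lborel) = 1"
    have "(\<integral>\<^sup>+v. ennreal (exp (- (l * (u + v))\<^sup>2 / 2)) \<partial>lborel) =
        (\<integral>\<^sup>+v. ennreal (sqrt (2 * pi) / l) * ennreal (normal_density (- u) (1 / l) v) \<partial>lborel)"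
      unfolding eq by (intro nn_integral_cong ennreal_mult'') simp
    also have "\<dots> = ennreal (sqrt (2 * pi) / l)"
      by (subst nn_integral_cmult) (auto simp: 1)
    finally show ?thesis .
  qed
qed

text \<open>
  \<open>indep_var\<close> wants both variables in the same type, whence the dummy second component of the pair with \<open>V\<close>.
\<close>

lemma (in prob_space) gauss_smoothing_step:
  assumes ind: "indep_var (borel \<Otimes>\<^sub>M borel) (\<lambda>w. (F w, U w)) (borel \<Otimes>\<^sub>M borel) (\<lambda>w. (V w, 0::real))"
    and F: "\<And>w. 0 \<le> F w" "F \<in> borel_measurable M" and U[measurable]: "U \<in> borel_measurable M"
    and V: "distributed M lborel V (normal_density 0 \<sigma>)" and \<sigma>: "0 < \<sigma>" and l: "0 < l"
  shows "(\<integral>\<^sup>+w. ennreal (F w * exp (- (l * (U w + V w))\<^sup>2 / 2)) \<partial>M) \<le> (\<integral>\<^sup>+w. ennreal (F w) \<partial>M)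
      * ennreal (1 / (l * \<sigma>))"
proof -
  have [measurable]: "F \<in> borel_measurable M" by fact
  have Vm[measurable]: "V \<in> borel_measurable M" using distributed_measurable[OF V] by simp
  let ?p = "\<lambda>w. (F w, U w)"
  let ?V = "\<lambda>w. (V w, 0::real)" and ?D = "distr M (borel \<Otimes>\<^sub>M borel) (\<lambda>w. (V w, 0::real))"
  let ?g = "\<lambda>z. ennreal (fst (fst z)) * ennreal (exp (- (l * (snd (fst z) + fst (snd z)))\<^sup>2 / 2))"
  have pm[measurable]: "?p \<in> measurable M (borel \<Otimes>\<^sub>M borel)" by simp
  have pair: "distr M (borel \<Otimes>\<^sub>M borel) ?p \<Otimes>\<^sub>M ?D =
      distr M ((borel \<Otimes>\<^sub>M borel) \<Otimes>\<^sub>M (borel \<Otimes>\<^sub>M borel)) (\<lambda>w. (?p w, ?V w))"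
    using ind unfolding indep_var_distribution_eq by auto
  interpret V: prob_space "?D" by (rule prob_space_distr) simp
  have gm[measurable]: "?g \<in> borel_measurable ((borel \<Otimes>\<^sub>M borel) \<Otimes>\<^sub>M (borel \<Otimes>\<^sub>M borel))" by measurable
  have inner: "(\<integral>\<^sup>+v. ennreal (exp (- (l * (u + fst v))\<^sup>2 / 2)) \<partial>?D) \<le> ennreal (1 / (l * \<sigma>))" for u
  proof -
    have "(\<integral>\<^sup>+v. ennreal (exp (- (l * (u + fst v))\<^sup>2 / 2)) \<partial>?D) =
        (\<integral>\<^sup>+w. ennreal (exp (- (l * (u + V w))\<^sup>2 / 2)) \<partial>M)"
      by (subst nn_integral_distr) auto
    also have "\<dots> = (\<integral>\<^sup>+v. ennreal (normal_density 0 \<sigma> v) * ennreal (exp (- (l * (u + v))\<^sup>2 / 2)) \<partial>lborel)"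
      using distributed_nn_integral[OF V, of "\<lambda>v. ennreal (exp (- (l * (u + v))\<^sup>2 / 2))"] by simp
    \<comment> \<open>The density of V is replaced by its maximum. The integral over v is then
      translation invariant, so the shift u disappears from the bound.\<close>
    also have "\<dots> \<le> (\<integral>\<^sup>+v. ennreal (1 / (sqrt (2 * pi) * \<sigma>)) * ennreal (exp (- (l * (u + v))\<^sup>2 / 2))
        \<partial>lborel)"
      using \<sigma> by (intro nn_integral_mono mult_right_mono ennreal_leI)
        (auto simp: normal_density_def real_sqrt_mult divide_simps)
    also have "\<dots> = ennreal (1 / (sqrt (2 * pi) * \<sigma>)) * ennreal (sqrt (2 * pi) / l)"
      by (subst nn_integral_cmult) (simp_all only: gauss_kernel_integral[OF l], measurable)
    also have "\<dots> = ennreal (1 / (l * \<sigma>))"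
      using l \<sigma> by (simp add: ennreal_mult[symmetric] divide_simps)
    finally show ?thesis .
  qed
  have "(\<integral>\<^sup>+w. ennreal (F w * exp (- (l * (U w + V w))\<^sup>2 / 2)) \<partial>M) = (\<integral>\<^sup>+w. ?g (?p w, ?V w) \<partial>M)"
    using F by (simp add: ennreal_mult)
  also have "\<dots> = (\<integral>\<^sup>+z. ?g z \<partial>distr M ((borel \<Otimes>\<^sub>M borel) \<Otimes>\<^sub>M (borel \<Otimes>\<^sub>M borel)) (\<lambda>w. (?p w, ?V w)))"
    by (subst nn_integral_distr) auto
  also have "\<dots> = (\<integral>\<^sup>+y. \<integral>\<^sup>+v. ?g (y, v) \<partial>?D \<partial>distr M (borel \<Otimes>\<^sub>M borel) ?p)"
    unfolding pair[symmetric] by (rule V.nn_integral_fst[symmetric])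
      (simp add: measurable_distr_eq1 cong: measurable_cong_sets)
  also have "\<dots> \<le> (\<integral>\<^sup>+y. ennreal (fst y) * ennreal (1 / (l * \<sigma>)) \<partial>distr M (borel \<Otimes>\<^sub>M borel) ?p)"
  proof (intro nn_integral_mono)
    fix y :: "real \<times> real"
    obtain x u where y: "y = (x, u)" by force
    have "(\<integral>\<^sup>+v. ?g (y, v) \<partial>?D) = ennreal x * (\<integral>\<^sup>+v. ennreal (exp (- (l * (u + fst v))\<^sup>2 / 2)) \<partial>?D)"
      unfolding y by (simp add: nn_integral_cmult)
    also have "\<dots> \<le> ennreal x * ennreal (1 / (l * \<sigma>))" by (intro mult_left_mono inner) auto
    finally show "(\<integral>\<^sup>+v. ?g (y, v) \<partial>?D) \<le> ennreal (fst y) * ennreal (1 / (l * \<sigma>))" by (simp add: y)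
  qed
  also have "\<dots> = (\<integral>\<^sup>+w. ennreal (F w) * ennreal (1 / (l * \<sigma>)) \<partial>M)"
    by (subst nn_integral_distr) auto
  also have "\<dots> = (\<integral>\<^sup>+w. ennreal (F w) \<partial>M) * ennreal (1 / (l * \<sigma>))"
    by (rule nn_integral_multc) simp
  finally show ?thesis .
qed

text \<open>Factor j sees the increments before b (Suc j) and is nondegenerate on its own block from
  b j on. Peel off the last factor: its block is independent of all earlier factors and of its own
  past part, which merely acts as a shift. So the factor is paid for with the standard deviation of
  the block alone. The hypotheses involving J stand in the conclusion because the induction shrinks
  them.\<close>

lemma (in prob_space) sequential_gauss_bound:
  fixes D :: "nat \<Rightarrow> 'a \<Rightarrow> real" and c :: "nat \<Rightarrow> nat \<Rightarrow> real"
  assumes indep: "indep_vars (\<lambda>_. borel) D {..<N}"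
    and dist: "\<And>i. i < N \<Longrightarrow> distributed M lborel (D i) (normal_density 0 (sqrt (\<delta> i)))"
    and \<delta>: "\<And>i. i < N \<Longrightarrow> 0 < \<delta> i" and l: "0 < l"
  shows "(\<And>j. j < J \<Longrightarrow> b j \<le> b (Suc j)) \<Longrightarrow> b J \<le> N \<Longrightarrow>
    (\<And>j i. j < J \<Longrightarrow> b (Suc j) \<le> i \<Longrightarrow> i < N \<Longrightarrow> c j i = 0) \<Longrightarrow>
    (\<And>j. j < J \<Longrightarrow> 0 < (\<Sum>i=b j..<b (Suc j). (c j i)\<^sup>2 * \<delta> i)) \<Longrightarrow>
    (\<integral>\<^sup>+w. ennreal (\<Prod>j<J. exp (- (l * (\<Sum>i<N. c j i * D i w))\<^sup>2 / 2)) \<partial>M)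
      \<le> ennreal (\<Prod>j<J. 1 / (l * sqrt (\<Sum>i=b j..<b (Suc j). (c j i)\<^sup>2 * \<delta> i)))"
proof (induction J)
  case 0
  then show ?case by (simp add: emeasure_space_1)
next
  case (Suc J)
  let ?F = "\<lambda>w. \<Prod>j<J. exp (- (l * (\<Sum>i<N. c j i * D i w))\<^sup>2 / 2)"
  let ?A = "{..<b J}" and ?B = "{b J..<b (Suc J)}"
  let ?U = "\<lambda>w. \<Sum>i\<in>?A. c J i * D i w" and ?V = "\<lambda>w. \<Sum>i\<in>?B. c J i * D i w"
  let ?\<sigma> = "sqrt (\<Sum>i\<in>?B. (c J i)\<^sup>2 * \<delta> i)"
  have bJ: "b J \<le> b (Suc J)" "b (Suc J) \<le> N" using Suc.prems by auto
  have "b (Suc j) \<le> b k" if "Suc j \<le> k" "k \<le> J" for j k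
    using that
  proof (induction k rule: dec_induct)
    case (step k)
    then show ?case using Suc.prems(1)[of k] by simp
  qed simp
  then have bmono: "b (Suc j) \<le> b J" if "j < J" for j using that by simp
  have sub: "(\<Sum>i<N. c j i * D i w) = (\<Sum>i<b (Suc j). c j i * D i w)" if "j < Suc J" for j w
  proof (rule sum.mono_neutral_right)
    have "b (Suc j) \<le> N" using bmono[of j] bJ that by (cases "j = J") auto
    then show "{..<b (Suc j)} \<subseteq> {..<N}" by auto
    show "\<forall>i\<in>{..<N} - {..<b (Suc j)}. c j i * D i w = 0" using Suc.prems(3)[OF that] by auto
  qed simp
  have D[measurable]: "D i \<in> borel_measurable M" if "i < N" for i
    using indep that unfolding indep_vars_def by auto
  have sumA: "(\<Sum>i<N. c j i * D i w) = (\<Sum>i\<in>?A. c j i * restrict (\<lambda>i. D i w) ?A i)" if "j < J" for j w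
    unfolding sub[OF less_SucI[OF that]] using bmono[OF that] Suc.prems(3)[of j] bJ that
    by (intro sum.mono_neutral_cong_left) auto
  have ind0: "indep_var (PiM ?A (\<lambda>_. borel)) (\<lambda>w. restrict (\<lambda>i. D i w) ?A)
      (PiM ?B (\<lambda>_. borel)) (\<lambda>w. restrict (\<lambda>i. D i w) ?B)"
    using bJ by (intro indep_var_restrict[OF indep]) auto
  let ?Y1 = "\<lambda>x. (\<Prod>j<J. exp (- (l * (\<Sum>i\<in>?A. c j i * x i))\<^sup>2 / 2), \<Sum>i\<in>?A. c J i * x i)"
  let ?Y2 = "\<lambda>x. (\<Sum>i\<in>?B. c J i * x i, 0::real)"
  have "indep_var (borel \<Otimes>\<^sub>M borel) (?Y1 \<circ> (\<lambda>w. restrict (\<lambda>i. D i w) ?A)) (borel \<Otimes>\<^sub>M borel)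
      (?Y2 \<circ> (\<lambda>w. restrict (\<lambda>i. D i w) ?B))"
    by (rule indep_var_compose[OF ind0]) measurable
  moreover have "?Y1 \<circ> (\<lambda>w. restrict (\<lambda>i. D i w) ?A) = (\<lambda>w. (?F w, ?U w))"
    by (auto simp: fun_eq_iff sumA)
  moreover have "?Y2 \<circ> (\<lambda>w. restrict (\<lambda>i. D i w) ?B) = (\<lambda>w. (?V w, 0))" by (auto simp: fun_eq_iff)
  ultimately have ind: "indep_var (borel \<Otimes>\<^sub>M borel) (\<lambda>w. (?F w, ?U w)) (borel \<Otimes>\<^sub>M borel) (\<lambda>w. (?V w, 0))"
      by simp
  have V: "distributed M lborel ?V (normal_density 0 ?\<sigma>)"
    using bJ Suc.prems(4)[of J] by (intro normal_sum[OF indep dist \<delta>]) auto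
  have UV: "(\<Sum>i<N. c J i * D i w) = ?U w + ?V w" for w
  proof -
    have "(\<Sum>i<N. c J i * D i w) = (\<Sum>i\<in>?A \<union> ?B. c J i * D i w)"
      unfolding sub[OF lessI] using bJ by (intro sum.cong) auto
    also have "\<dots> = ?U w + ?V w" by (rule sum.union_disjoint) auto
    finally show ?thesis .
  qed
  have "(\<integral>\<^sup>+w. ennreal (\<Prod>j<Suc J. exp (- (l * (\<Sum>i<N. c j i * D i w))\<^sup>2 / 2)) \<partial>M) =
      (\<integral>\<^sup>+w. ennreal (?F w * exp (- (l * (?U w + ?V w))\<^sup>2 / 2)) \<partial>M)"
    by (simp add: UV)
  also have "\<dots> \<le> (\<integral>\<^sup>+w. ennreal (?F w) \<partial>M) * ennreal (1 / (l * ?\<sigma>))"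
    using bJ Suc.prems(4)[of J] by (intro gauss_smoothing_step[OF ind _ _ _ V _ l] prod_nonneg)
      (auto intro!: borel_measurable_sum)
  also have "\<dots> \<le> ennreal (\<Prod>j<J. 1 / (l * sqrt (\<Sum>i=b j..<b (Suc j). (c j i)\<^sup>2 * \<delta> i)))
      * ennreal (1 / (l * ?\<sigma>))"
    using Suc.prems(1)[OF less_SucI] Suc.prems(3)[OF less_SucI] Suc.prems(4)[OF less_SucI]
      order_trans[OF bJ]
    by (intro mult_right_mono Suc.IH) simp_all
  also have "\<dots> = ennreal (\<Prod>j<Suc J. 1 / (l * sqrt (\<Sum>i=b j..<b (Suc j). (c j i)\<^sup>2 * \<delta> i)))"
  proof -
    have "0 \<le> (\<Prod>j<J. 1 / (l * sqrt (\<Sum>i=b j..<b (Suc j). (c j i)\<^sup>2 * \<delta> i)))"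
      using l Suc.prems(4) by (intro prod_nonneg) (auto intro!: mult_nonneg_nonneg simp: less_imp_le)
    then show ?thesis using l Suc.prems(4)[of J]
        by (simp only: prod.lessThan_Suc) (subst ennreal_mult, auto)
  qed
  finally show ?case .
qed

section \<open>From step functions to general Wiener integrals\<close>

lemma L2_diff:
  fixes f g :: "'a \<Rightarrow> real"
  assumes [measurable]: "f \<in> borel_measurable M" "g \<in> borel_measurable M"
    and "integrable M (\<lambda>x. (f x)\<^sup>2)" "integrable M (\<lambda>x. (g x)\<^sup>2)"
  shows "integrable M (\<lambda>x. (f x - g x)\<^sup>2)"
    and "(\<integral>x. (f x - g x)\<^sup>2 \<partial>M) \<le> 2 * (\<integral>x. (f x)\<^sup>2 \<partial>M) + 2 * (\<integral>x. (g x)\<^sup>2 \<partial>M)"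
proof -
  have le: "(a - b)\<^sup>2 \<le> 2 * a\<^sup>2 + 2 * b\<^sup>2" for a b :: real
    using zero_le_power2[of "a + b"] by (simp add: power2_sum power2_diff)
  have I: "integrable M (\<lambda>x. 2 * (f x)\<^sup>2 + 2 * (g x)\<^sup>2)" using assms by simp
  show I2: "integrable M (\<lambda>x. (f x - g x)\<^sup>2)"
    by (rule Bochner_Integration.integrable_bound[OF I]) (use le in auto)
  have "(\<integral>x. (f x - g x)\<^sup>2 \<partial>M) \<le> (\<integral>x. 2 * (f x)\<^sup>2 + 2 * (g x)\<^sup>2 \<partial>M)"
    by (rule integral_mono[OF I2 I le])
  then show "(\<integral>x. (f x - g x)\<^sup>2 \<partial>M) \<le> 2 * (\<integral>x. (f x)\<^sup>2 \<partial>M) + 2 * (\<integral>x. (g x)\<^sup>2 \<partial>M)"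
    using assms by simp
qed

lemma L2_tendsto_diff:
  fixes f g :: "'a \<Rightarrow> real"
  assumes [measurable]: "\<And>n. a n \<in> borel_measurable M" "\<And>n. b n \<in> borel_measurable M"
      "f \<in> borel_measurable M" "g \<in> borel_measurable M"
    and i: "\<And>n. integrable M (\<lambda>x. (a n x - f x)\<^sup>2)" "\<And>n. integrable M (\<lambda>x. (b n x - g x)\<^sup>2)"
    and l: "(\<lambda>n. \<integral>x. (a n x - f x)\<^sup>2 \<partial>M) \<longlonglongrightarrow> 0"
        "(\<lambda>n. \<integral>x. (b n x - g x)\<^sup>2 \<partial>M) \<longlonglongrightarrow> 0"
  shows "(\<lambda>n. \<integral>x. (a n x - b n x - (f x - g x))\<^sup>2 \<partial>M) \<longlonglongrightarrow> 0"
proof (rule tendsto_sandwich[OF _ _ tendsto_const])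
  show "(\<lambda>n. 2 * (\<integral>x. (a n x - f x)\<^sup>2 \<partial>M) + 2 * (\<integral>x. (b n x - g x)\<^sup>2 \<partial>M)) \<longlonglongrightarrow> 0"
    using l by (auto intro!: tendsto_eq_intros)
  have "(\<integral>x. (a n x - b n x - (f x - g x))\<^sup>2 \<partial>M) \<le> 2 * (\<integral>x. (a n x - f x)\<^sup>2 \<partial>M) + 2
      * (\<integral>x. (b n x - g x)\<^sup>2 \<partial>M)" for n
    using L2_diff(2)[OF _ _ i(1)[of n] i(2)[of n]] by (simp add: algebra_simps)
  then show "\<forall>\<^sub>F n in sequentially. (\<integral>x. (a n x - b n x - (f x - g x))\<^sup>2 \<partial>M) \<le>
      2 * (\<integral>x. (a n x - f x)\<^sup>2 \<partial>M) + 2 * (\<integral>x. (b n x - g x)\<^sup>2 \<partial>M)"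
    by (intro always_eventually allI)
qed simp

definition step_neg :: "(real \<times> real \<times> real) list \<Rightarrow> (real \<times> real \<times> real) list" where
  "step_neg l = map (\<lambda>(c, a, b). (- c, a, b)) l"

text \<open>Realises multiplication by the indicator of {..T} within the step lists: an interval
  beyond T collapses to the empty {T<..T}.\<close>

definition step_clip :: "real \<Rightarrow> (real \<times> real \<times> real) list \<Rightarrow> (real \<times> real \<times> real) list" where
  "step_clip T l = map (\<lambda>(c, a, b). (c, min a T, min b T)) l"

lemma step_valid_append [simp]: "step_valid (l @ l') \<longleftrightarrow> step_valid l \<and> step_valid l'"
  by (simp add: step_valid_def ball_Un)

lemma step_valid_neg [simp]: "step_valid (step_neg l) \<longleftrightarrow> step_valid l"
  by (auto simp: step_valid_def step_neg_def)

lemma step_valid_clip: "0 \<le> T \<Longrightarrow> step_valid l \<Longrightarrow> step_valid (step_clip T l)"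
  by (fastforce simp: step_valid_def step_clip_def)

lemma step_fun_diff: "step_fun (l @ step_neg l') s = step_fun l s - step_fun l' s"
  by (simp add: step_fun_def step_neg_def o_def case_prod_beta uminus_sum_list_map)

lemma step_int_diff: "step_int (l @ step_neg l') w = step_int l w - step_int l' w"
  by (simp add: step_int_def step_neg_def o_def case_prod_beta uminus_sum_list_map)

lemma step_fun_clip: "step_fun (step_clip T l) s = indicator {..T} s * step_fun l s"
proof -
  have "indicator {min a T<..min b T} s = indicator {..T} s * (indicator {a<..b} s :: real)" for a b
    by (auto simp: indicator_def)
  then show ?thesis
    unfolding step_fun_def step_clip_def sum_list_const_mult[symmetric]
    by (simp add: o_def case_prod_beta mult.left_commute)
qed

lemma step_fun_zero: "\<forall>(c, a, b)\<in>set l. b \<le> T \<Longrightarrow> T < s \<Longrightarrow> step_fun l s = 0"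
  by (induction l) (auto simp: step_fun_def)

lemma step_fun_nonpos: "step_valid l \<Longrightarrow> s < 0 \<Longrightarrow> step_fun l s = 0"
  by (induction l) (auto simp: step_fun_def step_valid_def)

definition half :: "(real \<Rightarrow> real) \<Rightarrow> real \<Rightarrow> real" where
  "half g s = indicator {0..} s * g s"

definition wiener_approx :: "path measure \<Rightarrow> (real \<Rightarrow> real) \<Rightarrow> (path \<Rightarrow> real) \<Rightarrow>
  (nat \<Rightarrow> (real \<times> real \<times> real) list) \<Rightarrow> bool" where
  "wiener_approx P g X l \<longleftrightarrow> (\<forall>n. step_valid (l n)) \<and>
     (\<lambda>n. \<integral>s. (step_fun (l n) s - half g s)\<^sup>2 \<partial>lborel) \<longlonglongrightarrow> 0 \<and>
     (\<lambda>n. \<integral>w. (step_int (l n) w - X w)\<^sup>2 \<partial>P) \<longlonglongrightarrow> 0"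

lemma wiener_integral_iff:
  "wiener_integral P g X \<longleftrightarrow> half g \<in> borel_measurable borel \<and> integrable lborel (\<lambda>s. (half g s)\<^sup>2) \<and>
     X \<in> borel_measurable P \<and> integrable P (\<lambda>w. (X w)\<^sup>2) \<and> (\<exists>l. wiener_approx P g X l)"
proof -
  have 1: "set_borel_measurable lborel {0..} g \<longleftrightarrow> half g \<in> borel_measurable borel"
    unfolding set_borel_measurable_def half_def[abs_def] by simp
  have "(\<lambda>s. indicator {0..} s *\<^sub>R (g s)\<^sup>2) = (\<lambda>s. (half g s)\<^sup>2)"
    by (auto simp: half_def indicator_def)
  then have 2: "set_integrable lborel {0..} (\<lambda>s. (g s)\<^sup>2) \<longleftrightarrow> integrable lborel (\<lambda>s. (half g s)\<^sup>2)"
    unfolding set_integrable_def by simp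
  have 3: "(LINT s:{0..}|lborel. (step_fun l s - g s)\<^sup>2) = (\<integral>s. (step_fun l s - half g s)\<^sup>2 \<partial>lborel)"
    if "step_valid l" for l
    unfolding set_lebesgue_integral_def
    using step_fun_nonpos[OF that]
    by (intro Bochner_Integration.integral_cong) (auto simp: half_def indicator_def)
  have "(\<forall>n. step_valid (l n)) \<and> (\<lambda>n. LINT s:{0..}|lborel. (step_fun (l n) s - g s)\<^sup>2)
      \<longlonglongrightarrow> 0 \<and>
     (\<lambda>n. \<integral>w. (step_int (l n) w - X w)\<^sup>2 \<partial>P) \<longlonglongrightarrow> 0 \<longleftrightarrow> wiener_approx P g X l" for l
    unfolding wiener_approx_def using 3 by auto
  then show ?thesis unfolding wiener_integral_def 1 2 by (auto simp: step_valid_def)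
qed

text \<open>Allows a kernel to be exchanged for the derivative of its primitive, which may differ
  from it on a finite set.\<close>

lemma wiener_integral_cong:
  assumes "wiener_integral P g X" "AE s in lborel. half g s = half g' s" "half g' \<in> borel_measurable borel"
  shows "wiener_integral P g' X"
proof -
  have [measurable]: "half g \<in> borel_measurable borel" "half g' \<in> borel_measurable borel"
    using assms unfolding wiener_integral_iff by auto
  have "integrable lborel (\<lambda>s. (half g s)\<^sup>2) \<longleftrightarrow> integrable lborel (\<lambda>s. (half g' s)\<^sup>2)"
    using assms(2) by (intro integrable_cong_AE) auto
  moreover have "(\<integral>s. (step_fun l s - half g s)\<^sup>2 \<partial>lborel) = (\<integral>s. (step_fun l s - half g' s)\<^sup>2 \<partial>lborel)"
      for l
    using assms(2) by (intro integral_cong_AE) auto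
  ultimately show ?thesis using assms unfolding wiener_integral_iff wiener_approx_def by simp
qed

context wiener_space
begin

lemma step_isometry:
  assumes "step_valid l" "step_valid l'"
  shows "integrable P (\<lambda>w. (step_int l w - step_int l' w)\<^sup>2)"
    and "expectation (\<lambda>w. (step_int l w - step_int l' w)\<^sup>2)
        = (\<integral>s. (step_fun l s - step_fun l' s)\<^sup>2 \<partial>lborel)"
  using step_moment(2,3)[of "l @ step_neg l'" 1] assms
  by (simp_all add: step_int_diff step_fun_diff gauss_moment_def)

lemma wiener_diff:
  assumes "wiener_integral P g X" "wiener_integral P g' X'"
  shows "wiener_integral P (\<lambda>s. g s - g' s) (\<lambda>w. X w - X' w)"
proof -
  note a = assms[unfolded wiener_integral_iff]
  have [measurable]: "half g \<in> borel_measurable borel" "half g' \<in> borel_measurable borel"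
     "X \<in> borel_measurable P" "X' \<in> borel_measurable P" using a by auto
  obtain l l' where l: "wiener_approx P g X l" "wiener_approx P g' X' l'" using a by auto
  have v: "step_valid (l n)" "step_valid (l' n)" for n using l by (auto simp: wiener_approx_def)
  have [measurable]: "step_int (l n) \<in> borel_measurable P" "step_int (l' n) \<in> borel_measurable P" for n
    using v step_int_measurable by auto
  have half: "half (\<lambda>s. g s - g' s) = (\<lambda>s. half g s - half g' s)" by (auto simp: half_def algebra_simps)
  have i: "integrable lborel (\<lambda>s. (step_fun (l n) s - half g s)\<^sup>2)"
      "integrable lborel (\<lambda>s. (step_fun (l' n) s - half g' s)\<^sup>2)"
    "integrable P (\<lambda>w. (step_int (l n) w - X w)\<^sup>2)" "integrable P (\<lambda>w. (step_int (l' n) w - X' w)\<^sup>2)" for n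
    using a step_moment(1)[OF v(1)] step_moment(1)[OF v(2)] step_moment(2)[OF v(1), of n 1]
      step_moment(2)[OF v(2), of n 1]
    by (auto intro!: L2_diff)
  have "(\<lambda>n. \<integral>s. (step_fun (l n @ step_neg (l' n)) s - (half g s - half g' s))\<^sup>2 \<partial>lborel)
      \<longlonglongrightarrow> 0"
    unfolding step_fun_diff by (rule L2_tendsto_diff[OF _ _ _ _ i(1,2)])
      (use l in \<open>auto simp: wiener_approx_def\<close>)
  moreover have "(\<lambda>n. \<integral>w. (step_int (l n @ step_neg (l' n)) w - (X w - X' w))\<^sup>2 \<partial>P)
      \<longlonglongrightarrow> 0"
    unfolding step_int_diff by (rule L2_tendsto_diff[OF _ _ _ _ i(3,4)])
      (use l in \<open>auto simp: wiener_approx_def\<close>)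
  ultimately have "wiener_approx P (\<lambda>s. g s - g' s) (\<lambda>w. X w - X' w) (\<lambda>n. l n @ step_neg (l' n))"
    using v unfolding wiener_approx_def half by simp
  then show ?thesis
    using a unfolding wiener_integral_iff half by (auto intro!: L2_diff)
qed

text \<open>One subsequence for all i at once: the sum over I of the squared errors tends to 0 in
  L1, and it dominates each of them.\<close>

lemma wiener_AE_subseq:
  assumes "finite I" "\<And>i. i \<in> I \<Longrightarrow> wiener_approx P (g i) (X i) (l i)"
    and X: "\<And>i. i \<in> I \<Longrightarrow> X i \<in> borel_measurable P" "\<And>i. i \<in> I \<Longrightarrow> integrable P (\<lambda>w. (X i w)\<^sup>2)"
  obtains r :: "nat \<Rightarrow> nat" where "strict_mono r"
      "AE w in P. \<forall>i\<in>I. (\<lambda>n. step_int (l i (r n)) w) \<longlonglongrightarrow> X i w"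
proof -
  have v: "step_valid (l i n)" if "i \<in> I" for n i using assms(2)[OF that] by (auto simp: wiener_approx_def)
  have m[measurable]: "step_int (l i n) \<in> borel_measurable P" if "i \<in> I" for n i
    using v[OF that] step_int_measurable by auto
  have i: "integrable P (\<lambda>w. (step_int (l i n) w - X i w)\<^sup>2)" if "i \<in> I" for n i
    using X[OF that] m[OF that] step_moment(2)[OF v[OF that], of n 1] by (intro L2_diff) auto
  define u where "u n w = (\<Sum>i\<in>I. (step_int (l i n) w - X i w)\<^sup>2)" for n w
  have u0: "0 \<le> u n w" for n w by (auto simp: u_def intro: sum_nonneg)
  have ui: "integrable P (u n)" for n
    unfolding u_def by (intro Bochner_Integration.integrable_sum i)
  have "(\<lambda>n. \<Sum>i\<in>I. \<integral>w. (step_int (l i n) w - X i w)\<^sup>2 \<partial>P) \<longlonglongrightarrow> (\<Sum>i\<in>I. 0)"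
    using assms(2) by (intro tendsto_sum) (auto simp: wiener_approx_def)
  moreover have "(\<integral>w. norm (u n w) \<partial>P) = (\<Sum>i\<in>I. \<integral>w. (step_int (l i n) w - X i w)\<^sup>2 \<partial>P)" for n
    using u0 by (simp add: abs_of_nonneg u_def Bochner_Integration.integral_sum[OF i] del: abs_sum_abs)
  ultimately have "(\<lambda>n. \<integral>w. norm (u n w) \<partial>P) \<longlonglongrightarrow> 0" by simp
  from tendsto_L1_AE_subseq[OF ui this] obtain r :: "nat \<Rightarrow> nat" where
    r: "strict_mono r" "AE w in P. (\<lambda>n. u (r n) w) \<longlonglongrightarrow> 0" by auto
  have "(\<lambda>n. step_int (l i (r n)) w) \<longlonglongrightarrow> X i w"
      if u: "(\<lambda>n. u (r n) w) \<longlonglongrightarrow> 0" and ii: "i \<in> I" for w i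
  proof -
    have "(\<lambda>n. (step_int (l i (r n)) w - X i w)\<^sup>2) \<longlonglongrightarrow> 0"
    proof (rule tendsto_sandwich[OF _ _ tendsto_const u])
      show "\<forall>\<^sub>F n in sequentially. (step_int (l i (r n)) w - X i w)\<^sup>2 \<le> u (r n) w"
        unfolding u_def using assms(1) ii by (intro always_eventually allI member_le_sum) auto
    qed simp
    then have "(\<lambda>n. sqrt ((step_int (l i (r n)) w - X i w)\<^sup>2)) \<longlonglongrightarrow> 0"
        using tendsto_real_sqrt by fastforce
    then have "(\<lambda>n. step_int (l i (r n)) w - X i w) \<longlonglongrightarrow> 0"
        by (simp add: tendsto_rabs_zero_iff)
    then show ?thesis by (simp add: LIM_zero_cancel)
  qed
  then show ?thesis using r by (intro that[of r]) (auto elim!: AE_mp)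
qed

text \<open>The law of X is never identified. Even moments of the approximating step integrals are
  bounded, because their variances are, and Fatou's lemma along an a.e. convergent subsequence
  carries the bound to X.\<close>

lemma wiener_moment:
  assumes "wiener_integral P g X"
  shows "integrable P (\<lambda>w. X w ^ (2 * m))"
proof -
  note a = assms[unfolded wiener_integral_iff]
  have [measurable]: "half g \<in> borel_measurable borel" "X \<in> borel_measurable P" using a by auto
  obtain l where l: "wiener_approx P g X l" using a by auto
  have v: "step_valid (l n)" for n using l by (auto simp: wiener_approx_def)
  have [measurable]: "step_int (l n) \<in> borel_measurable P" for n using v step_int_measurable by auto
  have "convergent (\<lambda>n. \<integral>s. (step_fun (l n) s - half g s)\<^sup>2 \<partial>lborel)"
    using l by (auto simp: wiener_approx_def convergent_def)
  then have "Bseq (\<lambda>n. \<integral>s. (step_fun (l n) s - half g s)\<^sup>2 \<partial>lborel)" by (rule convergent_imp_Bseq)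
  then obtain C where "\<forall>n. norm (\<integral>s. (step_fun (l n) s - half g s)\<^sup>2 \<partial>lborel) \<le> C" by (rule BseqE)
  then have C: "(\<integral>s. (step_fun (l n) s - half g s)\<^sup>2 \<partial>lborel) \<le> C" for n
    unfolding real_norm_def using abs_le_D1 by blast
  define V where "V = 2 * C + 2 * (\<integral>s. (half g s)\<^sup>2 \<partial>lborel)"
  have V: "(\<integral>s. (step_fun (l n) s)\<^sup>2 \<partial>lborel) \<le> V" for n
  proof -
    have "(\<integral>s. (step_fun (l n) s)\<^sup>2 \<partial>lborel)
        = (\<integral>s. ((step_fun (l n) s - half g s) - (- half g s))\<^sup>2 \<partial>lborel)" by simp
    also have "\<dots> \<le> 2 * (\<integral>s. (step_fun (l n) s - half g s)\<^sup>2 \<partial>lborel) + 2 * (\<integral>s. (- half g s)\<^sup>2 \<partial>lborel)"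
      using a step_moment(1)[OF v] by (intro L2_diff(2)) (auto intro!: L2_diff(1))
    finally show ?thesis using C[of n] by (simp add: V_def)
  qed
  obtain r :: "nat \<Rightarrow> nat" where r:
      "AE w in P. \<forall>i\<in>{()}. (\<lambda>n. step_int (l (r n)) w) \<longlonglongrightarrow> X w"
    using wiener_AE_subseq[of "{()}" "\<lambda>_. g" "\<lambda>_. X" "\<lambda>_. l"] l a by auto
  have "(\<integral>\<^sup>+w. ennreal (X w ^ (2 * m)) \<partial>P)
      = (\<integral>\<^sup>+w. liminf (\<lambda>n. ennreal (step_int (l (r n)) w ^ (2 * m))) \<partial>P)"
  proof (intro nn_integral_cong_AE, use r in eventually_elim)
    case (elim w)
    then have "(\<lambda>n. ennreal (step_int (l (r n)) w ^ (2 * m))) \<longlonglongrightarrow> ennreal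
        (X w ^ (2 * m))"
      by (intro tendsto_ennrealI tendsto_power) auto
    then show ?case using lim_imp_Liminf[OF sequentially_bot] by metis
  qed
  also have "\<dots> \<le> liminf (\<lambda>n. \<integral>\<^sup>+w. ennreal (step_int (l (r n)) w ^ (2 * m)) \<partial>P)"
    by (rule nn_integral_liminf) simp
  also have "\<dots> \<le> liminf (\<lambda>n. ennreal (V ^ m * gauss_moment m))"
  proof (intro Liminf_mono always_eventually allI)
    fix n
    have "(\<integral>\<^sup>+w. ennreal (step_int (l (r n)) w ^ (2 * m)) \<partial>P) =
       ennreal ((\<integral>s. (step_fun (l (r n)) s)\<^sup>2 \<partial>lborel) ^ m * gauss_moment m)"
      unfolding step_moment(3)[OF v, symmetric]
      by (rule nn_integral_eq_integral[OF step_moment(2)[OF v]]) auto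
    also have "\<dots> \<le> ennreal (V ^ m * gauss_moment m)"
      using V by (intro ennreal_leI mult_right_mono power_mono) (auto simp: gauss_moment_def)
    finally show "(\<integral>\<^sup>+w. ennreal (step_int (l (r n)) w ^ (2 * m)) \<partial>P) \<le> ennreal (V ^ m * gauss_moment m)" .
  qed
  also have "\<dots> < \<infinity>" by (simp add: Liminf_const)
  finally show ?thesis by (intro integrableI_nonneg) auto
qed

text \<open>Approximating steps may reach beyond T although g does not, and would then see
  increments after T, which the blockwise argument forbids. Clipping only lowers the error in L2 of
  time, and the isometry turns this into closeness of the clipped and unclipped integrals.\<close>

lemma wiener_approx_clip:
  assumes g: "half g \<in> borel_measurable borel" "integrable lborel (\<lambda>s. (half g s)\<^sup>2)"
    and X: "X \<in> borel_measurable P" "integrable P (\<lambda>w. (X w)\<^sup>2)"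
    and l: "wiener_approx P g X l" and T: "0 \<le> T" "\<And>s. T < s \<Longrightarrow> g s = 0"
  shows "wiener_approx P g X (\<lambda>n. step_clip T (l n))"
proof -
  have [measurable]: "half g \<in> borel_measurable borel" "X \<in> borel_measurable P" using g X by auto
  have v: "step_valid (l n)" "step_valid (step_clip T (l n))" for n
    using l step_valid_clip[OF T(1)] by (auto simp: wiener_approx_def)
  have [measurable]: "step_int (l n) \<in> borel_measurable P"
      "step_int (step_clip T (l n)) \<in> borel_measurable P" for n
    using v step_int_measurable by auto
  let ?a = "\<lambda>n. \<integral>s. (step_fun (l n) s - half g s)\<^sup>2 \<partial>lborel"
  let ?b = "\<lambda>n. \<integral>s. (step_fun (step_clip T (l n)) s - half g s)\<^sup>2 \<partial>lborel"
  let ?c = "\<lambda>n. \<integral>w. (step_int (l n) w - X w)\<^sup>2 \<partial>P"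
  have i: "integrable lborel (\<lambda>s. (step_fun (l n) s - half g s)\<^sup>2)"
    "integrable lborel (\<lambda>s. (step_fun (step_clip T (l n)) s - half g s)\<^sup>2)"
    "integrable P (\<lambda>w. (step_int (l n) w - X w)\<^sup>2)"
    "integrable P (\<lambda>w. (step_int (step_clip T (l n)) w - step_int (l n) w)\<^sup>2)" for n
    using g X step_moment(1)[OF v(1)] step_moment(1)[OF v(2)] step_moment(2)[OF v(1), of n 1]
      step_isometry(1)[OF v(2,1)]
    by (auto intro!: L2_diff)
  have ab: "?b n \<le> ?a n" for n
    using T by (intro integral_mono i) (auto simp: step_fun_clip indicator_def half_def)
  have a0: "?a \<longlonglongrightarrow> 0" and c0: "?c \<longlonglongrightarrow> 0" using l
      by (auto simp: wiener_approx_def)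
  have b0: "?b \<longlonglongrightarrow> 0"
    by (rule tendsto_sandwich[OF _ _ tendsto_const a0]) (use ab in auto)
  \<comment> \<open>Twice (x - y)^2 \<le> 2 x^2 + 2 y^2, which makes 2 (2 b + 2 a) + 2 c.\<close>
  have "(\<integral>w. (step_int (step_clip T (l n)) w - X w)\<^sup>2 \<partial>P) \<le> 4 * ?b n + 4 * ?a n + 2 * ?c n" for n
  proof -
    have "(\<integral>s. (step_fun (step_clip T (l n)) s - step_fun (l n) s)\<^sup>2 \<partial>lborel) =
       (\<integral>s. ((step_fun (step_clip T (l n)) s - half g s) - (step_fun (l n) s - half g s))\<^sup>2 \<partial>lborel)"
         by simp
    also have "\<dots> \<le> 2 * ?b n + 2 * ?a n" by (intro L2_diff i) auto
    finally have 1: "(\<integral>w. (step_int (step_clip T (l n)) w - step_int (l n) w)\<^sup>2 \<partial>P) \<le> 2 * ?b n + 2 * ?a n"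
      unfolding step_isometry(2)[OF v(2,1)] .
    have "(\<integral>w. (step_int (step_clip T (l n)) w - X w)\<^sup>2 \<partial>P) =
       (\<integral>w. ((step_int (step_clip T (l n)) w - step_int (l n) w) - (- (step_int (l n) w - X w)))\<^sup>2 \<partial>P)"
         by simp
    also have "\<dots> \<le> 2 * (\<integral>w. (step_int (step_clip T (l n)) w - step_int (l n) w)\<^sup>2 \<partial>P) + 2
        * (\<integral>w. (- (step_int (l n) w - X w))\<^sup>2 \<partial>P)"
      using i by (intro L2_diff(2)) (auto simp only: power2_minus, measurable)
    finally show ?thesis using 1 by (simp only: power2_minus)
  qed
  note bd = this
  have s0: "(\<lambda>n. 4 * ?b n + 4 * ?a n + 2 * ?c n) \<longlonglongrightarrow> 0"
    using tendsto_add[OF tendsto_add[OF tendsto_mult_left[OF b0, of 4] tendsto_mult_left[OF a0, of 4]]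
      tendsto_mult_left[OF c0, of 2]]
    by simp
  have "(\<lambda>n. \<integral>w. (step_int (step_clip T (l n)) w - X w)\<^sup>2 \<partial>P) \<longlonglongrightarrow> 0"
    by (rule tendsto_sandwich[OF _ _ tendsto_const s0])
      (rule always_eventually, simp, rule always_eventually, rule allI, rule bd)
  then show ?thesis using b0 v by (simp add: wiener_approx_def)
qed

end

text \<open>A single grid through all t j and all end points of all lists makes the J integrals
  linear forms in the same independent increments. The block boundary b j is the grid index of t
  j.\<close>

lemma (in wiener_space) step_sequential:
  assumes t: "0 \<le> t 0" "\<And>j. j < J \<Longrightarrow> t j < t (Suc j)"
    and L: "\<And>j. j < J \<Longrightarrow> step_valid (L j)" "\<And>j. j < J \<Longrightarrow> \<forall>(c, a, b)\<in>set (L j). b \<le> t (Suc j)"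
    and q: "\<And>j. j < J \<Longrightarrow> 0 < (\<integral>s. indicator {t j<..t (Suc j)} s * (step_fun (L j) s)\<^sup>2 \<partial>lborel)"
    and l: "0 < l"
  shows "(\<integral>\<^sup>+w. ennreal (\<Prod>j<J. exp (- (l * step_int (L j) w)\<^sup>2 / 2)) \<partial>P) \<le>
    ennreal (\<Prod>j<J. 1 / (l * sqrt (\<integral>s. indicator {t j<..t (Suc j)} s * (step_fun (L j) s)\<^sup>2 \<partial>lborel)))"
proof -
  let ?E = "\<Union>j<J. (\<lambda>(c, a, b). a) ` set (L j) \<union> (\<lambda>(c, a, b). b) ` set (L j)"
  let ?S = "t ` {..J} \<union> ?E"
  have fin: "finite ?S" by auto
  obtain \<tau> N where \<tau>: "\<tau> ` {..N} = ?S" "grid N \<tau>" "mono \<tau>" "range \<tau> \<subseteq> ?S"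
    by (rule grid_exists[OF fin]) auto
  have Lg: "\<forall>(c, a, b)\<in>set (L j). a \<le> b \<and> a \<in> \<tau> ` {..N} \<and> b \<in> \<tau> ` {..N}" if j: "j < J" for j
  proof (rule ballI, clarify)
    fix c a b assume *: "(c, a, b) \<in> set (L j)"
    have "a \<in> (\<lambda>(c, a, b). a) ` set (L j)" "b \<in> (\<lambda>(c, a, b). b) ` set (L j)"
        by (auto intro!: rev_image_eqI[OF *])
    then have "a \<in> ?E" "b \<in> ?E" using j by blast+
    moreover have "a \<le> b" using L(1)[OF j] * by (auto simp: step_valid_def)
    ultimately show "a \<le> b \<and> a \<in> \<tau> ` {..N} \<and> b \<in> \<tau> ` {..N}" unfolding \<tau>(1) by simp
  qed
  have t0: "0 \<le> t j" if "j \<le> J" for j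
    using that by (induction j) (use t in \<open>auto simp: Suc_le_eq intro: less_imp_le order_trans\<close>)
  have S0: "0 \<le> x" if "x \<in> ?S" for x
  proof -
    have "0 \<le> a \<and> 0 \<le> b" if "j < J" "(c, a, b) \<in> set (L j)" for j c a b
      using L(1)[OF that(1)] that(2) by (auto simp: step_valid_def dest!: bspec)
    then show ?thesis using that t0 by auto
  qed
  have pos: "0 \<le> \<tau> i" for i by (rule S0[OF subsetD[OF \<tau>(4) rangeI]])
  have "\<exists>i\<le>N. \<tau> i = t j" if "j \<le> J" for j
  proof -
    have "t j \<in> \<tau> ` {..N}" unfolding \<tau>(1) using that by simp
    then show ?thesis by auto
  qed
  then obtain b where b: "\<And>j. j \<le> J \<Longrightarrow> b j \<le> N" "\<And>j. j \<le> J \<Longrightarrow> \<tau> (b j) = t j" by metis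
  let ?D = "\<lambda>i w. coord w (\<tau> (Suc i)) - coord w (\<tau> i)" and ?\<delta> = "\<lambda>i. \<tau> (Suc i) - \<tau> i"
  let ?c = "\<lambda>j i. step_fun (L j) (\<tau> (Suc i))"
  have bmono: "b j \<le> b (Suc j)" if "j < J" for j
    using grid_le_iff[OF \<tau>(2), of "b j" "b (Suc j)"] b[of j] b[of "Suc j"] t(2)[OF that] that by simp
  have qeq: "(\<integral>s. indicator {t j<..t (Suc j)} s * (step_fun (L j) s)\<^sup>2 \<partial>lborel) =
      (\<Sum>i=b j..<b (Suc j). (?c j i)\<^sup>2 * ?\<delta> i)" if j: "j < J" for j
    using step_fun_sq_integral[OF \<tau>(2) Lg[OF j] bmono[OF j]] b[of j] b[of "Suc j"] j by simp
  have ieq: "step_int (L j) w = (\<Sum>i<N. ?c j i * ?D i w)" if "j < J" for j w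
    by (rule step_int_grid[OF \<tau>(2) Lg[OF that]])
  have "(\<integral>\<^sup>+w. ennreal (\<Prod>j<J. exp (- (l * (\<Sum>i<N. ?c j i * ?D i w))\<^sup>2 / 2)) \<partial>P)
      \<le> ennreal (\<Prod>j<J. 1 / (l * sqrt (\<Sum>i=b j..<b (Suc j). (?c j i)\<^sup>2 * ?\<delta> i)))"
  proof (rule sequential_gauss_bound)
    show "indep_vars (\<lambda>_. borel) ?D {..<N}" by (rule increments_indep[OF pos \<tau>(3)])
    fix i assume "i < N"
    then have *: "\<tau> i < \<tau> (Suc i)" using \<tau>(2) by (simp add: grid_def)
    then show "distributed P lborel (?D i) (normal_density 0 (sqrt (?\<delta> i)))" "0 < ?\<delta> i"
      using increment_law[OF pos *] by auto
  next
    fix j i assume j: "j < J" and i: "b (Suc j) \<le> i" "i < N"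
    have "\<tau> (b (Suc j)) < \<tau> (Suc i)" using grid_less_iff[OF \<tau>(2), of "b (Suc j)" "Suc i"] b j i by auto
    then show "?c j i = 0" using b j by (intro step_fun_zero[OF L(2)[OF j]]) auto
  qed (use l bmono b q qeq in auto)
  moreover have "(\<Prod>j<J. exp (- (l * step_int (L j) w)\<^sup>2 / 2))
      = (\<Prod>j<J. exp (- (l * (\<Sum>i<N. ?c j i * ?D i w))\<^sup>2 / 2))" for w
    by (intro prod.cong refl) (simp add: ieq)
  moreover have "(\<Prod>j<J. 1 / (l * sqrt (\<integral>s. indicator {t j<..t (Suc j)} s * (step_fun (L j) s)\<^sup>2 \<partial>lborel))) =
      (\<Prod>j<J. 1 / (l * sqrt (\<Sum>i=b j..<b (Suc j). (?c j i)\<^sup>2 * ?\<delta> i)))"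
    by (intro prod.cong refl) (simp add: qeq)
  ultimately show ?thesis by presburger
qed

text \<open>The step version passes to the limit: the left side by dominated convergence with bound
  1, the right side because the energies of the steps on their intervals are asymptotically at least
  v.\<close>

lemma (in wiener_space) wiener_small_ball:
  assumes t: "0 \<le> t 0" "\<And>j. j < J \<Longrightarrow> t j < t (Suc j)"
    and W: "\<And>j. j < J \<Longrightarrow> wiener_integral P (g j) (X j)" and g0: "\<And>j s. j < J \<Longrightarrow> t (Suc j) < s \<Longrightarrow> g j s = 0"
    and v: "0 < v" "\<And>j. j < J \<Longrightarrow> v \<le> (\<integral>s. indicator {t j<..t (Suc j)} s * (half (g j) s)\<^sup>2 \<partial>lborel)"
    and l: "0 < l"
  shows "expectation (\<lambda>w. \<Prod>j<J. exp (- (l * X j w)\<^sup>2 / 2)) \<le> (1 / (l * sqrt v)) ^ J"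
proof -
  have W': "half (g j) \<in> borel_measurable borel" "integrable lborel (\<lambda>s. (half (g j) s)\<^sup>2)"
     "X j \<in> borel_measurable P" "integrable P (\<lambda>w. (X j w)\<^sup>2)" "\<exists>l. wiener_approx P (g j) (X j) l"
       if "j < J" for j
    using W[OF that] unfolding wiener_integral_iff by auto
  have t0: "0 \<le> t j" if "j \<le> J" for j
    using that by (induction j) (use t in \<open>auto simp: Suc_le_eq intro: less_imp_le order_trans\<close>)
  have "\<exists>L. wiener_approx P (g j) (X j) (\<lambda>n. step_clip (t (Suc j)) (L n))" if j: "j < J" for j
    using W'[OF j] wiener_approx_clip[OF W'(1-4)[OF j] _ _ g0[OF j]] t0[of "Suc j"] j by fastforce
  then obtain L where L: "\<And>j. j < J \<Longrightarrow> wiener_approx P (g j) (X j) (\<lambda>n. step_clip (t (Suc j)) (L j n))"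
      by metis
  define K where "K j n = step_clip (t (Suc j)) (L j n)" for j n
  have Kb: "\<forall>(c, a, b)\<in>set (K j n). b \<le> t (Suc j)" for j n by (auto simp: K_def step_clip_def)
  have KA: "wiener_approx P (g j) (X j) (K j)" if "j < J" for j using L[OF that]
      by (simp add: K_def[abs_def])
  have Kv: "step_valid (K j n)" if "j < J" for j n using KA[OF that] by (auto simp: wiener_approx_def)
  have [measurable]: "half (g j) \<in> borel_measurable borel" "X j \<in> borel_measurable P"
      "step_int (K j n) \<in> borel_measurable P"
    if "j < J" for j n using W'[OF that] step_int_measurable[OF Kv[OF that]] by auto
  obtain r :: "nat \<Rightarrow> nat" where r: "strict_mono r"
      "AE w in P. \<forall>j\<in>{..<J}. (\<lambda>n. step_int (K j (r n)) w) \<longlonglongrightarrow> X j w"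
    using wiener_AE_subseq[of "{..<J}" g X K] KA W' by auto
  let ?I = "\<lambda>j. indicator {t j<..t (Suc j)} :: real \<Rightarrow> real"
  define a where "a j n = (\<integral>s. (step_fun (K j n) s - half (g j) s)\<^sup>2 \<partial>lborel)" for j n
  \<comment> \<open>One error for all j: by the triangle inequality in L2 of the interval, sqrt (q j
    n) \<ge> sqrt v - d n.\<close>
  define d where "d n = (\<Sum>j<J. sqrt (a j n))" for n
  define q where "q j n = (\<integral>s. ?I j s * (step_fun (K j n) s)\<^sup>2 \<partial>lborel)" for j n
  have "(\<lambda>n. \<Sum>j<J. sqrt (a j n)) \<longlonglongrightarrow> (\<Sum>j<J. sqrt 0)"
    using KA by (intro tendsto_sum tendsto_real_sqrt) (auto simp: a_def wiener_approx_def)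
  then have d0: "d \<longlonglongrightarrow> 0" by (simp add: d_def[abs_def])
  have sqI: "(?I j s * f)\<^sup>2 = ?I j s * f\<^sup>2" for j s f by (auto simp: indicator_def)
  have ii: "integrable lborel (\<lambda>s. ?I j s * f s)" if "integrable lborel f" for f :: "real \<Rightarrow> real" and j
    using integrable_real_mult_indicator[OF _ that, of "{t j<..t (Suc j)}"] by (simp add: mult.commute)
  have qd: "sqrt v - d n \<le> sqrt (q j n)" if j: "j < J" for j n
  proof -
    have i1: "integrable lborel (\<lambda>s. (step_fun (K j n) s - half (g j) s)\<^sup>2)"
      using W'[OF j] step_moment(1)[OF Kv[OF j]] by (intro L2_diff) auto
    have i2: "integrable lborel (\<lambda>s. (?I j s * step_fun (K j n) s)\<^sup>2)"
      unfolding sqI by (rule ii[OF step_moment(1)[OF Kv[OF j]]])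
    have i3: "integrable lborel (\<lambda>s. (?I j s * (half (g j) s - step_fun (K j n) s))\<^sup>2)"
      unfolding sqI by (rule ii) (use i1 in \<open>simp add: power2_commute\<close>)
    have "sqrt v \<le> sqrt (\<integral>s. (?I j s * half (g j) s)\<^sup>2 \<partial>lborel)"
      using v(2)[OF j] by (simp add: sqI)
    also have "\<dots> = sqrt (\<integral>s. (?I j s * step_fun (K j n) s + ?I j s
        * (half (g j) s - step_fun (K j n) s))\<^sup>2 \<partial>lborel)"
      by (simp add: algebra_simps)
    also have "\<dots> \<le> sqrt (\<integral>s. (?I j s * step_fun (K j n) s)\<^sup>2 \<partial>lborel) +
        sqrt (\<integral>s. (?I j s * (half (g j) s - step_fun (K j n) s))\<^sup>2 \<partial>lborel)"
      using j i2 i3 by (intro L2_triangle) auto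
    also have "(\<integral>s. (?I j s * (half (g j) s - step_fun (K j n) s))\<^sup>2 \<partial>lborel) \<le> a j n"
      unfolding a_def using i1 i3 by (intro integral_mono) (auto simp: indicator_def power2_commute)
    also have "(\<integral>s. (?I j s * step_fun (K j n) s)\<^sup>2 \<partial>lborel) = q j n" by (simp add: q_def sqI)
    finally have "sqrt v \<le> sqrt (q j n) + sqrt (a j n)" by simp
    moreover have "sqrt (a j n) \<le> d n"
      unfolding d_def using j by (intro member_le_sum) (auto simp: a_def)
    ultimately show ?thesis by simp
  qed
  define E where "E n = expectation (\<lambda>w. \<Prod>j<J. exp (- (l * step_int (K j n) w)\<^sup>2 / 2))" for n
  have bnd: "norm (\<Prod>j<J. exp (- (l * f j)\<^sup>2 / 2)) \<le> 1" for f :: "nat \<Rightarrow> real"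
    unfolding prod_norm[symmetric] by (intro prod_le_1) auto
  have Elim: "(\<lambda>n. E (r n)) \<longlonglongrightarrow> expectation (\<lambda>w. \<Prod>j<J. exp (- (l * X j w)\<^sup>2 / 2))"
    unfolding E_def
  proof (rule integral_dominated_convergence[where w="\<lambda>_. 1"])
    show "AE w in P. (\<lambda>n. \<Prod>j<J. exp (- (l * step_int (K j (r n)) w)\<^sup>2 / 2)) \<longlonglongrightarrow>
        (\<Prod>j<J. exp (- (l * X j w)\<^sup>2 / 2))"
      using r(2) by eventually_elim (intro tendsto_intros, auto)
    show "AE w in P. norm (\<Prod>j<J. exp (- (l * step_int (K j (r n)) w)\<^sup>2 / 2)) \<le> 1" for n
      using bnd by (intro always_eventually allI)
  qed (auto intro!: borel_measurable_prod)
  have Eb: "E n \<le> (1 / (l * (sqrt v - d n))) ^ J" if dn: "d n < sqrt v" for n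
  proof -
    have qpos: "0 < q j n" if "j < J" for j using qd[OF that, of n] dn
        by (meson diff_gt_0_iff_gt less_le_trans real_sqrt_gt_0_iff)
    have "ennreal (E n) = (\<integral>\<^sup>+w. ennreal (\<Prod>j<J. exp (- (l * step_int (K j n) w)\<^sup>2 / 2)) \<partial>P)"
      unfolding E_def
    proof (rule nn_integral_eq_integral[symmetric])
      show "integrable P (\<lambda>w. \<Prod>j<J. exp (- (l * step_int (K j n) w)\<^sup>2 / 2))"
      proof (rule integrable_const_bound[where B=1])
        show "AE w in P. norm (\<Prod>j<J. exp (- (l * step_int (K j n) w)\<^sup>2 / 2)) \<le> 1"
          by (intro always_eventually allI bnd)
      qed (auto intro!: borel_measurable_prod)
    qed (auto intro!: AE_I2 prod_nonneg)
    also have "\<dots> \<le> ennreal (\<Prod>j<J. 1 / (l * sqrt (q j n)))"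
      unfolding q_def by (rule step_sequential[OF t]) (use Kv Kb l qpos in \<open>auto simp: q_def\<close>)
    also have "\<dots> \<le> ennreal (\<Prod>j<J. 1 / (l * (sqrt v - d n)))"
    proof (intro ennreal_leI prod_mono conjI)
      fix j assume "j \<in> {..<J}"
      then have j: "j < J" by simp
      show "0 \<le> 1 / (l * sqrt (q j n))" using l qpos[OF j] by simp
      show "1 / (l * sqrt (q j n)) \<le> 1 / (l * (sqrt v - d n))"
        using l qpos[OF j] qd[OF j, of n] dn by (intro divide_left_mono mult_left_mono mult_pos_pos) auto
    qed
    finally show ?thesis using l dn by (simp add: ennreal_le_iff)
  qed
  have lim: "(\<lambda>n. (1 / (l * (sqrt v - d (r n)))) ^ J) \<longlonglongrightarrow> (1 / (l * (sqrt v - 0))) ^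
      J"
    using LIMSEQ_subseq_LIMSEQ[OF d0 r(1)] l v(1)
    by (intro tendsto_intros) (auto simp: o_def)
  have "\<forall>\<^sub>F n in sequentially. d (r n) < sqrt v"
    using LIMSEQ_subseq_LIMSEQ[OF d0 r(1)] v(1) by (intro order_tendstoD[of _ 0]) (auto simp: o_def)
  then have "\<forall>\<^sub>F n in sequentially. E (r n) \<le> (1 / (l * (sqrt v - d (r n)))) ^ J"
    by eventually_elim (rule Eb)
  from tendsto_le[OF _ lim Elim this] show ?thesis by simp
qed

section \<open>The Sobolev norm of smooth functionals\<close>

definition deriv_norm :: "nat \<Rightarrow> smooth_data \<Rightarrow> path \<Rightarrow> real" where
  "deriv_norm k F w = tensor_norm (malliavin_deriv k F w)"

lemma deriv_fun_L2:
  assumes "smooth_functional P F"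
  shows "deriv_fun k F w \<in> borel_measurable (lborel_k k)"
    and "integrable (lborel_k k) (\<lambda>s. (deriv_fun k F w s)\<^sup>2)"
    and "deriv_norm k F w = sqrt (\<integral>s. (deriv_fun k F w s)\<^sup>2 \<partial>lborel_k k)"
proof -
  note wf = tensor_wf_malliavin[OF assms, of k w]
  have eq: "tensor_fun k (malliavin_deriv k F w) = deriv_fun k F w"
    by (rule ext) (rule tensor_fun_malliavin)
  show "deriv_fun k F w \<in> borel_measurable (lborel_k k)"
    using tensor_fun_measurable[OF wf] unfolding eq .
  show "integrable (lborel_k k) (\<lambda>s. (deriv_fun k F w s)\<^sup>2)"
    using tensor_norm_integral(1)[OF wf] unfolding eq .
  show "deriv_norm k F w = sqrt (\<integral>s. (deriv_fun k F w s)\<^sup>2 \<partial>lborel_k k)"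
    using tensor_norm_integral(2)[OF wf] unfolding eq deriv_norm_def .
qed

lemma deriv_norm_nonneg: "smooth_functional P F \<Longrightarrow> 0 \<le> deriv_norm k F w"
  by (simp add: deriv_fun_L2(3))

lemma deriv_norm_add:
  assumes "smooth_functional P F" "smooth_functional P G"
  shows "deriv_norm k (data_add F G) w \<le> deriv_norm k F w + deriv_norm k G w"
  unfolding deriv_fun_L2(3)[OF smooth_data_add[OF assms]] deriv_fun_L2(3)[OF assms(1)]
    deriv_fun_L2(3)[OF assms(2)] deriv_fun_add[OF assms]
  by (intro L2_triangle deriv_fun_L2(1,2)[OF assms(1)] deriv_fun_L2(1,2)[OF assms(2)])

lemma deriv_norm_0: "deriv_norm 0 F w = \<bar>sval F w\<bar>"
  by (simp add: deriv_norm_def malliavin_deriv_def tensor_norm_def tensor_inner_def sval_def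
    power2_eq_square[symmetric])

lemma deriv_norm_diff:
  assumes "smooth_functional P F" "smooth_functional P G"
  shows "tensor_norm (tensor_diff (malliavin_deriv k F w) (malliavin_deriv k G w))
      = deriv_norm k (data_add F (data_neg G)) w"
proof -
  note wf = tensor_wf_diff[OF tensor_wf_malliavin[OF assms(1), of k w]
    tensor_wf_malliavin[OF assms(2), of k w]]
  show ?thesis
    unfolding tensor_norm_integral(2)[OF wf]
      deriv_fun_L2(3)[OF smooth_data_add[OF assms(1) smooth_data_neg[OF assms(2)]]]
      deriv_fun_add[OF assms(1) smooth_data_neg[OF assms(2)]] deriv_fun_neg[OF assms(2)] tensor_fun_diff
        tensor_fun_malliavin
    by simp
qed

text \<open>Order 0 absorbs the separate L^p term, since the norm of the 0-th derivative is the
  absolute value. The norm becomes one sum over k \<le> r, the form in which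
  \<open>sum_minkowski\<close> applies.\<close>

lemma smooth_norm_eq:
  "smooth_norm P p r F = (\<Sum>k\<le>r. \<integral>w. deriv_norm k F w powr p \<partial>P) powr (1 / p)"
proof -
  have "{..r} = insert 0 {1..r}" by auto
  then show ?thesis unfolding smooth_norm_def by (simp add: deriv_norm_0 deriv_norm_def[symmetric])
qed

lemma smooth_dist_eq:
  assumes "smooth_functional P F" "smooth_functional P G"
  shows "smooth_dist P p r F G = smooth_norm P p r (data_add F (data_neg G))"
proof -
  have "{..r} = insert 0 {1..r}" by auto
  then show ?thesis unfolding smooth_dist_def smooth_norm_eq
    by (simp add: deriv_norm_0 deriv_norm_diff[OF assms] sval_add[OF assms(1)] sval_neg)
qed

text \<open>Different records may encode the same functional. The norm sees only the functions
  \<open>deriv_fun\<close>, so identities such as F = G + (F - G) are available although they fail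
  for the records.\<close>

lemma smooth_norm_cong:
  assumes "smooth_functional P F" "smooth_functional P G" "\<And>k w s. deriv_fun k F w s = deriv_fun k G w s"
  shows "smooth_norm P p r F = smooth_norm P p r G"
  unfolding smooth_norm_eq deriv_fun_L2(3)[OF assms(1)] deriv_fun_L2(3)[OF assms(2)] assms(3) ..

lemma smooth_norm_neg:
  assumes "smooth_functional P F"
  shows "smooth_norm P p r (data_neg F) = smooth_norm P p r F"
  unfolding smooth_norm_eq deriv_fun_L2(3)[OF assms] deriv_fun_L2(3)[OF smooth_data_neg[OF assms]]
    deriv_fun_neg[OF assms]
  by simp

lemma smooth_norm_zero: "0 < p \<Longrightarrow> smooth_norm P p r data_zero = 0"
  unfolding smooth_norm_eq deriv_fun_L2(3)[OF smooth_data_zero] deriv_fun_zero by simp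

lemma smooth_norm_nonneg: "0 \<le> smooth_norm P p r F"
  unfolding smooth_norm_eq by simp

section \<open>Integrability and the triangle inequality for the Sobolev norm\<close>

lemma integrable_powr_sum:
  fixes f :: "'i \<Rightarrow> 'a \<Rightarrow> real"
  assumes p: "1 \<le> p" and I: "finite I"
    and f: "\<And>i. i \<in> I \<Longrightarrow> f i \<in> borel_measurable M" "\<And>i x. i \<in> I \<Longrightarrow> 0 \<le> f i x"
      "\<And>i. i \<in> I \<Longrightarrow> integrable M (\<lambda>x. f i x powr p)"
  shows "integrable M (\<lambda>x. (\<Sum>i\<in>I. f i x) powr p)"
  using I f
proof (induction I)
  case (insert i I)
  have "integrable M (\<lambda>x. (f i x + (\<Sum>i\<in>I. f i x)) powr p)"
    using insert p
    by (intro sum_minkowski_integrable[where A="{()}" and f="\<lambda>_. f i" and g="\<lambda>_ x. \<Sum>i\<in>I. f i x"])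
       (auto intro!: sum_nonneg)
  then show ?case using insert by simp
qed simp

context wiener_space
begin

lemmas smooth_rules = smooth_data_add[where P=P] smooth_data_neg[where P=P]
lemmas smooth_simps = deriv_fun_add[where P=P] deriv_fun_neg[where P=P] sval_add[where P=P] sval_neg

lemma wiener_moment_powr:
  assumes "wiener_integral P g X" "1 \<le> q"
  shows "integrable P (\<lambda>w. \<bar>X w\<bar> powr q)"
proof -
  obtain m :: nat where m: "q \<le> real m" using real_arch_simple by blast
  have [measurable]: "X \<in> borel_measurable P" using assms unfolding wiener_integral_def by auto
  have le: "\<bar>x\<bar> powr q \<le> 1 + x ^ (2 * m)" for x :: real
  proof (cases "\<bar>x\<bar> \<le> 1")
    case True
    then have "\<bar>x\<bar> powr q \<le> 1 powr q" using assms by (intro powr_mono2) auto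
    then show ?thesis by (simp add: add_increasing2)
  next
    case False
    then have "\<bar>x\<bar> powr q \<le> \<bar>x\<bar> powr real (2 * m)" using m by (intro powr_mono) auto
    also have "\<dots> = x ^ (2 * m)" using False by (subst powr_realpow) (auto simp: power_even_abs)
    finally show ?thesis by simp
  qed
  have I: "integrable P (\<lambda>w. 1 + X w ^ (2 * m))" using wiener_moment[OF assms(1), of m] by simp
  show ?thesis
    by (rule Bochner_Integration.integrable_bound[OF I]) (use le order_trans[OF _ abs_ge_self] in auto)
qed

lemma smooth_deriv_measurable:
  assumes F: "smooth_functional P F" and "is": "set is \<subseteq> {..<arity F}"
  shows "(\<lambda>w. iter_partial is (outer F) (\<lambda>i. gauss F i w)) \<in> borel_measurable P"
proof -
  have sm: "smooth_poly_growth (arity F) (outer F)" using F unfolding smooth_functional_def by auto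
  \<comment> \<open>From index \<open>arity F\<close> on, \<open>gauss F\<close> is arbitrary and
    perhaps not measurable; the outer function ignores these entries, so they are set to 0.\<close>
  let ?x = "\<lambda>w i. if i < arity F then gauss F i w else 0"
  have "(\<lambda>w. if i < arity F then gauss F i w else 0) \<in> borel_measurable P" for i
    using F unfolding smooth_functional_def wiener_integral_def by (cases "i < arity F") auto
  then have "?x \<in> borel_measurable P" by (rule measurable_coordinatewise_then_product)
  then have "(\<lambda>w. iter_partial is (outer F) (?x w)) \<in> borel_measurable P"
    by (rule measurable_compose[OF _
      borel_measurable_continuous_onI[OF smooth_poly_growth_cont[OF sm "is"]]])
  moreover have "iter_partial is (outer F) (?x w) = iter_partial is (outer F) (\<lambda>i. gauss F i w)" for w
    by (rule iter_partial_cong_coord[OF smooth_poly_growth_dep[OF sm] "is"]) auto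
  ultimately show ?thesis by simp
qed

lemma smooth_deriv_integrable:
  assumes F: "smooth_functional P F" and "is": "set is \<subseteq> {..<arity F}" and p: "1 \<le> p"
  shows "integrable P (\<lambda>w. \<bar>iter_partial is (outer F) (\<lambda>i. gauss F i w)\<bar> powr p)"
proof -
  have sm: "smooth_poly_growth (arity F) (outer F)" using F unfolding smooth_functional_def by auto
  obtain C N where CN: "\<forall>x. \<bar>iter_partial is (outer F) x\<bar> \<le> C * (1 + (\<Sum>i<arity F. \<bar>x i\<bar>)) ^ N"
    by (rule smooth_poly_growth_bound[OF sm "is"])
  let ?S = "\<lambda>w. \<Sum>i<arity F. \<bar>gauss F i w\<bar>"
  \<comment> \<open>The summand 1 keeps q \<ge> 1, as Minkowski's inequality demands, when N =
    0.\<close>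
  define q where "q = real N * p + 1"
  have q: "1 \<le> q" using p by (simp add: q_def)
  have [measurable]: "gauss F i \<in> borel_measurable P" if "i < arity F" for i
    using F that unfolding smooth_functional_def wiener_integral_def by auto
  have "integrable P (\<lambda>w. ?S w powr q)"
    using F q unfolding smooth_functional_def
      by (intro integrable_powr_sum) (auto intro!: wiener_moment_powr)
  then have "integrable P (\<lambda>w. (1 + ?S w) powr q)"
    using q by (intro sum_minkowski_integrable[where A="{()}" and f="\<lambda>_ _. 1" and g="\<lambda>_. ?S"])
      (auto intro!: sum_nonneg)
  then have I: "integrable P (\<lambda>w. \<bar>C\<bar> powr p * (1 + ?S w) powr q)" by simp
  have le: "\<bar>iter_partial is (outer F) (\<lambda>i. gauss F i w)\<bar> powr p \<le> \<bar>C\<bar> powr p * (1 + ?S w) powr q" for w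
  proof -
    have S: "0 \<le> ?S w" by (intro sum_nonneg) auto
    have "\<bar>iter_partial is (outer F) (\<lambda>i. gauss F i w)\<bar> \<le> \<bar>C\<bar> * (1 + ?S w) ^ N"
      using S by (intro order_trans[OF CN[rule_format]] mult_right_mono) auto
    then have "\<bar>iter_partial is (outer F) (\<lambda>i. gauss F i w)\<bar> powr p \<le> (\<bar>C\<bar> * (1 + ?S w) ^ N) powr p"
      using p by (intro powr_mono2) auto
    also have "\<dots> = \<bar>C\<bar> powr p * (1 + ?S w) powr (real N * p)"
      using S by (simp add: powr_mult powr_powr powr_realpow[symmetric] add_pos_nonneg)
    also have "\<dots> \<le> \<bar>C\<bar> powr p * (1 + ?S w) powr q"
      using S by (intro mult_left_mono powr_mono) (auto simp: q_def)
    finally show ?thesis .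
  qed
  show ?thesis
    by (rule Bochner_Integration.integrable_bound[OF I])
       (use le smooth_deriv_measurable[OF F "is"] order_trans[OF _ abs_ge_self] in auto)
qed

text \<open>Here the formal sum is the better form: it is the root of a quadratic form in finitely
  many measurable coefficients, whereas the L2 realisation would call for joint measurability in
  path and times.\<close>

lemma deriv_norm_measurable [measurable]:
  assumes F: "smooth_functional P F"
  shows "deriv_norm k F \<in> borel_measurable P"
proof -
  let ?f = "\<lambda>i w. iter_partial (index_lists (arity F) k ! i) (outer F) (\<lambda>i. gauss F i w)"
  let ?n = "length (index_lists (arity F) k)"
  have [measurable]: "?f i \<in> borel_measurable P" if "i < ?n" for i
  proof (rule smooth_deriv_measurable[OF F])
    have "index_lists (arity F) k ! i \<in> set (index_lists (arity F) k)" using that by simp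
    then show "set (index_lists (arity F) k ! i) \<subseteq> {..<arity F}" unfolding set_index_lists by simp
  qed
  have "deriv_norm k F = (\<lambda>w. sqrt (\<Sum>i<?n. \<Sum>j<?n. ?f i w * ?f j w *
     prod_list (map2 cm_inner (map (dir F) (index_lists (arity F) k ! i))
       (map (dir F) (index_lists (arity F) k ! j)))))"
    unfolding deriv_norm_def[abs_def] tensor_norm_def tensor_inner_def sum_list_sum_nth atLeast0LessThan
      malliavin_deriv_def malliavin_step_iter
    by (simp add: case_prod_beta)
  also have "\<dots> \<in> borel_measurable P" by measurable
  finally show ?thesis .
qed

lemma deriv_norm_le:
  assumes F: "smooth_functional P F" and V: "\<forall>i<arity F. \<forall>j<arity F. \<bar>cm_inner (dir F i) (dir F j)\<bar> \<le> V"
      "0 \<le> V"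
  shows "deriv_norm k F w \<le> sqrt (V ^ k) *
    (\<Sum>is | set is \<subseteq> {..<arity F} \<and> length is = k. \<bar>iter_partial is (outer F) (\<lambda>i. gauss F i w)\<bar>)"
proof -
  have "deriv_norm k F w \<le> sqrt (V ^ k) * (\<Sum>(c, x)\<leftarrow>malliavin_deriv k F w. \<bar>c\<bar>)"
    unfolding deriv_norm_def
  proof (rule tensor_norm_le[where D="dir F ` {..<arity F}"])
    show "\<forall>(c, x)\<in>set (malliavin_deriv k F w). length x = k \<and> set x \<subseteq> dir F ` {..<arity F}"
      unfolding malliavin_deriv_def malliavin_step_iter by (auto simp: set_index_lists)
  qed (use V in auto)
  also have "(\<Sum>(c, x)\<leftarrow>malliavin_deriv k F w. \<bar>c\<bar>) =
     (\<Sum>is\<leftarrow>index_lists (arity F) k. \<bar>iter_partial is (outer F) (\<lambda>i. gauss F i w)\<bar>)"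
    unfolding malliavin_deriv_def malliavin_step_iter by (simp add: o_def case_prod_beta)
  also have "\<dots> = (\<Sum>is | set is \<subseteq> {..<arity F} \<and> length is = k. \<bar>iter_partial is (outer F)
      (\<lambda>i. gauss F i w)\<bar>)"
    by (simp add: sum_list_distinct_conv_sum_set distinct_index_lists set_index_lists)
  finally show ?thesis .
qed

lemma deriv_norm_integrable:
  assumes F: "smooth_functional P F" and p: "1 \<le> p"
  shows "integrable P (\<lambda>w. deriv_norm k F w powr p)"
proof -
  let ?A = "(\<lambda>(i, j). \<bar>cm_inner (dir F i) (dir F j)\<bar>) ` ({..<arity F} \<times> {..<arity F})"
  define V where "V = Max (insert 0 ?A)"
  have V: "\<forall>i<arity F. \<forall>j<arity F. \<bar>cm_inner (dir F i) (dir F j)\<bar> \<le> V" "0 \<le> V"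
    unfolding V_def by (auto intro!: Max_ge image_eqI[where x="(_, _)"])
  let ?T = "\<lambda>w. \<Sum>is | set is \<subseteq> {..<arity F} \<and> length is = k. \<bar>iter_partial is (outer F) (\<lambda>i. gauss F i w)\<bar>"
  have "integrable P (\<lambda>w. ?T w powr p)"
    using smooth_deriv_measurable[OF F] smooth_deriv_integrable[OF F _ p] finite_index_set p
    by (intro integrable_powr_sum) auto
  then have I: "integrable P (\<lambda>w. sqrt (V ^ k) powr p * ?T w powr p)" by simp
  have le: "deriv_norm k F w powr p \<le> sqrt (V ^ k) powr p * ?T w powr p" for w
  proof -
    have "deriv_norm k F w powr p \<le> (sqrt (V ^ k) * ?T w) powr p"
      using p deriv_norm_le[OF F V] deriv_norm_nonneg[OF F] by (intro powr_mono2) auto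
    also have "\<dots> = sqrt (V ^ k) powr p * ?T w powr p" by (rule powr_mult)
    finally show ?thesis .
  qed
  show ?thesis
    by (rule Bochner_Integration.integrable_bound[OF I])
      (use le deriv_norm_measurable[OF F] order_trans[OF _ abs_ge_self] in auto)
qed

lemma sval_measurable [measurable]: "smooth_functional P F \<Longrightarrow> sval F \<in> borel_measurable P"
  using smooth_deriv_measurable[of F "[]"] by (simp add: sval_def[abs_def] iter_partial_Nil)

lemma sval_integrable: "smooth_functional P F \<Longrightarrow> 1 \<le> p \<Longrightarrow> integrable P (\<lambda>w. \<bar>sval F w\<bar> powr p)"
  using deriv_norm_integrable[of F p 0] by (simp add: deriv_norm_0)

lemma smooth_norm_add:
  assumes F: "smooth_functional P F" and G: "smooth_functional P G" and p: "1 \<le> p"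
  shows "smooth_norm P p r (data_add F G) \<le> smooth_norm P p r F + smooth_norm P p r G"
proof -
  have i1: "integrable P (\<lambda>w. deriv_norm k (data_add F G) w powr p)" for k
    by (rule deriv_norm_integrable[OF smooth_data_add[OF F G] p])
  have i2: "integrable P (\<lambda>w. (deriv_norm k F w + deriv_norm k G w) powr p)" for k
    using p by (intro sum_minkowski_integrable[where A="{()}" and f="\<lambda>_. deriv_norm k F"
      and g="\<lambda>_. deriv_norm k G"])
      (auto intro: deriv_norm_measurable deriv_norm_integrable deriv_norm_nonneg F G)
  have le: "deriv_norm k (data_add F G) w powr p \<le> (deriv_norm k F w + deriv_norm k G w) powr p" for k w
    using p deriv_norm_add[OF F G] deriv_norm_nonneg[OF smooth_data_add[OF F G]] by (intro powr_mono2) auto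
  have "(\<Sum>k\<le>r. \<integral>w. deriv_norm k (data_add F G) w powr p \<partial>P)
      \<le> (\<Sum>k\<le>r. \<integral>w. (deriv_norm k F w + deriv_norm k G w) powr p \<partial>P)"
    by (intro sum_mono integral_mono i1 i2 le)
  then have "smooth_norm P p r (data_add F G)
      \<le> (\<Sum>k\<le>r. \<integral>w. (deriv_norm k F w + deriv_norm k G w) powr p \<partial>P) powr (1 / p)"
    unfolding smooth_norm_eq using p by (intro powr_mono2) (auto intro!: sum_nonneg)
  also have "\<dots> \<le> smooth_norm P p r F + smooth_norm P p r G"
    unfolding smooth_norm_eq using p
    by (intro sum_minkowski) (auto intro: deriv_norm_measurable deriv_norm_integrable deriv_norm_nonneg F G)
  finally show ?thesis .
qed

lemma sval_norm_le:
  assumes "smooth_functional P F" "1 \<le> p"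
  shows "(\<integral>w. \<bar>sval F w\<bar> powr p \<partial>P) \<le> smooth_norm P p r F powr p"
proof -
  let ?S = "\<Sum>k\<le>r. \<integral>w. deriv_norm k F w powr p \<partial>P"
  have "(\<integral>w. \<bar>sval F w\<bar> powr p \<partial>P) = (\<Sum>k\<in>{0}. \<integral>w. deriv_norm k F w powr p \<partial>P)" by (simp add: deriv_norm_0)
  also have "\<dots> \<le> ?S" by (intro sum_mono2) auto
  also have "?S = smooth_norm P p r F powr p"
    using assms by (simp add: smooth_norm_eq powr_powr sum_nonneg)
  finally show ?thesis .
qed

text \<open>Summing over a series requires an L1 bound that is linear in the norm; x \<le> a + a (x
  / a)^p gives it with the factor 2. Allowing any positive a above the norm covers a vanishing
  norm.\<close>

lemma sval_L1_le:
  assumes F: "smooth_functional P F" and p: "1 \<le> p" and a: "smooth_norm P p r F \<le> a" "0 < a"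
  shows "integrable P (sval F)" "(\<integral>w. \<bar>sval F w\<bar> \<partial>P) \<le> 2 * a"
proof -
  have le: "x \<le> a + a * (x powr p / a powr p)" if "0 \<le> x" for x
  proof (cases "x \<le> a")
    case True
    then show ?thesis using a by (simp add: add_increasing2)
  next
    case False
    have "(x / a) powr 1 \<le> (x / a) powr p" using False a p by (intro powr_mono) (auto simp: divide_simps)
    then have "x / a \<le> x powr p / a powr p" using False a by (simp add: powr_divide)
    then have "x \<le> a * (x powr p / a powr p)" using a by (simp add: divide_simps mult.commute)
    then show ?thesis using a by simp
  qed
  have I: "integrable P (\<lambda>w. a + a * (\<bar>sval F w\<bar> powr p / a powr p))"
    using sval_integrable[OF F p] by simp
  show 1: "integrable P (sval F)"
    by (rule Bochner_Integration.integrable_bound[OF I])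
      (use le[OF abs_ge_zero] order_trans[OF _ abs_ge_self] F in auto)
  have "(\<integral>w. \<bar>sval F w\<bar> \<partial>P) \<le> (\<integral>w. a + a * (\<bar>sval F w\<bar> powr p / a powr p) \<partial>P)"
    using I 1 le by (intro integral_mono) auto
  also have "\<dots> = a + a * ((\<integral>w. \<bar>sval F w\<bar> powr p \<partial>P) / a powr p)"
    using sval_integrable[OF F p] by (simp add: prob_space)
  also have "\<dots> \<le> a + a * (a powr p / a powr p)"
    using a order_trans[OF sval_norm_le[OF F p, of r] powr_mono2[OF _ smooth_norm_nonneg a(1)]] p
    by (intro add_left_mono mult_left_mono divide_right_mono) auto
  finally show "(\<integral>w. \<bar>sval F w\<bar> \<partial>P) \<le> 2 * a" using a by simp
qed

end

section \<open>Series in the Sobolev space and countable subadditivity\<close>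

primrec data_sum :: "(nat \<Rightarrow> smooth_data) \<Rightarrow> nat \<Rightarrow> smooth_data" where
  "data_sum H 0 = data_zero"
| "data_sum H (Suc n) = data_add (data_sum H n) (H n)"

lemma smooth_data_sum: "(\<And>i. smooth_functional P (H i)) \<Longrightarrow> smooth_functional P (data_sum H n)"
  by (induction n) (auto simp: smooth_data_zero smooth_data_add)

lemma sval_data_sum:
  assumes "\<And>i. smooth_functional P (H i)"
  shows "sval (data_sum H n) w = (\<Sum>i<n. sval (H i) w)"
  by (induction n) (auto simp: sval_zero sval_add[OF smooth_data_sum[of P H, OF assms]])

lemma deriv_fun_data_sum:
  assumes "\<And>i. smooth_functional P (H i)"
  shows "deriv_fun k (data_sum H n) w s = (\<Sum>i<n. deriv_fun k (H i) w s)"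
  by (induction n) (auto simp: deriv_fun_zero deriv_fun_add[OF smooth_data_sum[of P H, OF assms] assms])

context wiener_space
begin

lemma smooth_norm_data_sum:
  assumes "\<And>i. smooth_functional P (H i)" "1 \<le> p"
  shows "smooth_norm P p r (data_sum H n) \<le> (\<Sum>i<n. smooth_norm P p r (H i))"
proof (induction n)
  case (Suc n)
  have "smooth_norm P p r (data_sum H (Suc n)) \<le> smooth_norm P p r (data_sum H n) + smooth_norm P p r (H n)"
    using smooth_norm_add[OF smooth_data_sum[of P H, OF assms(1)] assms(1) assms(2)] by simp
  then show ?case using Suc by simp
qed (use assms in \<open>simp add: smooth_norm_zero\<close>)

text \<open>The records on the two sides differ; the difference of two partial sums and the shifted
  block have the same derivative functions.\<close>

lemma smooth_dist_data_sum:
  assumes H: "\<And>i. smooth_functional P (H i)" and "1 \<le> p"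
  shows "smooth_dist P p r (data_sum H (n + j)) (data_sum H n)
      = smooth_norm P p r (data_sum (\<lambda>i. H (n + i)) j)"
proof -
  have S: "smooth_functional P (data_sum H m)" for m by (rule smooth_data_sum[OF H])
  have "smooth_functional P (data_sum (\<lambda>i. H (n + i)) j)" by (rule smooth_data_sum[OF H])
  moreover have "deriv_fun k (data_add (data_sum H (n + j)) (data_neg (data_sum H n))) w s
      = deriv_fun k (data_sum (\<lambda>i. H (n + i)) j) w s" for k w s
  proof -
    have "(\<Sum>i<n + j. deriv_fun k (H i) w s) = (\<Sum>i<n. deriv_fun k (H i) w s)
        + (\<Sum>i<j. deriv_fun k (H (n + i)) w s)"
      by (induction j) auto
    then show ?thesis
      by (simp add: deriv_fun_add[OF S smooth_data_neg[OF S]] deriv_fun_neg[OF S] deriv_fun_data_sum[OF H])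
  qed
  ultimately show ?thesis
    unfolding smooth_dist_eq[OF S S] by (intro smooth_norm_cong smooth_data_add S smooth_data_neg)
qed

lemma smooth_dist_sym:
  assumes "smooth_functional P F" "smooth_functional P G"
  shows "smooth_dist P p r F G = smooth_dist P p r G F"
proof -
  have "smooth_norm P p r (data_add F (data_neg G))
      = smooth_norm P p r (data_neg (data_add G (data_neg F)))"
    using assms
    by (intro smooth_norm_cong smooth_rules) (simp_all add: smooth_simps smooth_rules)
  then show ?thesis
    using assms by (simp add: smooth_dist_eq smooth_norm_neg[where P=P] smooth_rules)
qed

lemma smooth_norm_dist:
  assumes "smooth_functional P F" "smooth_functional P G" "1 \<le> p"
  shows "smooth_norm P p r F \<le> smooth_norm P p r G + smooth_dist P p r F G"
proof -
  have "smooth_norm P p r F = smooth_norm P p r (data_add G (data_add F (data_neg G)))"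
    using assms by (intro smooth_norm_cong smooth_rules) (simp_all add: smooth_simps smooth_rules)
  also have "\<dots> \<le> smooth_norm P p r G + smooth_norm P p r (data_add F (data_neg G))"
    using assms by (intro smooth_norm_add smooth_rules)
  finally show ?thesis using assms by (simp add: smooth_dist_eq)
qed

lemma smooth_series_tail:
  assumes H: "\<And>i. smooth_functional P (H i)" and p: "1 \<le> p" and sm: "summable (\<lambda>i. smooth_norm P p r (H i))"
    and "n \<le> m"
  shows "smooth_dist P p r (data_sum H m) (data_sum H n) \<le> (\<Sum>i. smooth_norm P p r (H (i + n)))"
proof -
  obtain j where m: "m = n + j" using \<open>n \<le> m\<close> le_Suc_ex by blast
  have "smooth_dist P p r (data_sum H m) (data_sum H n) \<le> (\<Sum>i<j. smooth_norm P p r (H (n + i)))"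
    unfolding m smooth_dist_data_sum[OF H p] by (rule smooth_norm_data_sum[OF H p])
  also have "\<dots> \<le> (\<Sum>i. smooth_norm P p r (H (i + n)))"
    using summable_ignore_initial_segment[OF sm, of n]
    by (subst add.commute) (intro sum_le_suminf, auto simp: smooth_norm_nonneg)
  finally show ?thesis .
qed

lemma smooth_series_AE_summable:
  assumes H: "\<And>i. smooth_functional P (H i)" and p: "1 \<le> p" and sm: "summable (\<lambda>i. smooth_norm P p r (H i))"
  shows "AE w in P. summable (\<lambda>i. \<bar>sval (H i) w\<bar>)"
proof -
  \<comment> \<open>The geometric term makes the bound positive where a norm vanishes and is itself
    summable.\<close>
  let ?a = "\<lambda>i. smooth_norm P p r (H i) + (1 / 2) ^ i"
  have sa: "summable (\<lambda>i. 2 * ?a i)"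
    by (intro summable_mult summable_add sm summable_geometric) auto
  have [measurable]: "sval (H i) \<in> borel_measurable P" for i using H by (rule sval_measurable)
  have L1: "integrable P (sval (H i))" "(\<integral>w. \<bar>sval (H i) w\<bar> \<partial>P) \<le> 2 * ?a i" for i
    using sval_L1_le[OF H p, of r i "?a i"] by (auto simp: add_nonneg_pos smooth_norm_nonneg)
  have "(\<integral>\<^sup>+w. (\<Sum>i. ennreal \<bar>sval (H i) w\<bar>) \<partial>P) = (\<Sum>i. \<integral>\<^sup>+w. ennreal \<bar>sval (H i) w\<bar> \<partial>P)"
    by (rule nn_integral_suminf) simp
  also have "\<dots> = (\<Sum>i. ennreal (\<integral>w. \<bar>sval (H i) w\<bar> \<partial>P))"
    using L1(1) by (intro suminf_cong nn_integral_eq_integral) auto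
  also have "\<dots> \<le> (\<Sum>i. ennreal (2 * ?a i))"
    using L1(2) by (intro suminf_le ennreal_leI) auto
  also have "\<dots> = ennreal (\<Sum>i. 2 * ?a i)"
    using sa by (intro suminf_ennreal2) (auto simp: smooth_norm_nonneg)
  also have "\<dots> < \<infinity>" by simp
  finally have "AE w in P. (\<Sum>i. ennreal \<bar>sval (H i) w\<bar>) \<noteq> \<infinity>"
    by (intro nn_integral_PInf_AE) auto
  then show ?thesis
    by eventually_elim (rule summable_suminf_not_top, auto)
qed

text \<open>Absolutely summable series converge. The limit is taken pointwise a.e., so that later
  statements about signs and order are at hand, and is then shown to be the p-th mean limit that
  \<open>sobolev\<close> asks for.\<close>

lemma smooth_series:
  assumes H: "\<And>i. smooth_functional P (H i)" and p: "1 < p" and sm: "summable (\<lambda>i. smooth_norm P p r (H i))"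
  shows "\<exists>c. sobolev P p r (\<lambda>w. \<Sum>i. sval (H i) w) c \<and> c \<le> (\<Sum>i. smooth_norm P p r (H i))"
    and "(\<lambda>n. \<integral>w. \<bar>sval (data_sum H n) w - (\<Sum>i. sval (H i) w)\<bar> powr p \<partial>P) \<longlonglongrightarrow> 0"
    and "integrable P (\<lambda>w. \<bar>sval (data_sum H n) w - (\<Sum>i. sval (H i) w)\<bar> powr p)"
proof -
  have p1: "1 \<le> p" using p by simp
  have [measurable]: "sval (H i) \<in> borel_measurable P" for i using H by (rule sval_measurable)
  let ?A = "data_sum H" and ?\<phi> = "\<lambda>w. \<Sum>i. sval (H i) w"
  have S: "smooth_functional P (?A m)" for m by (rule smooth_data_sum[OF H])
  have [measurable]: "sval (?A n) \<in> borel_measurable P" for n using S by (rule sval_measurable)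
  have \<phi>m[measurable]: "?\<phi> \<in> borel_measurable P" by measurable
  define \<rho> where "\<rho> n = (\<Sum>i. smooth_norm P p r (H (i + n)))" for n
  have \<rho>0: "0 \<le> \<rho> n" for n unfolding \<rho>_def
    using summable_ignore_initial_segment[OF sm, of n]
      by (intro suminf_nonneg) (auto simp: smooth_norm_nonneg)
  have \<rho>lim: "\<rho> \<longlonglongrightarrow> 0" unfolding \<rho>_def
    by (rule suminf_exist_split2[OF sm])
  have dist: "smooth_dist P p r (?A m) (?A n) \<le> \<rho> n" if "n \<le> m" for m n
    unfolding \<rho>_def by (rule smooth_series_tail[OF H p1 sm that])
  have conv: "AE w in P. (\<lambda>n. sval (?A n) w) \<longlonglongrightarrow> ?\<phi> w"
    using smooth_series_AE_summable[OF H p1 sm]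
  proof eventually_elim
    case (elim w)
    then have "summable (\<lambda>i. sval (H i) w)" by (rule summable_rabs_cancel)
    then show ?case unfolding sval_data_sum[OF H] by (rule summable_LIMSEQ)
  qed
  \<comment> \<open>Fatou's lemma in m: the distance from the n-th to any later partial sum is at
    most the tail \<rho> n of the norms, and this survives the pointwise limit.\<close>
  have bound: "(\<integral>\<^sup>+w. ennreal (\<bar>sval (?A n) w - ?\<phi> w\<bar> powr p) \<partial>P) \<le> ennreal (\<rho> n powr p)" for n
  proof -
    have "(\<integral>\<^sup>+w. ennreal (\<bar>sval (?A n) w - ?\<phi> w\<bar> powr p) \<partial>P) =
       (\<integral>\<^sup>+w. liminf (\<lambda>m. ennreal (\<bar>sval (?A n) w - sval (?A m) w\<bar> powr p)) \<partial>P)"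
    proof (intro nn_integral_cong_AE, use conv in eventually_elim)
      case (elim w)
      have "(\<lambda>m. ennreal (\<bar>sval (?A n) w - sval (?A m) w\<bar> powr p)) \<longlonglongrightarrow> ennreal
          (\<bar>sval (?A n) w - ?\<phi> w\<bar> powr p)"
        using elim p by (intro tendsto_ennrealI tendsto_powr' tendsto_intros) auto
      then show ?case using lim_imp_Liminf[OF sequentially_bot] by metis
    qed
    also have "\<dots> \<le> liminf (\<lambda>m. \<integral>\<^sup>+w. ennreal (\<bar>sval (?A n) w - sval (?A m) w\<bar> powr p) \<partial>P)"
      by (rule nn_integral_liminf) measurable
    also have "\<dots> \<le> liminf (\<lambda>m. ennreal (\<rho> n powr p))"
    proof (rule Liminf_mono, rule eventually_sequentiallyI)
      fix m assume m: "n \<le> m"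
      let ?D = "data_add (?A m) (data_neg (?A n))"
      have D: "smooth_functional P ?D" by (intro smooth_data_add S smooth_data_neg)
      have "(\<integral>\<^sup>+w. ennreal (\<bar>sval (?A n) w - sval (?A m) w\<bar> powr p) \<partial>P)
          = (\<integral>\<^sup>+w. ennreal (\<bar>sval ?D w\<bar> powr p) \<partial>P)"
        by (simp add: sval_add[OF S] sval_neg abs_minus_commute)
      also have "\<dots> = ennreal (\<integral>w. \<bar>sval ?D w\<bar> powr p \<partial>P)"
        by (rule nn_integral_eq_integral[OF sval_integrable[OF D p1]]) auto
      also have "\<dots> \<le> ennreal (smooth_norm P p r ?D powr p)" by (intro ennreal_leI sval_norm_le[OF D p1])
      also have "\<dots> \<le> ennreal (\<rho> n powr p)"
        using dist[OF m] p by (intro ennreal_leI powr_mono2)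
          (auto simp: smooth_dist_eq[OF S S] smooth_norm_nonneg)
      finally show "(\<integral>\<^sup>+w. ennreal (\<bar>sval (?A n) w - sval (?A m) w\<bar> powr p) \<partial>P) \<le> ennreal (\<rho> n powr p)" .
    qed
    also have "\<dots> = ennreal (\<rho> n powr p)" by (simp add: Liminf_const)
    finally show ?thesis .
  qed
  show I: "integrable P (\<lambda>w. \<bar>sval (?A n) w - ?\<phi> w\<bar> powr p)" for n
    using bound[of n] by (intro integrableI_nonneg) (auto intro: le_less_trans)
  have Ib: "(\<integral>w. \<bar>sval (?A n) w - ?\<phi> w\<bar> powr p \<partial>P) \<le> \<rho> n powr p" for n
    using bound[of n] unfolding nn_integral_eq_integral[OF I AE_I2[OF powr_ge_zero]]
      by (simp add: ennreal_le_iff)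
  show Lp: "(\<lambda>n. \<integral>w. \<bar>sval (?A n) w - ?\<phi> w\<bar> powr p \<partial>P) \<longlonglongrightarrow> 0"
  proof (rule tendsto_sandwich[OF _ _ tendsto_const])
    show "(\<lambda>n. \<rho> n powr p) \<longlonglongrightarrow> 0"
      using tendsto_powr'[OF \<rho>lim tendsto_const, of p] p \<rho>0 by simp
  qed (use Ib in \<open>auto intro!: always_eventually\<close>)
  have cauchy: "\<exists>N. \<forall>m\<ge>N. \<forall>n\<ge>N. smooth_dist P p r (?A m) (?A n) < e" if e: "0 < e" for e
  proof -
    obtain N where N: "\<And>n. n \<ge> N \<Longrightarrow> \<rho> n < e"
      using order_tendstoD(2)[OF \<rho>lim e] by (auto simp: eventually_sequentially)
    have "smooth_dist P p r (?A m) (?A n) < e" if "m \<ge> N" "n \<ge> N" for m n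
    proof (cases "n \<le> m")
      case True
      then show ?thesis using dist[OF True] N[OF that(2)] by simp
    next
      case False
      then show ?thesis using dist[of m n] N[OF that(1)] smooth_dist_sym[OF S S, of p r m n] by simp
    qed
    then show ?thesis by blast
  qed
  have "Cauchy (\<lambda>n. smooth_norm P p r (?A n))"
  proof (rule metric_CauchyI)
    fix e :: real assume "0 < e"
    then obtain N where N: "\<forall>m\<ge>N. \<forall>n\<ge>N. smooth_dist P p r (?A m) (?A n) < e" using cauchy by blast
    have "dist (smooth_norm P p r (?A m)) (smooth_norm P p r (?A n)) < e" if "m \<ge> N" "n \<ge> N" for m n
      using smooth_norm_dist[OF S S p1, of r m n] smooth_norm_dist[OF S S p1, of r n m] N that
      unfolding dist_real_def by (smt (verit))
    then show "\<exists>M. \<forall>m\<ge>M. \<forall>n\<ge>M. dist (smooth_norm P p r (?A m)) (smooth_norm P p r (?A n)) < e" by blast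
  qed
  then obtain c where c: "(\<lambda>n. smooth_norm P p r (?A n)) \<longlonglongrightarrow> c"
    using Cauchy_convergent convergentD by blast
  have "smooth_norm P p r (?A n) \<le> (\<Sum>i. smooth_norm P p r (H i))" for n
    by (rule order_trans[OF smooth_norm_data_sum[OF H p1] sum_le_suminf[OF sm]])
      (auto simp: smooth_norm_nonneg)
  then have "c \<le> (\<Sum>i. smooth_norm P p r (H i))" by (intro LIMSEQ_le_const2[OF c]) auto
  moreover have "integrable P (\<lambda>w. \<bar>?\<phi> w\<bar> powr p)"
    using I[of 0] by (simp add: sval_zero)
  ultimately show "\<exists>c. sobolev P p r ?\<phi> c \<and> c \<le> (\<Sum>i. smooth_norm P p r (H i))"
    unfolding sobolev_def using S cauchy c Lp \<phi>m by blast
qed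

text \<open>Telescoping a fast subsequence of the approximating smooth functionals. The first term
  costs nearly the norm c and the differences cost arbitrarily little, so the series loses at most
  \<delta> against the norm.\<close>

lemma sobolev_series:
  assumes \<phi>: "sobolev P p r \<phi> c" and p: "1 < p" and \<delta>: "0 < \<delta>"
  obtains H where "\<And>i. smooth_functional P (H i)" "summable (\<lambda>i. smooth_norm P p r (H i))"
    "(\<Sum>i. smooth_norm P p r (H i)) \<le> c + \<delta>" "AE w in P. \<phi> w = (\<Sum>i. sval (H i) w)"
proof -
  have p1: "1 \<le> p" using p by simp
  have [measurable]: "\<phi> \<in> borel_measurable P" and \<phi>i: "integrable P (\<lambda>w. \<bar>\<phi> w\<bar> powr p)"
    using \<phi> unfolding sobolev_def by simp_all
  from \<phi>[unfolded sobolev_def, THEN conjunct2, THEN conjunct2]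
  obtain F where FF: "(\<forall>n. smooth_functional P (F n)) \<and>
        (\<forall>e>0. \<exists>N. \<forall>m\<ge>N. \<forall>n\<ge>N. smooth_dist P p r (F m) (F n) < e) \<and>
        (\<lambda>n. LINT w|P. \<bar>sval (F n) w - \<phi> w\<bar> powr p) \<longlonglongrightarrow> 0 \<and>
        (\<lambda>n. smooth_norm P p r (F n)) \<longlonglongrightarrow> c"
    by (rule exE)
  have F: "smooth_functional P (F n)" for n using FF by simp
  have cau: "\<exists>N. \<forall>m\<ge>N. \<forall>n\<ge>N. smooth_dist P p r (F m) (F n) < e" if "0 < e" for e using FF that by simp
  have lim: "(\<lambda>n. \<integral>w. \<bar>sval (F n) w - \<phi> w\<bar> powr p \<partial>P) \<longlonglongrightarrow> 0"
    and nlim: "(\<lambda>n. smooth_norm P p r (F n)) \<longlonglongrightarrow> c" using FF by simp_all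
  have [measurable]: "sval (F n) \<in> borel_measurable P" for n using F by (rule sval_measurable)
  \<comment> \<open>Sums to \<delta> / 2; the other half is the slack of the first term.\<close>
  define e where "e j = \<delta> / 2 * (1 / 2) ^ Suc j" for j :: nat
  have e0: "0 < e j" for j using \<delta> by (simp add: e_def)
  have "\<forall>j. \<exists>N. \<forall>m\<ge>N. \<forall>n\<ge>N. smooth_dist P p r (F m) (F n) < e j" using cau e0 by blast
  then obtain K where K': "\<forall>j. \<forall>m\<ge>K j. \<forall>n\<ge>K j. smooth_dist P p r (F m) (F n) < e j"
      by (rule choice[THEN exE])
  then have K: "smooth_dist P p r (F m) (F n) < e j" if "m \<ge> K j" "n \<ge> K j" for j m n using that by simp
  have "\<forall>\<^sub>F n in sequentially. smooth_norm P p r (F n) < c + \<delta> / 2"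
    using nlim \<delta> by (intro order_tendstoD) auto
  then obtain M where M: "\<And>n. n \<ge> M \<Longrightarrow> smooth_norm P p r (F n) < c + \<delta> / 2"
      by (auto simp: eventually_sequentially)
  \<comment> \<open>Beyond M the norms are below c + \<delta> / 2, beyond K j the distances are
    below e j, and the summand j makes k strictly increasing.\<close>
  define k where "k j = M + j + (\<Sum>i\<le>j. K i)" for j
  have kK: "K j \<le> k j" for j unfolding k_def by (intro trans_le_add2 member_le_sum) auto
  have kS: "k j < k (Suc j)" for j by (simp add: k_def)
  have km: "strict_mono k" using kS by (simp add: strict_mono_Suc_iff)
  define H where "H i = (case i of 0 \<Rightarrow> F (k 0) | Suc j \<Rightarrow> data_add (F (k (Suc j))) (data_neg (F (k j))))"
      for i
  have HF: "smooth_functional P (H i)" for i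
    by (cases i) (auto simp: H_def F smooth_data_add smooth_data_neg)
  have H0: "smooth_norm P p r (H 0) \<le> c + \<delta> / 2" using M[of "k 0"] by (simp add: H_def k_def)
  have HS: "smooth_norm P p r (H (Suc j)) \<le> e j" for j
    using K[of j "k (Suc j)" "k j"] kK[of j] kS[of j] by (simp add: H_def smooth_dist_eq[OF F F, symmetric])
  have es: "e sums (\<delta> / 2)"
    using sums_mult[OF geometric_sums[of "1 / 2 :: real"], of "\<delta> / 4"]
      by (simp add: e_def[abs_def] mult.commute)
  have sS: "summable (\<lambda>j. smooth_norm P p r (H (Suc j)))"
    by (rule summable_comparison_test[OF _ sums_summable[OF es]]) (use HS smooth_norm_nonneg in auto)
  then have sm: "summable (\<lambda>i. smooth_norm P p r (H i))" by (rule summable_Suc_iff[THEN iffD1])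
  have "(\<Sum>i. smooth_norm P p r (H i)) = smooth_norm P p r (H 0) + (\<Sum>j. smooth_norm P p r (H (Suc j)))"
    using suminf_split_head[OF sm] by simp
  also have "\<dots> \<le> (c + \<delta> / 2) + (\<Sum>j. e j)"
    using HS sS es by (intro add_mono H0 suminf_le) (auto simp: sums_iff)
  also have "\<dots> = c + \<delta>" using es by (simp add: sums_iff)
  finally have sum_le: "(\<Sum>i. smooth_norm P p r (H i)) \<le> c + \<delta>" .
  have sv: "sval (data_sum H (Suc n)) w = sval (F (k n)) w" for n w
  proof -
    have h: "sval (H 0) w = sval (F (k 0)) w"
        "sval (H (Suc j)) w = sval (F (k (Suc j))) w - sval (F (k j)) w" for j
      by (simp_all add: H_def sval_add[OF F] sval_neg)
    have "(\<Sum>i<Suc n. sval (H i) w) = sval (F (k n)) w" by (induction n) (simp_all add: h)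
    then show ?thesis unfolding sval_data_sum[OF HF] .
  qed
  have subseq: "(\<lambda>n. \<integral>w. norm (\<bar>sval (F (k n)) w - \<phi> w\<bar> powr p) \<partial>P) \<longlonglongrightarrow> 0"
    using LIMSEQ_subseq_LIMSEQ[OF lim km] by (simp add: o_def)
  have int: "integrable P (\<lambda>w. \<bar>sval (F (k n)) w - \<phi> w\<bar> powr p)" for n
  proof -
    have I: "integrable P (\<lambda>w. (\<bar>sval (F (k n)) w\<bar> + \<bar>\<phi> w\<bar>) powr p)"
      using p \<phi>i sval_integrable[OF F p1]
      by (intro sum_minkowski_integrable[where A="{()}" and f="\<lambda>_ w. \<bar>sval (F (k n)) w\<bar>"
        and g="\<lambda>_ w. \<bar>\<phi> w\<bar>"]) auto
    show ?thesis
      by (rule Bochner_Integration.integrable_bound[OF I]) (use p in \<open>auto intro!: powr_mono2\<close>)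
  qed
  obtain s where s: "strict_mono s"
      "AE w in P. (\<lambda>n. \<bar>sval (F (k (s n))) w - \<phi> w\<bar> powr p) \<longlonglongrightarrow> 0"
    using tendsto_L1_AE_subseq[OF int subseq] by blast
  have \<phi>H: "AE w in P. \<phi> w = (\<Sum>i. sval (H i) w)"
    using s(2) smooth_series_AE_summable[OF HF p1 sm]
  proof eventually_elim
    case (elim w)
    have "(\<lambda>n. (\<bar>sval (F (k (s n))) w - \<phi> w\<bar> powr p) powr (1 / p)) \<longlonglongrightarrow> 0 powr (1 / p)"
      using elim(1) p by (intro tendsto_powr') auto
    then have "(\<lambda>n. \<bar>sval (F (k (s n))) w - \<phi> w\<bar>) \<longlonglongrightarrow> 0" using p
        by (simp add: powr_powr)
    then have 1: "(\<lambda>n. sval (F (k (s n))) w) \<longlonglongrightarrow> \<phi> w"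
        by (simp add: tendsto_rabs_zero_iff LIM_zero_cancel)
    have "(\<lambda>n. sval (data_sum H n) w) \<longlonglongrightarrow> (\<Sum>i. sval (H i) w)"
      unfolding sval_data_sum[OF HF] by (rule summable_LIMSEQ[OF summable_rabs_cancel[OF elim(2)]])
    then have "(\<lambda>n. sval (F (k n)) w) \<longlonglongrightarrow> (\<Sum>i. sval (H i) w)"
      unfolding sv[symmetric] by (rule LIMSEQ_Suc)
    then have "(\<lambda>n. sval (F (k (s n))) w) \<longlonglongrightarrow> (\<Sum>i. sval (H i) w)"
      using LIMSEQ_subseq_LIMSEQ[OF _ s(1)] by (fastforce simp: o_def)
    then show ?case using 1 LIMSEQ_unique by blast
  qed
  show ?thesis by (rule that[OF HF sm sum_le \<phi>H])
qed

text \<open>The test function for the union is the sum of the \<phi> i: they are nonnegative, so the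
  sum is at least 1 wherever one of them is, and no maximum has to be formed in the Sobolev space.
  To place the sum in that space, each \<phi> i is expanded into smooth functionals and the double
  series is enumerated as one series of total norm at most the sum of the e i.\<close>

lemma open_capacity_UN:
  assumes p: "1 < p" and cap: "\<And>i. open_capacity P p r (U i) < ennreal (e i)" and e: "summable e"
  shows "open_capacity P p r (\<Union>i. U i) \<le> ennreal (\<Sum>i. e i)"
proof -
  have p1: "1 \<le> p" using p by simp
  have e0: "0 < e i" for i
  proof (rule ccontr)
    assume "\<not> 0 < e i"
    then have "ennreal (e i) = 0" by (simp add: ennreal_neg)
    then show False using cap[of i] by simp
  qed
  define R where "R i H \<phi> \<longleftrightarrow> (\<forall>j. smooth_functional P (H j)) \<and> summable (\<lambda>j. smooth_norm P p r (H j)) \<and>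
      (\<Sum>j. smooth_norm P p r (H j)) \<le> e i \<and> (AE w in P. \<phi> w = (\<Sum>j. sval (H j) w)) \<and>
      (AE w in P. w \<in> U i \<longrightarrow> 1 \<le> \<phi> w) \<and> (AE w in P. 0 \<le> \<phi> w)" for i H \<phi>
  have "\<exists>H \<phi>. R i H \<phi>" for i
  proof -
    obtain c \<phi> where c: "sobolev P p r \<phi> c" "AE w in P. w \<in> U i \<longrightarrow> 1 \<le> \<phi> w" "AE w in P. 0 \<le> \<phi> w"
        "ennreal c < ennreal (e i)"
      using cap[of i] unfolding open_capacity_def Inf_less_iff by blast
    have "c < e i"
    proof (rule ccontr)
      assume "\<not> c < e i"
      then have "ennreal (e i) \<le> ennreal c" by (intro ennreal_leI) simp
      then show False using c(4) by simp
    qed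
    then have "0 < e i - c" by simp
    from sobolev_series[OF c(1) p this] obtain H where "\<And>j. smooth_functional P (H j)"
        "summable (\<lambda>j. smooth_norm P p r (H j))"
      "(\<Sum>j. smooth_norm P p r (H j)) \<le> c + (e i - c)" "AE w in P. \<phi> w = (\<Sum>j. sval (H j) w)" by blast
    then have "R i H \<phi>" using c unfolding R_def by simp
    then show ?thesis by blast
  qed
  then obtain H \<phi> where HR: "\<And>i. R i (H i) (\<phi> i)" by metis
  have H: "smooth_functional P (H i j)" and sH: "summable (\<lambda>j. smooth_norm P p r (H i j))"
    and sHe: "(\<Sum>j. smooth_norm P p r (H i j)) \<le> e i" and \<phi>H: "AE w in P. \<phi> i w = (\<Sum>j. sval (H i j) w)"
    and \<phi>1: "AE w in P. w \<in> U i \<longrightarrow> 1 \<le> \<phi> i w" and \<phi>0: "AE w in P. 0 \<le> \<phi> i w" for i j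
    using HR[of i] unfolding R_def by simp_all
  define G where "G n = H (fst (prod_decode n)) (snd (prod_decode n))" for n
  have GF: "smooth_functional P (G n)" for n by (simp add: G_def H)
  have ens: "(\<Sum>n. ennreal (smooth_norm P p r (G n))) \<le> ennreal (\<Sum>i. e i)"
  proof -
    have "(\<Sum>n. ennreal (smooth_norm P p r (G n))) = (\<Sum>i. ennreal (\<Sum>j. smooth_norm P p r (H i j)))"
      unfolding G_def
      by (rule suminf_ennreal_2dimen[where f="\<lambda>(i, j). ennreal (smooth_norm P p r (H i j))", unfolded
        o_def case_prod_beta])
         (auto simp: suminf_ennreal2[OF _ sH] smooth_norm_nonneg)
    also have "\<dots> \<le> (\<Sum>i. ennreal (e i))" by (intro suminf_le ennreal_leI sHe) auto
    also have "\<dots> = ennreal (\<Sum>i. e i)" using e e0 by (intro suminf_ennreal2) (auto simp: less_imp_le)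
    finally show ?thesis .
  qed
  have sG: "summable (\<lambda>n. smooth_norm P p r (G n))"
    by (rule summable_suminf_not_top) (use ens in \<open>auto simp: smooth_norm_nonneg top_unique\<close>)
  have sGe: "(\<Sum>n. smooth_norm P p r (G n)) \<le> (\<Sum>i. e i)"
    using ens e e0 unfolding suminf_ennreal2[OF smooth_norm_nonneg sG]
    by (subst (asm) ennreal_le_iff) (auto intro!: suminf_nonneg simp: less_imp_le)
  obtain c where c: "sobolev P p r (\<lambda>w. \<Sum>n. sval (G n) w) c" "c \<le> (\<Sum>n. smooth_norm P p r (G n))"
    using smooth_series(1)[OF GF p sG] by blast
  \<comment> \<open>Where the enumerated series converges absolutely it may be summed by rows, and
    row i adds up to \<phi> i w.\<close>
  have key: "(\<Sum>n. sval (G n) w) \<ge> 0 \<and> (\<forall>i. \<phi> i w \<le> (\<Sum>n. sval (G n) w))"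
    if s: "summable (\<lambda>n. \<bar>sval (G n) w\<bar>)" and eq: "\<forall>i. \<phi> i w = (\<Sum>j. sval (H i j) w)"
      and nn: "\<forall>i. 0 \<le> \<phi> i w" for w
  proof -
    let ?x = "\<lambda>(i, j). sval (H i j) w"
    have Gx: "sval (G n) w = ?x (prod_decode n)" for n by (simp add: G_def case_prod_beta)
    have bij: "bij_betw prod_decode UNIV UNIV" by (rule bij_prod_decode)
    have "(\<lambda>n. sval (G n) w) summable_on UNIV" using s by (intro norm_summable_imp_summable_on) simp
    then have sx: "?x summable_on (UNIV \<times> UNIV)"
      unfolding Gx summable_on_reindex_bij_betw[OF bij] by simp
    have row: "(\<Sum>\<^sub>\<infinity>j. ?x (i, j)) = \<phi> i w" for i
    proof -
      have "(\<lambda>j. sval (H i j) w) summable_on UNIV"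
          using summable_on_SigmaD1[of "\<lambda>i j. sval (H i j) w" UNIV "\<lambda>_. UNIV" i] sx by simp
      then have "(\<lambda>j. sval (H i j) w) sums (\<Sum>\<^sub>\<infinity>j. sval (H i j) w)"
          by (intro has_sum_imp_sums has_sum_infsum)
      then show ?thesis using eq by (simp add: sums_iff)
    qed
    have "((\<lambda>n. sval (G n) w) has_sum (\<Sum>n. sval (G n) w)) UNIV"
      using s by (intro norm_summable_imp_has_sum summable_sums summable_rabs_cancel[OF s]) simp
    then have "(\<Sum>n. sval (G n) w) = (\<Sum>\<^sub>\<infinity>n. sval (G n) w)" by (simp add: infsumI)
    also have "\<dots> = infsum ?x (UNIV \<times> UNIV)" unfolding Gx infsum_reindex_bij_betw[OF bij] by simp
    also have "\<dots> = (\<Sum>\<^sub>\<infinity>i. \<phi> i w)" using infsum_Sigma_banach[OF sx] by (simp add: row[unfolded prod.case])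
    finally have tot: "(\<Sum>n. sval (G n) w) = (\<Sum>\<^sub>\<infinity>i. \<phi> i w)" .
    have s\<phi>: "(\<lambda>i. \<phi> i w) summable_on UNIV"
      using summable_on_Sigma_banach[OF sx] row by (simp add: case_prod_beta)
    have "\<phi> i w \<le> (\<Sum>\<^sub>\<infinity>i. \<phi> i w)" for i
      using finite_sum_le_infsum[OF s\<phi>, of "{i}"] nn by simp
    moreover have "0 \<le> (\<Sum>\<^sub>\<infinity>i. \<phi> i w)" using nn by (intro infsum_nonneg) auto
    ultimately show ?thesis unfolding tot by simp
  qed
  have AEk: "AE w in P. (\<Sum>n. sval (G n) w) \<ge> 0 \<and> (\<forall>i. \<phi> i w \<le> (\<Sum>n. sval (G n) w))"
  proof -
    have "AE w in P. \<forall>i. \<phi> i w = (\<Sum>j. sval (H i j) w)" "AE w in P. \<forall>i. 0 \<le> \<phi> i w"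
      using \<phi>H \<phi>0 by (simp_all add: AE_all_countable)
    with smooth_series_AE_summable[OF GF p1 sG] show ?thesis by eventually_elim (rule key)
  qed
  have "AE w in P. \<forall>i. w \<in> U i \<longrightarrow> 1 \<le> \<phi> i w" using \<phi>1 by (simp add: AE_all_countable)
  with AEk have G1: "AE w in P. w \<in> (\<Union>i. U i) \<longrightarrow> 1 \<le> (\<Sum>n. sval (G n) w)"
  proof eventually_elim
    case (elim w)
    show ?case
    proof
      assume "w \<in> (\<Union>i. U i)"
      then obtain i where "w \<in> U i" by blast
      then have "1 \<le> \<phi> i w" "\<phi> i w \<le> (\<Sum>n. sval (G n) w)" using elim by simp_all
      then show "1 \<le> (\<Sum>n. sval (G n) w)" by linarith
    qed
  qed
  have G0: "AE w in P. 0 \<le> (\<Sum>n. sval (G n) w)" using AEk by eventually_elim simp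
  have "open_capacity P p r (\<Union>i. U i) \<le> ennreal c"
    unfolding open_capacity_def
    by (rule Inf_lower) (intro CollectI exI[of _ c] exI[of _ "\<lambda>w. \<Sum>n. sval (G n) w"] conjI refl c(1) G1 G0)
  also have "\<dots> \<le> ennreal (\<Sum>i. e i)" using c(2) sGe by (intro ennreal_leI) simp
  finally show ?thesis .
qed

end

section \<open>The kernel of fractional Brownian motion\<close>

text \<open>Both integrals of \<open>fbm_kernel\<close> take this form after u = s x; the cases H >
  1/2 and H < 1/2 interchange the two exponents.\<close>

definition kernel_int :: "real \<Rightarrow> real \<Rightarrow> real \<Rightarrow> real" where
  "kernel_int a b y = (\<integral>x. indicator {1<..<y} x * ((x - 1) powr a * x powr b) \<partial>lborel)"

lemma powr_shift_integral:
  fixes a y :: real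
  assumes a: "-1 < a" and y: "1 \<le> y"
  shows "has_bochner_integral lborel (\<lambda>x. indicator {1<..<y} x * (x - 1) powr a)
      ((y - 1) powr (a + 1) / (a + 1))"
proof -
  have "((\<lambda>x. x powr a) has_integral ((y - 1) powr (a + 1) / (a + 1))) {0..y - 1}"
    using a y by (intro has_integral_powr_from_0) auto
  then have hi: "((\<lambda>x. if x \<in> {0..y - 1} then x powr a else 0) has_integral
      ((y - 1) powr (a + 1) / (a + 1))) UNIV"
    by (simp only: has_integral_restrict_UNIV)
  have eq: "(\<lambda>x. if x \<in> {0..y - 1} then x powr a else 0) = (\<lambda>x. indicator {0..y - 1} x * x powr a)"
    by (auto simp: indicator_def)
  have "(\<integral>\<^sup>+x. ennreal (indicator {0..y - 1} x * x powr a) \<partial>lborel)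
      = ennreal ((y - 1) powr (a + 1) / (a + 1))"
    by (rule nn_integral_has_integral_lborel[OF _ _ hi[unfolded eq]]) auto
  then have "has_bochner_integral lborel (\<lambda>x. indicator {0..y - 1} x * x powr a)
      ((y - 1) powr (a + 1) / (a + 1))"
    using a by (intro has_bochner_integral_nn_integral) auto
  then have "has_bochner_integral lborel (\<lambda>x. indicator {0..y - 1} (- 1 + 1 * x) * (- 1 + 1 * x) powr a)
      (((y - 1) powr (a + 1) / (a + 1)) /\<^sub>R \<bar>1\<bar>)"
    by (subst (asm) lborel_has_bochner_integral_real_affine_iff[of 1 _ _ "-1"]) auto
  then have "has_bochner_integral lborel (\<lambda>x. indicator {0..y - 1} (x - 1) * (x - 1) powr a)
      ((y - 1) powr (a + 1) / (a + 1))"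
    by simp
  then show ?thesis
  proof (rule has_bochner_integralI_AE)
    show "AE x in lborel. indicator {0..y - 1} (x - 1) * (x - 1) powr a = indicator {1<..<y} x
        * (x - 1) powr a"
      using AE_lborel_singleton[of y] by eventually_elim (auto simp: indicator_def)
  qed auto
qed

lemma kernel_int_integrable:
  fixes a b y :: real
  assumes a: "-1 < a" and y: "1 \<le> y"
  shows "integrable lborel (\<lambda>x. indicator {1<..<y} x * ((x - 1) powr a * x powr b))"
proof -
  have I: "integrable lborel (\<lambda>x. (1 + y powr b) * (indicator {1<..<y} x * (x - 1) powr a))"
    using powr_shift_integral[OF assms]
      by (intro integrable_mult_right) (simp add: has_bochner_integral_iff)
  \<comment> \<open>The singularity at 1 sits in the other factor; x^b is bounded by y^b or by 1
    according to the sign of b.\<close>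
  have le: "x powr b \<le> 1 + y powr b" if "1 < x" "x < y" for x
  proof (cases "0 \<le> b")
    case True
    then have "x powr b \<le> y powr b" using that by (intro powr_mono2) auto
    then show ?thesis by simp
  next
    case False
    then have "x powr b \<le> x powr 0" using that by (intro powr_mono) auto
    then show ?thesis using that by (simp add: add_increasing2)
  qed
  show ?thesis
    by (rule Bochner_Integration.integrable_bound[OF I])
       (use le in \<open>auto simp: indicator_def mult.commute intro!: mult_left_mono\<close>)
qed

lemma kernel_int_nonneg: "0 \<le> kernel_int a b y"
  unfolding kernel_int_def by (intro integral_nonneg_AE AE_I2) (auto simp: indicator_def)

lemma kernel_int_scale:
  assumes "0 < s" "s < t"
  shows "(LBINT u=ereal s..ereal t. (u - s) powr a * u powr b) = s powr (a + b + 1)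
      * kernel_int a b (t / s)"
proof -
  have "(LBINT u=ereal s..ereal t. (u - s) powr a * u powr b) =
      (\<integral>u. indicator {s<..<t} u * ((u - s) powr a * u powr b) \<partial>lborel)"
    using assms by (simp add: interval_integral_Ioo set_lebesgue_integral_def)
  also have "\<dots> = s * (\<integral>x. indicator {s<..<t} (s * x) * ((s * x - s) powr a * (s * x) powr b) \<partial>lborel)"
    using assms lborel_integral_real_affine[of s "\<lambda>u. indicator {s<..<t} u * ((u - s) powr a * u powr b)"
      0] by simp
  also have "(\<integral>x. indicator {s<..<t} (s * x) * ((s * x - s) powr a * (s * x) powr b) \<partial>lborel) =
      (\<integral>x. s powr (a + b) * (indicator {1<..<t / s} x * ((x - 1) powr a * x powr b)) \<partial>lborel)"
  proof (intro Bochner_Integration.integral_cong refl)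
    fix x
    have "indicator {s<..<t} (s * x) = (indicator {1<..<t / s} x :: real)"
      using assms by (auto simp: indicator_def field_simps)
    moreover have "(s * x - s) powr a * (s * x) powr b = s powr (a + b) * ((x - 1) powr a * x powr b)"
        if "1 < x"
    proof -
      have "s * x - s = s * (x - 1)" by (simp add: algebra_simps)
      then show ?thesis using that assms by (simp add: powr_mult powr_add)
    qed
    ultimately show "indicator {s<..<t} (s * x) * ((s * x - s) powr a * (s * x) powr b) =
        s powr (a + b) * (indicator {1<..<t / s} x * ((x - 1) powr a * x powr b))"
      by (cases "1 < x") (auto simp: indicator_def)
  qed
  also have "s * (\<integral>x. s powr (a + b) * (indicator {1<..<t / s} x * ((x - 1) powr a * x powr b)) \<partial>lborel) =
      s powr (a + b + 1) * kernel_int a b (t / s)"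
    using assms by (simp add: kernel_int_def powr_add)
  finally show ?thesis .
qed

lemma kernel_int_continuous:
  assumes a: "-1 < a" and y: "1 < y"
  shows "isCont (kernel_int a b) y"
proof -
  let ?f = "\<lambda>x. indicator {1<..<y + 1} x * ((x - 1) powr a * x powr b)"
  have I: "integrable lborel ?f" using a y by (intro kernel_int_integrable) auto
  have si: "set_integrable lborel A ?f" if "A \<in> sets borel" for A
    using integrable_mult_indicator[OF _ I, of A] that by (simp add: set_integrable_def)
  have "continuous_on {1..y + 1} (\<lambda>z. integral {1..z} ?f)"
    using set_borel_integral_eq_integral(1)[OF si] by (intro indefinite_integral_continuous_1) auto
  moreover have "integral {1..z} ?f = kernel_int a b z" if z: "z \<in> {1<..<y + 1}" for z
  proof -
    have "integral {1..z} ?f = (\<integral>x. indicator {1..z} x * ?f x \<partial>lborel)"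
      using set_borel_integral_eq_integral(2)[OF si[of "{1..z}"]] by (simp add: set_lebesgue_integral_def)
    also have "\<dots> = kernel_int a b z" unfolding kernel_int_def
    proof (intro integral_cong_AE)
      show "AE x in lborel. indicator {1..z} x * ?f x = indicator {1<..<z} x * ((x - 1) powr a * x powr b)"
        using AE_lborel_singleton[of z] by eventually_elim (use z in \<open>auto simp: indicator_def\<close>)
    qed auto
    finally show ?thesis .
  qed
  ultimately have "continuous_on {1<..<y + 1} (kernel_int a b)"
    by (subst continuous_on_cong[OF refl, of _ _ "\<lambda>z. integral {1..z} ?f"])
       (auto intro: continuous_on_subset)
  then show ?thesis using y by (simp add: continuous_on_eq_continuous_at)
qed

text \<open>The kernel is homogeneous of degree H - 1/2 in (t, s); this is its profile K(y, 1). For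
  H < 1/2 the sign has been moved into 1/2 - H, so that both summands are visibly
  nonnegative.\<close>

definition fbm_shape :: "real \<Rightarrow> real \<Rightarrow> real" where
  "fbm_shape H y =
     (if H > 1/2 then sqrt (H * (2 * H - 1) / Beta (2 - 2 * H) (H - 1/2)) * kernel_int (H - 3/2) (H - 1/2) y
      else if H < 1/2 then sqrt (2 * H / ((1 - 2 * H) * Beta (1 - 2 * H) (H + 1/2))) *
        (y powr (H - 1/2) * (y - 1) powr (H - 1/2) + (1/2 - H) * kernel_int (H - 1/2) (H - 3/2) y)
      else 1)"

lemma fbm_kernel_shape:
  assumes s: "0 < s" "s < t"
  shows "fbm_kernel H t s = s powr (H - 1/2) * fbm_shape H (t / s)"
proof -
  consider "H > 1/2" | "H < 1/2" | "H = 1/2" by linarith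
  then show ?thesis
  proof cases
    case 1
    have p1: "s powr (1/2 - H) * s powr (H - 3/2 + (H - 1/2) + 1) = s powr (H - 1/2)"
      unfolding powr_add[symmetric] by (rule arg_cong[where f="(powr) s"]) (simp add: field_simps)
    let ?C = "sqrt (H * (2 * H - 1) / Beta (2 - 2 * H) (H - 1/2))"
    have "fbm_kernel H t s = ?C * s powr (1/2 - H) *
        (s powr (H - 3/2 + (H - 1/2) + 1) * kernel_int (H - 3/2) (H - 1/2) (t / s))"
      using 1 unfolding fbm_kernel_def kernel_int_scale[OF s] by (simp only: if_True)
    also have "\<dots> = s powr (1/2 - H) * s powr (H - 3/2 + (H - 1/2) + 1)
        * (?C * kernel_int (H - 3/2) (H - 1/2) (t / s))"
      by (simp only: ac_simps)
    also have "\<dots> = s powr (H - 1/2) * fbm_shape H (t / s)"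
      using 1 unfolding p1 fbm_shape_def by (simp only: if_True)
    finally show ?thesis .
  next
    case 2
    have n: "\<not> 1/2 < H" using 2 by simp
    have sw: "(LBINT u=ereal s..ereal t. u powr (H - 3/2) * (u - s) powr (H - 1/2)) =
        s powr (H - 1/2 + (H - 3/2) + 1) * kernel_int (H - 1/2) (H - 3/2) (t / s)"
      using kernel_int_scale[OF s, of "H - 1/2" "H - 3/2"] by (simp add: mult.commute)
    have p1: "s powr (1/2 - H) * s powr (H - 1/2 + (H - 3/2) + 1) = s powr (H - 1/2)"
      unfolding powr_add[symmetric] by (rule arg_cong[where f="(powr) s"]) (simp add: field_simps)
    have "t - s = s * (t / s - 1)" using s by (simp add: field_simps)
    then have p2: "(t - s) powr (H - 1/2) = s powr (H - 1/2) * (t / s - 1) powr (H - 1/2)"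
      using s by (simp add: powr_mult)
    let ?C = "sqrt (2 * H / ((1 - 2 * H) * Beta (1 - 2 * H) (H + 1/2)))"
    have "fbm_kernel H t s = ?C * ((t / s) powr (H - 1/2)
        * (s powr (H - 1/2) * (t / s - 1) powr (H - 1/2)) -
        (H - 1/2) * (s powr (1/2 - H) * s powr (H - 1/2 + (H - 3/2) + 1)) * kernel_int (H - 1/2) (H - 3/2)
          (t / s))"
      using 2 n unfolding fbm_kernel_def sw p2 by (simp only: if_False if_True mult.assoc)
    also have "\<dots> = s powr (H - 1/2) * (?C * ((t / s) powr (H - 1/2) * (t / s - 1) powr (H - 1/2) +
        (1/2 - H) * kernel_int (H - 1/2) (H - 3/2) (t / s)))"
      unfolding p1 by (simp only: left_diff_distrib distrib_left right_diff_distrib) (simp only: ac_simps)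
    also have "\<dots> = s powr (H - 1/2) * fbm_shape H (t / s)"
      using 2 n unfolding fbm_shape_def by (simp only: if_False if_True)
    finally show ?thesis .
  next
    case 3
    have "fbm_kernel (1/2) t s = s powr (1/2 - 1/2) * fbm_shape (1/2) (t / s)"
      using s by (simp add: fbm_kernel_def fbm_shape_def)
    then show ?thesis using 3 by (simp only:)
  qed
qed

lemma fbm_shape_continuous:
  assumes "0 < H" "H < 1" "1 < y"
  shows "isCont (fbm_shape H) y"
proof -
  consider "H > 1/2" | "H < 1/2" | "H = 1/2" by linarith
  then show ?thesis
  proof cases
    case 1
    then show ?thesis unfolding fbm_shape_def[abs_def] using assms
      by (auto intro!: continuous_intros kernel_int_continuous)
  next
    case 2
    then show ?thesis unfolding fbm_shape_def[abs_def] using assms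
      by (auto intro!: continuous_intros kernel_int_continuous)
  qed (simp add: fbm_shape_def[abs_def])
qed

lemma Beta_real_pos: "0 < (a::real) \<Longrightarrow> 0 < b \<Longrightarrow> 0 < Beta a b"
  by (simp add: Beta_def)

text \<open>Near the diagonal the kernel is at least of order (t - s)^(H - 1/2). For H > 1/2 the
  factor x^(H - 1/2) under the integral is at least 1 and the rest integrates exactly. For H < 1/2
  the integral is dropped as nonnegative, and y \<le> 2 bounds y^(H - 1/2) from below.\<close>

lemma fbm_shape_lower:
  assumes H: "0 < H" "H < 1"
  obtains c where "0 < c" "\<forall>y. 1 < y \<and> y \<le> 2 \<longrightarrow> c * (y - 1) powr (H - 1/2) \<le> fbm_shape H y"
proof -
  consider "H > 1/2" | "H < 1/2" | "H = 1/2" by linarith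
  then show ?thesis
  proof cases
    case 1
    let ?C = "sqrt (H * (2 * H - 1) / Beta (2 - 2 * H) (H - 1/2))"
    have C: "0 < ?C" using 1 H by (auto intro!: divide_pos_pos mult_pos_pos Beta_real_pos)
    have "?C / (H - 1/2) * (y - 1) powr (H - 1/2) \<le> fbm_shape H y" if y: "1 < y" for y
    proof -
      have "(y - 1) powr (H - 1/2) / (H - 1/2)
          = (\<integral>x. indicator {1<..<y} x * (x - 1) powr (H - 3/2) \<partial>lborel)"
        using powr_shift_integral[of "H - 3/2" y] 1 y by (simp add: has_bochner_integral_iff)
      also have "\<dots> \<le> kernel_int (H - 3/2) (H - 1/2) y"
        unfolding kernel_int_def
      proof (rule integral_mono)
        show "integrable lborel (\<lambda>x. indicator {1<..<y} x * (x - 1) powr (H - 3/2))"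
          using powr_shift_integral[of "H - 3/2" y] 1 y by (simp add: has_bochner_integral_iff)
        show "integrable lborel (\<lambda>x. indicator {1<..<y} x * ((x - 1) powr (H - 3/2) * x powr (H - 1/2)))"
          using 1 y by (intro kernel_int_integrable) auto
        show "indicator {1<..<y} x * (x - 1) powr (H - 3/2) \<le> indicator {1<..<y} x
            * ((x - 1) powr (H - 3/2) * x powr (H - 1/2))" for x
          using 1 by (auto simp: indicator_def mult_le_cancel_left1 ge_one_powr_ge_zero)
      qed
      finally have "?C * ((y - 1) powr (H - 1/2) / (H - 1/2)) \<le> ?C * kernel_int (H - 3/2) (H - 1/2) y"
        using C by (intro mult_left_mono) auto
      then show ?thesis using 1 by (simp add: fbm_shape_def)
    qed
    then show ?thesis using C 1 by (intro that[of "?C / (H - 1/2)"]) auto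
  next
    case 2
    let ?C = "sqrt (2 * H / ((1 - 2 * H) * Beta (1 - 2 * H) (H + 1/2)))"
    have C: "0 < ?C" using 2 H by (auto intro!: divide_pos_pos mult_pos_pos Beta_real_pos)
    have "?C * 2 powr (H - 1/2) * (y - 1) powr (H - 1/2) \<le> fbm_shape H y" if y: "1 < y" "y \<le> 2" for y
    proof -
      have "2 powr (H - 1/2) \<le> y powr (H - 1/2)" using 2 y by (intro powr_mono2') auto
      then have "2 powr (H - 1/2) * (y - 1) powr (H - 1/2) \<le> y powr (H - 1/2) * (y - 1) powr (H - 1/2)"
        by (intro mult_right_mono) auto
      also have "\<dots> \<le> y powr (H - 1/2) * (y - 1) powr (H - 1/2) + (1/2 - H)
          * kernel_int (H - 1/2) (H - 3/2) y"
        using 2 kernel_int_nonneg by simp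
      finally have "?C * (2 powr (H - 1/2) * (y - 1) powr (H - 1/2)) \<le>
          ?C * (y powr (H - 1/2) * (y - 1) powr (H - 1/2) + (1/2 - H) * kernel_int (H - 1/2) (H - 3/2) y)"
        using C by (intro mult_left_mono) auto
      then show ?thesis using 2 by (simp add: fbm_shape_def mult.assoc)
    qed
    then show ?thesis using C by (intro that[of "?C * 2 powr (H - 1/2)"]) auto
  next
    case 3
    then have H0: "H - 1/2 = 0" by simp
    show ?thesis using 3 by (intro that[of 1]) (simp_all only: H0, auto simp: fbm_shape_def)
  qed
qed

section \<open>Variance of fractional Brownian motion, global and near the diagonal\<close>

definition fbm_integrand :: "real \<Rightarrow> real \<Rightarrow> real \<Rightarrow> real" where
  "fbm_integrand H t s = indicator {0<..<t} s * fbm_kernel H t s"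

text \<open>Needed for the directions: at a point of continuity the primitive of the integrand is
  differentiable with the right value.\<close>

lemma fbm_integrand_continuous:
  assumes H: "0 < H" "H < 1" and "0 \<le> t" and s: "s \<notin> {0, t}"
  shows "isCont (fbm_integrand H t) s"
proof (cases "s \<in> {0<..<t}")
  case True
  have "isCont (\<lambda>s. s powr (H - 1/2) * fbm_shape H (t / s)) s"
    using True by (intro continuous_intros isCont_o2[OF _ fbm_shape_continuous[OF H]]) auto
  moreover have "\<forall>\<^sub>F x in nhds s. fbm_integrand H t x = x powr (H - 1/2) * fbm_shape H (t / x)"
    using eventually_nhds_in_open[OF open_greaterThanLessThan True]
  proof eventually_elim
    case (elim x)
    then show ?case by (simp add: fbm_integrand_def fbm_kernel_shape)
  qed
  ultimately show ?thesis by (simp add: isCont_cong)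
next
  case False
  have "open (- {0..t})" by (intro open_Compl closed_atLeastAtMost)
  moreover have "s \<in> - {0..t}" using False s by auto
  ultimately have "\<forall>\<^sub>F x in nhds s. x \<in> - {0..t}" by (rule eventually_nhds_in_open)
  then have "\<forall>\<^sub>F x in nhds s. fbm_integrand H t x = 0"
    by (rule eventually_mono) (auto simp: fbm_integrand_def)
  then show ?thesis by (simp add: isCont_cong[of _ "\<lambda>_. 0"])
qed

text \<open>Self-similarity through s = t x. The variance at time 1 remains a constant that is never
  computed; boundedness on bounded time ranges is what is wanted.\<close>

lemma fbm_integrand_variance:
  assumes "0 < t"
  shows "(\<integral>s. (fbm_integrand H t s)\<^sup>2 \<partial>lborel) = t powr (2 * H) * (\<integral>s. (fbm_integrand H 1 s)\<^sup>2 \<partial>lborel)"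
proof -
  have "(\<integral>s. (fbm_integrand H t s)\<^sup>2 \<partial>lborel) = t * (\<integral>x. (fbm_integrand H t (t * x))\<^sup>2 \<partial>lborel)"
    using assms lborel_integral_real_affine[of t "\<lambda>s. (fbm_integrand H t s)\<^sup>2" 0] by simp
  also have "(\<integral>x. (fbm_integrand H t (t * x))\<^sup>2 \<partial>lborel)
      = (\<integral>x. t powr (2 * H - 1) * (fbm_integrand H 1 x)\<^sup>2 \<partial>lborel)"
  proof (intro Bochner_Integration.integral_cong refl)
    fix x
    show "(fbm_integrand H t (t * x))\<^sup>2 = t powr (2 * H - 1) * (fbm_integrand H 1 x)\<^sup>2"
    proof (cases "x \<in> {0<..<1}")
      case True
      then have "fbm_integrand H t (t * x) = t powr (H - 1/2) * fbm_integrand H 1 x"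
        using assms by (simp add: fbm_integrand_def fbm_kernel_shape powr_mult)
      moreover have "(t powr (H - 1/2))\<^sup>2 = t powr (2 * H - 1)"
        using assms by (simp add: power2_eq_square powr_add[symmetric])
      ultimately show ?thesis by (simp add: power_mult_distrib)
    next
      case False
      then have "t * x \<notin> {0<..<t}" using assms by (auto simp: zero_less_mult_iff)
      then show ?thesis using False by (simp add: fbm_integrand_def)
    qed
  qed
  also have "t * (\<integral>x. t powr (2 * H - 1) * (fbm_integrand H 1 x)\<^sup>2 \<partial>lborel) =
      t powr (2 * H) * (\<integral>s. (fbm_integrand H 1 s)\<^sup>2 \<partial>lborel)"
    using assms by (simp add: powr_diff)
  finally show ?thesis .
qed

text \<open>What matters is that c does not depend on t: the part of the noise after t alone
  produces variance of order h^(2H), however long the past. Integrability is a hypothesis because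
  the integral of a non-integrable function is 0 by convention.\<close>

lemma fbm_local_variance:
  assumes H: "0 < H" "H < 1"
  obtains c where "0 < c"
    "\<forall>t h. 0 \<le> t \<and> 0 < h \<and> integrable lborel (\<lambda>s. indicator {t<..t + h} s * (fbm_integrand H (t + h) s)\<^sup>2) \<longrightarrow>
      c * h powr (2 * H) \<le> (\<integral>s. indicator {t<..t + h} s * (fbm_integrand H (t + h) s)\<^sup>2 \<partial>lborel)"
proof -
  obtain c where c: "0 < c" "\<forall>y. 1 < y \<and> y \<le> 2 \<longrightarrow> c * (y - 1) powr (H - 1/2) \<le> fbm_shape H y"
    by (rule fbm_shape_lower[OF H])
  \<comment> \<open>The minimum covers both monotonicities of x \<mapsto> x^(H - 1/2) on
    [1/4, 1/2].\<close>
  define \<kappa> where "\<kappa> = min ((1 / 4) powr (H - 1/2)) ((1 / 2) powr (H - 1/2) :: real)"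
  have \<kappa>: "0 < \<kappa>" by (simp add: \<kappa>_def)
  show ?thesis
  proof (rule that[of "(c * \<kappa>)\<^sup>2 / 4"], use c \<kappa> in simp, intro allI impI, elim conjE)
    fix t h :: real
    assume t: "0 \<le> t" and h: "0 < h"
      and I: "integrable lborel (\<lambda>s. indicator {t<..t + h} s * (fbm_integrand H (t + h) s)\<^sup>2)"
    \<comment> \<open>On this window the distance to t + h lies between h / 4 and h / 2, safe for
      either sign of H - 1/2, and (t + h) / s stays below 2. Its length h / 4 is the source of the
      divisor 4.\<close>
    let ?S = "{t + h / 2<..<t + 3 * h / 4}"
    let ?K = "(c * (\<kappa> * h powr (H - 1/2)))\<^sup>2"
    have low: "indicator ?S s * ?K \<le> indicator {t<..t + h} s * (fbm_integrand H (t + h) s)\<^sup>2" for s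
    proof (cases "s \<in> ?S")
      case True
      then have s: "t + h / 2 < s" "s < t + 3 * h / 4" by auto
      then have s0: "0 < s" "s < t + h" using t h by auto
      define x where "x = (t + h - s) / h"
      have x: "1 / 4 \<le> x" "x \<le> 1 / 2" "t + h - s = x * h" using s h by (auto simp: x_def field_simps)
      have "\<kappa> \<le> x powr (H - 1/2)"
      proof (cases "H \<ge> 1/2")
        case True
        then have "(1 / 4) powr (H - 1/2) \<le> x powr (H - 1/2)" using x by (intro powr_mono2) auto
        then show ?thesis by (simp add: \<kappa>_def)
      next
        case False
        then have "(1 / 2) powr (H - 1/2) \<le> x powr (H - 1/2)" using x by (intro powr_mono2') auto
        then show ?thesis by (simp add: \<kappa>_def)
      qed
      then have "\<kappa> * h powr (H - 1/2) \<le> (t + h - s) powr (H - 1/2)"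
        using x h by (simp add: powr_mult mult_right_mono)
      also have "\<dots> = s powr (H - 1/2) * ((t + h) / s - 1) powr (H - 1/2)"
      proof -
        have "t + h - s = s * ((t + h) / s - 1)" using s0 by (simp add: field_simps)
        then show ?thesis by (simp add: powr_mult)
      qed
      finally have "c * (\<kappa> * h powr (H - 1/2)) \<le> s powr (H - 1/2) * (c * ((t + h) / s - 1) powr (H - 1/2))"
        using c(1) by (simp add: mult.left_commute)
      also have "\<dots> \<le> s powr (H - 1/2) * fbm_shape H ((t + h) / s)"
        using s s0 t h by (intro mult_left_mono c(2)[rule_format]) (auto simp: field_simps)
      also have "\<dots> = fbm_integrand H (t + h) s"
        using s0 by (simp add: fbm_integrand_def fbm_kernel_shape)
      finally have "?K \<le> (fbm_integrand H (t + h) s)\<^sup>2" using c(1) \<kappa> by (intro power_mono) auto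
      moreover have "s \<in> {t<..t + h}" using s s0 h by auto
      ultimately show ?thesis using True by simp
    qed (auto simp: indicator_def)
    have "(c * \<kappa>)\<^sup>2 / 4 * h powr (2 * H) = (h / 4) * ?K"
    proof -
      have "h powr (2 * H) = h * (h powr (H - 1/2))\<^sup>2"
        using h by (simp add: power2_eq_square powr_add[symmetric] powr_diff)
      then show ?thesis by (simp add: power_mult_distrib)
    qed
    also have "\<dots> = (\<integral>s. indicator ?S s * ?K \<partial>lborel)" using h by simp
    also have "\<dots> \<le> (\<integral>s. indicator {t<..t + h} s * (fbm_integrand H (t + h) s)\<^sup>2 \<partial>lborel)"
      using low I h by (intro integral_mono)
        (auto intro!: integrable_mult_left simp: integrable_indicator_iff)
    finally show "(c * \<kappa>)\<^sup>2 / 4 * h powr (2 * H)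
        \<le> (\<integral>s. indicator {t<..t + h} s * (fbm_integrand H (t + h) s)\<^sup>2 \<partial>lborel)" .
  qed
qed

section \<open>Primitives as Cameron--Martin paths\<close>

text \<open>The pointwise bound x \<le> K + x^2 / K for x \<ge> 0 stands in for Cauchy-Schwarz. It
  is additive over disjoint intervals, which is the shape absolute continuity asks for: K large
  controls the energy, then short total length controls the rest.\<close>

lemma L2_primitive_bound:
  fixes g :: "real \<Rightarrow> real"
  assumes g: "g \<in> borel_measurable borel" "integrable lborel g" "integrable lborel (\<lambda>s. (g s)\<^sup>2)"
    and K: "0 < K" and ab: "a \<le> b"
  shows "\<bar>(\<integral>s. indicator {a<..b} s * g s \<partial>lborel)\<bar> \<le>
    K * (b - a) + (\<integral>s. indicator {a<..<b} s * (g s)\<^sup>2 \<partial>lborel) / K"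
proof -
  have [measurable]: "g \<in> borel_measurable borel" by fact
  have eq: "(\<integral>s. indicator {a<..b} s * g s \<partial>lborel) = (\<integral>s. indicator {a<..<b} s * g s \<partial>lborel)"
  proof (intro integral_cong_AE)
    show "AE s in lborel. indicator {a<..b} s * g s = indicator {a<..<b} s * g s"
      using AE_lborel_singleton[of b] by eventually_elim (auto simp: indicator_def)
  qed auto
  have le: "\<bar>x\<bar> \<le> K + x\<^sup>2 / K" for x :: real
  proof (cases "\<bar>x\<bar> \<le> K")
    case False
    then have "K * \<bar>x\<bar> \<le> \<bar>x\<bar> * \<bar>x\<bar>" by (intro mult_right_mono) auto
    then have "\<bar>x\<bar> \<le> x\<^sup>2 / K" using K by (simp add: pos_le_divide_eq power2_eq_square mult.commute)
    then show ?thesis using K by simp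
  qed (use K in \<open>simp add: add_increasing2\<close>)
  have I: "integrable lborel (\<lambda>s. indicator {a<..<b} s * f s)" if "integrable lborel f"
      for f :: "real \<Rightarrow> real"
    using integrable_real_mult_indicator[OF _ that, of "{a<..<b}"] by (simp add: mult.commute)
  have I1: "integrable lborel (indicator {a<..<b} :: real \<Rightarrow> real)"
    using ab by (simp add: integrable_indicator_iff)
  have "\<bar>\<integral>s. indicator {a<..<b} s * g s \<partial>lborel\<bar> \<le> (\<integral>s. \<bar>indicator {a<..<b} s * g s\<bar> \<partial>lborel)"
    using integral_norm_bound[of lborel "\<lambda>s. indicator {a<..<b} s * g s"] by simp
  also have "\<dots> \<le> (\<integral>s. K * indicator {a<..<b} s + (indicator {a<..<b} s * (g s)\<^sup>2) / K \<partial>lborel)"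
  proof (rule integral_mono)
    show "integrable lborel (\<lambda>s. \<bar>indicator {a<..<b} s * g s\<bar>)" by (rule integrable_abs[OF I[OF g(2)]])
    show "integrable lborel (\<lambda>s. K * indicator {a<..<b} s + (indicator {a<..<b} s * (g s)\<^sup>2) / K)"
      using I[OF g(3)] I1 by simp
  qed (use le in \<open>auto simp: indicator_def\<close>)
  also have "\<dots> = K * (b - a) + (\<integral>s. indicator {a<..<b} s * (g s)\<^sup>2 \<partial>lborel) / K"
    using I[OF g(3)] I1 ab by simp
  finally show ?thesis unfolding eq .
qed

text \<open>Bounded support makes the square-integrable g integrable, and support to the right of 0
  makes the primitive vanish on the negative half-line, as the type \<open>path\<close> requires.
  Continuity of g off Z replaces Lebesgue differentiation.\<close>

lemma cameron_martin_primitive: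
  fixes g :: "real \<Rightarrow> real"
  assumes g: "g \<in> borel_measurable borel" "integrable lborel (\<lambda>s. (g s)\<^sup>2)"
    and supp: "\<And>s. s \<notin> {0<..<T} \<Longrightarrow> g s = 0" and T: "0 < T"
    and Z: "finite Z" "\<And>s. s \<notin> Z \<Longrightarrow> isCont g s"
  obtains h where "h \<in> cameron_martin" "\<forall>s. s \<notin> Z \<longrightarrow> deriv (coord h) s = g s"
proof -
  have [measurable]: "g \<in> borel_measurable borel" by fact
  have gi: "integrable lborel g"
  proof (rule Bochner_Integration.integrable_bound)
    show "integrable lborel (\<lambda>s. indicator {0<..<T} s + (g s)\<^sup>2)"
      using g T by (intro Bochner_Integration.integrable_add) (auto simp: integrable_indicator_iff)
    have "\<bar>x\<bar> \<le> 1 + x\<^sup>2" for x :: real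
      using zero_le_power2[of "\<bar>x\<bar> - 1"] abs_ge_zero[of x] by (simp add: power2_diff)
    then show "AE s in lborel. norm (g s) \<le> norm (indicator {0<..<T} s + (g s)\<^sup>2)"
      using supp by (intro AE_I2) (auto simp: indicator_def)
  qed auto
  define \<phi> where "\<phi> s = (\<integral>u. indicator {..s} u * g u \<partial>lborel)" for s
  have Ig: "integrable lborel (\<lambda>s. indicator A s * g s)" if "A \<in> sets borel" for A
    using integrable_real_mult_indicator[OF _ gi, of A] that by (simp add: mult.commute)
  have incr: "\<phi> b - \<phi> a = (\<integral>u. indicator {a<..b} u * g u \<partial>lborel)" if "a \<le> b" for a b
  proof -
    have "\<phi> b - \<phi> a = (\<integral>u. indicator {..b} u * g u - indicator {..a} u * g u \<partial>lborel)"
      unfolding \<phi>_def using Ig by (intro Bochner_Integration.integral_diff[symmetric]) auto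
    also have "\<dots> = (\<integral>u. indicator {a<..b} u * g u \<partial>lborel)"
      using that by (intro Bochner_Integration.integral_cong) (auto simp: indicator_def)
    finally show ?thesis .
  qed
  have zero: "\<phi> s = 0" if "s \<le> 0" for s
  proof -
    have "(\<lambda>u. indicator {..s} u * g u) = (\<lambda>_. 0)" using supp that by (auto simp: indicator_def fun_eq_iff)
    then show ?thesis by (simp add: \<phi>_def)
  qed
  define V where "V = (\<integral>s. (g s)\<^sup>2 \<partial>lborel)"
  have V: "0 \<le> V" by (simp add: V_def)
  have small: "\<exists>d>0. \<forall>n. \<forall>a b :: nat \<Rightarrow> real. (\<forall>i<n. a i \<le> b i) \<longrightarrow> disjoint_family_on (\<lambda>i. {a i<..<b i})
      {..<n} \<longrightarrow>
      (\<Sum>i<n. b i - a i) < d \<longrightarrow> (\<Sum>i<n. \<bar>\<phi> (b i) - \<phi> (a i)\<bar>) < e" if e: "0 < e" for e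
  proof -
    \<comment> \<open>Makes V / K < e / 2, with V + 1 keeping K positive when g vanishes; the length
      e / (2 K) accounts for the other half.\<close>
    define K where "K = 2 * (V + 1) / e"
    have K: "0 < K" using V e by (simp add: K_def)
    have VK: "V / K < e / 2" using V e by (simp add: K_def field_simps)
    show ?thesis
    proof (intro exI[of _ "e / (2 * K)"] conjI allI impI)
      show "0 < e / (2 * K)" using e K by simp
      fix n and a b :: "nat \<Rightarrow> real"
      assume ab: "\<forall>i<n. a i \<le> b i" and disj: "disjoint_family_on (\<lambda>i. {a i<..<b i}) {..<n}"
        and sm: "(\<Sum>i<n. b i - a i) < e / (2 * K)"
      have Isq: "integrable lborel (\<lambda>s. indicator {a i<..<b i} s * (g s)\<^sup>2)" for i
        using integrable_real_mult_indicator[OF _ g(2), of "{a i<..<b i}"] by (simp add: mult.commute)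
      have "(\<Sum>i<n. \<bar>\<phi> (b i) - \<phi> (a i)\<bar>)
          \<le> (\<Sum>i<n. K * (b i - a i) + (\<integral>s. indicator {a i<..<b i} s * (g s)\<^sup>2 \<partial>lborel) / K)"
        using ab L2_primitive_bound[OF g(1) gi g(2) K] by (intro sum_mono) (simp add: incr)
      also have "\<dots> = K * (\<Sum>i<n. b i - a i) + (\<Sum>i<n. \<integral>s. indicator {a i<..<b i} s * (g s)\<^sup>2 \<partial>lborel) / K"
        by (simp add: sum.distrib sum_distrib_left sum_divide_distrib)
      also have "(\<Sum>i<n. \<integral>s. indicator {a i<..<b i} s * (g s)\<^sup>2 \<partial>lborel) \<le> V"
      proof -
        have "(\<Sum>i<n. \<integral>s. indicator {a i<..<b i} s * (g s)\<^sup>2 \<partial>lborel) =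
            (\<integral>s. (\<Sum>i<n. indicator {a i<..<b i} s * (g s)\<^sup>2) \<partial>lborel)"
          using Isq by (intro Bochner_Integration.integral_sum[symmetric]) auto
        also have "\<dots> \<le> V" unfolding V_def
        proof (rule integral_mono)
          show "integrable lborel (\<lambda>s. \<Sum>i<n. indicator {a i<..<b i} s * (g s)\<^sup>2)"
            by (rule Bochner_Integration.integrable_sum) (rule Isq)
          fix s
          have "(\<Sum>i<n. indicator {a i<..<b i} s * (g s)\<^sup>2) = indicator (\<Union>i<n. {a i<..<b i}) s * (g s)\<^sup>2"
            unfolding sum_distrib_right[symmetric] by (subst indicator_UN_disjoint[OF _ disj]) auto
          also have "\<dots> \<le> (g s)\<^sup>2" by (auto simp: indicator_def)
          finally show "(\<Sum>i<n. indicator {a i<..<b i} s * (g s)\<^sup>2) \<le> (g s)\<^sup>2" .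
        qed (rule g(2))
        finally show ?thesis .
      qed
      finally have "(\<Sum>i<n. \<bar>\<phi> (b i) - \<phi> (a i)\<bar>) \<le> K * (\<Sum>i<n. b i - a i) + V / K"
        using K by (simp add: divide_right_mono)
      moreover have "K * (\<Sum>i<n. b i - a i) < e / 2" using sm K
          by (simp add: pos_less_divide_eq mult.commute mult.left_commute)
      ultimately show "(\<Sum>i<n. \<bar>\<phi> (b i) - \<phi> (a i)\<bar>) < e" using VK by linarith
    qed
  qed
  have cont: "continuous_on UNIV \<phi>"
    unfolding continuous_on_iff
  proof (intro ballI allI impI)
    fix x e :: real assume "0 < e"
    from small[OF this] obtain d where d:
        "d > 0 \<and> (\<forall>n. \<forall>a b :: nat \<Rightarrow> real. (\<forall>i<n. a i \<le> b i) \<longrightarrow> disjoint_family_on (\<lambda>i. {a i<..<b i}) {..<n} \<longrightarrow>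
      (\<Sum>i<n. b i - a i) < d \<longrightarrow> (\<Sum>i<n. \<bar>\<phi> (b i) - \<phi> (a i)\<bar>) < e)" by (rule exE)
    have one: "\<bar>\<phi> b - \<phi> a\<bar> < e" if "a \<le> b" "b - a < d" for a b
    proof -
      have "(\<Sum>i<Suc 0. \<bar>\<phi> b - \<phi> a\<bar>) < e"
        by (rule d[THEN conjunct2, rule_format]) (use that in \<open>auto simp: disjoint_family_on_def\<close>)
      then show ?thesis by simp
    qed
    have "dist (\<phi> y) (\<phi> x) < e" if "dist y x < d" for y
      using one[of x y] one[of y x] that by (cases "x \<le> y") (auto simp: dist_real_def abs_minus_commute)
    then show "\<exists>d>0. \<forall>y\<in>UNIV. dist y x < d \<longrightarrow> dist (\<phi> y) (\<phi> x) < e"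
      using d[THEN conjunct1] by (intro exI[of _ d]) simp
  qed
  define h where "h = Abs_path \<phi>"
  have h: "coord h = \<phi>" unfolding h_def by (rule Abs_path_inverse) (use cont zero in auto)
  have der: "(\<phi> has_real_derivative g s) (at s)" if s: "s \<notin> Z" for s
  proof -
    have si: "set_integrable lborel A g" if "A \<in> sets borel" for A
      using Ig[OF that] by (simp add: set_integrable_def)
    \<comment> \<open>The fundamental theorem is applied from the base point s - 1; near s this
      integral differs from \<phi> by a constant.\<close>
    have "((\<lambda>u. integral {s - 1..u} g) has_vector_derivative g s) (at s within ({s - 1..s + 1} - {}))"
      using Z(2)[OF s] set_borel_integral_eq_integral(1)[OF si[of "{s - 1..s + 1}"]]
      by (intro integral_has_vector_derivative_continuous_at)
        (auto intro: continuous_at_imp_continuous_at_within)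
    then have "((\<lambda>u. integral {s - 1..u} g) has_real_derivative g s) (at s within {s - 1..s + 1})"
      by (simp add: has_real_derivative_iff_has_vector_derivative)
    then have "((\<lambda>u. integral {s - 1..u} g + \<phi> (s - 1)) has_real_derivative g s) (at s)"
      by (subst (asm) at_within_interior) (auto intro!: derivative_eq_intros)
    then show ?thesis
    proof (rule DERIV_cong_ev[THEN iffD1, rotated 3, OF _ refl _ refl])
      have "integral {s - 1..u} g + \<phi> (s - 1) = \<phi> u" if "u \<in> {s - 1<..}" for u
      proof -
        have "integral {s - 1..u} g = (\<integral>x. indicator {s - 1..u} x * g x \<partial>lborel)"
          using set_borel_integral_eq_integral(2)[OF si[of "{s - 1..u}"]]
            by (simp add: set_lebesgue_integral_def)
        also have "\<dots> = (\<integral>x. indicator {s - 1<..u} x * g x \<partial>lborel)"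
        proof (intro integral_cong_AE)
          show "AE x in lborel. indicator {s - 1..u} x * g x = indicator {s - 1<..u} x * g x"
            using AE_lborel_singleton[of "s - 1"] by eventually_elim (auto simp: indicator_def)
        qed auto
        also have "\<dots> = \<phi> u - \<phi> (s - 1)" using that by (intro incr[symmetric]) auto
        finally show ?thesis by simp
      qed
      then show "\<forall>\<^sub>F u in nhds s. integral {s - 1..u} g + \<phi> (s - 1) = \<phi> u"
        using eventually_nhds_in_open[of "{s - 1<..}" s] by (auto elim: eventually_mono)
    qed
  qed
  have deriv: "deriv (coord h) s = g s" if "s \<notin> Z" for s
    unfolding h using der[OF that] by (rule DERIV_imp_deriv)
  have "abs_cont_on {0..S} (coord h)" for S
    unfolding abs_cont_on_def h using small by meson
  moreover have "set_integrable lborel {0..} (\<lambda>t. (deriv (coord h) t)\<^sup>2)"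
    unfolding set_integrable_def
  proof (rule integrable_discrete_difference[where X=Z, THEN iffD1])
    show "integrable lborel (\<lambda>t. indicator {0..} t *\<^sub>R (g t)\<^sup>2)"
      using integrable_mult_indicator[OF _ g(2), of "{0..}"] by simp
  qed (use Z deriv in \<open>auto simp: countable_finite\<close>)
  ultimately have "h \<in> cameron_martin" by (simp add: cameron_martin_def)
  then show ?thesis by (rule that) (simp add: deriv)
qed

lemma borel_measurable_finite_difference:
  fixes f g :: "real \<Rightarrow> real"
  assumes "g \<in> borel_measurable borel" "finite Z" "\<And>s. s \<notin> Z \<Longrightarrow> f s = g s"
  shows "f \<in> borel_measurable borel"
  by (rule measurable_discrete_difference[OF assms(1), of Z]) (use assms in \<open>auto simp: countable_finite\<close>)

text \<open>A smooth functional accepts X only as the integral of the derivative of a direction h.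
  The primitive of g qualifies: its derivative agrees with g off Z, so the same random variable X
  serves and the Gram entry is the energy of g.\<close>

lemma wiener_integral_direction:
  fixes g :: "real \<Rightarrow> real"
  assumes W: "wiener_integral P g X"
    and supp: "\<And>s. s \<notin> {0<..<T} \<Longrightarrow> g s = 0" and T: "0 < T"
    and Z: "finite Z" "\<And>s. s \<notin> Z \<Longrightarrow> isCont g s"
  obtains h where "h \<in> cameron_martin" "wiener_integral P (deriv (coord h)) X"
    "cm_inner h h = (\<integral>s. (g s)\<^sup>2 \<partial>lborel)"
proof -
  have hg: "half g = g" using supp by (auto simp: half_def indicator_def fun_eq_iff)
  have g: "g \<in> borel_measurable borel" "integrable lborel (\<lambda>s. (g s)\<^sup>2)"
    using W unfolding wiener_integral_iff hg by auto
  obtain h where h: "h \<in> cameron_martin" "\<forall>s. s \<notin> Z \<longrightarrow> deriv (coord h) s = g s"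
    by (rule cameron_martin_primitive[OF g supp T Z])
  have heq: "half (deriv (coord h)) s = half g s" if "s \<notin> Z" for s using h(2) that by (simp add: half_def)
  have ae: "AE s in lborel. half g s = half (deriv (coord h)) s"
  proof -
    have "AE s in lborel. s \<notin> Z" using finite_imp_null_set_lborel[OF Z(1)] by (rule AE_not_in)
    then show ?thesis by eventually_elim (simp add: heq)
  qed
  have m: "half (deriv (coord h)) \<in> borel_measurable borel"
    by (rule borel_measurable_finite_difference[OF g(1) Z(1)]) (simp add: heq hg)
  have [measurable]: "half (deriv (coord h)) \<in> borel_measurable borel" "g \<in> borel_measurable borel"
      by (fact m, fact g)
  have "wiener_integral P (deriv (coord h)) X" by (rule wiener_integral_cong[OF W ae m])
  moreover have "cm_inner h h = (\<integral>s. (g s)\<^sup>2 \<partial>lborel)"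
  proof -
    have "cm_inner h h = (\<integral>s. half (deriv (coord h)) s * half (deriv (coord h)) s \<partial>lborel)"
      unfolding cm_inner_eq by (simp add: cm_density_def half_def)
    also have "\<dots> = (\<integral>s. (g s)\<^sup>2 \<partial>lborel)"
    proof (intro integral_cong_AE)
      show "AE s in lborel. half (deriv (coord h)) s * half (deriv (coord h)) s = (g s)\<^sup>2"
        using ae by eventually_elim (simp add: hg power2_eq_square)
    qed measurable
    finally show ?thesis .
  qed
  ultimately show ?thesis using h(1) that by blast
qed

section \<open>Smooth functionals concentrated on small increments\<close>

text \<open>Up to the factor (-1)^a exp 1 these are the Hermite polynomials, since differentiating p
  exp(-x^2) replaces p by p' - 2 x p. The constant exp 1 makes \<open>bump 0\<close> at least 1 on
  [-1, 1].\<close>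

primrec bump_poly :: "nat \<Rightarrow> real poly" where
  "bump_poly 0 = [:exp 1:]"
| "bump_poly (Suc a) = pderiv (bump_poly a) - [:0, 2:] * bump_poly a"

definition bump :: "nat \<Rightarrow> real \<Rightarrow> real" where
  "bump a x = poly (bump_poly a) x * exp (- x\<^sup>2)"

lemma bump_deriv: "(bump a has_real_derivative bump (Suc a) x) (at x)"
  unfolding bump_def[abs_def]
  by (auto intro!: derivative_eq_intros poly_DERIV simp: algebra_simps)

lemma bump_continuous: "continuous_on UNIV (bump a)"
  using bump_deriv DERIV_isCont continuous_at_imp_continuous_on by blast

text \<open>The exponent e has to be free in the induction: a factor x consumes one half of it and
  the shorter polynomial the other half.\<close>

lemma poly_exp_bound:
  fixes p :: "real poly"
  assumes "0 < e"
  shows "\<exists>C. \<forall>x. \<bar>poly p x\<bar> \<le> C * exp (e * x\<^sup>2)"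
  using assms
proof (induction p arbitrary: e)
  case 0
  show ?case by (intro exI[of _ 0]) simp
next
  case (pCons a p)
  obtain C where C: "\<forall>x. \<bar>poly p x\<bar> \<le> C * exp (e / 2 * x\<^sup>2)" using pCons.IH[of "e / 2"] pCons.prems by auto
  have C0: "0 \<le> C" using C[rule_format, of 0] by (simp add: order_trans[OF abs_ge_zero])
  have "\<bar>poly (pCons a p) x\<bar> \<le> (\<bar>a\<bar> + (1 + 2 / e) * C) * exp (e * x\<^sup>2)" for x
  proof -
    have e1: "1 \<le> exp (e * x\<^sup>2)" "1 \<le> exp (e / 2 * x\<^sup>2)" using pCons.prems by auto
    have "e / 2 * x\<^sup>2 \<le> exp (e / 2 * x\<^sup>2)" using exp_ge_add_one_self[of "e / 2 * x\<^sup>2"] by linarith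
    then have "x\<^sup>2 \<le> 2 / e * exp (e / 2 * x\<^sup>2)" using pCons.prems by (simp add: field_simps)
    moreover have "\<bar>x\<bar> \<le> 1 + x\<^sup>2"
      using zero_le_power2[of "\<bar>x\<bar> - 1"] abs_ge_zero[of x] by (simp add: power2_diff)
    ultimately have "\<bar>x\<bar> \<le> (1 + 2 / e) * exp (e / 2 * x\<^sup>2)" using e1(2) unfolding distrib_right by linarith
    then have "\<bar>x\<bar> * \<bar>poly p x\<bar> \<le> ((1 + 2 / e) * exp (e / 2 * x\<^sup>2)) * (C * exp (e / 2 * x\<^sup>2))"
      using C pCons.prems by (intro mult_mono) auto
    also have "\<dots> = (1 + 2 / e) * C * exp (e * x\<^sup>2)" by (simp add: mult_exp_exp ac_simps)
    finally have 1: "\<bar>x * poly p x\<bar> \<le> (1 + 2 / e) * C * exp (e * x\<^sup>2)" by (simp add: abs_mult)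
    have "\<bar>a\<bar> \<le> \<bar>a\<bar> * exp (e * x\<^sup>2)" using e1(1) by (simp add: mult_le_cancel_left1)
    then show ?thesis using 1 abs_triangle_ineq[of a "x * poly p x"] by (simp add: distrib_right)
  qed
  then show ?case by blast
qed

text \<open>Half of the Gaussian decay pays for the polynomial; the half that is left is the kernel
  of the small-ball estimate.\<close>

lemma bump_bound: "\<exists>C. \<forall>x. \<bar>bump a x\<bar> \<le> C * exp (- x\<^sup>2 / 2)"
proof -
  obtain C where C: "\<forall>x. \<bar>poly (bump_poly a) x\<bar> \<le> C * exp (1 / 2 * x\<^sup>2)"
    using poly_exp_bound[of "1 / 2" "bump_poly a"] by auto
  have "\<bar>bump a x\<bar> \<le> C * exp (- x\<^sup>2 / 2)" for x
  proof -
    have "\<bar>bump a x\<bar> \<le> (C * exp (1 / 2 * x\<^sup>2)) * exp (- x\<^sup>2)"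
      unfolding bump_def abs_mult using C by (simp add: mult_right_mono)
    also have "\<dots> = C * exp (- x\<^sup>2 / 2)" by (simp add: mult_exp_exp)
    finally show ?thesis .
  qed
  then show ?thesis by blast
qed

lemma bump_bound_uniform:
  obtains C where "1 \<le> C" "\<forall>a\<le>k. \<forall>x. \<bar>bump a x\<bar> \<le> C * exp (- x\<^sup>2 / 2)"
proof -
  obtain c where c: "\<And>a x. \<bar>bump a x\<bar> \<le> c a * exp (- x\<^sup>2 / 2)" using bump_bound by metis
  define C where "C = 1 + (\<Sum>a\<le>k. \<bar>c a\<bar>)"
  have "\<bar>bump a x\<bar> \<le> C * exp (- x\<^sup>2 / 2)" if "a \<le> k" for a x
  proof -
    have "c a \<le> \<bar>c a\<bar>" by simp
    also have "\<bar>c a\<bar> \<le> (\<Sum>a\<le>k. \<bar>c a\<bar>)" using that by (intro member_le_sum) auto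
    finally have "c a * exp (- x\<^sup>2 / 2) \<le> C * exp (- x\<^sup>2 / 2)" by (intro mult_right_mono) (auto simp: C_def)
    then show ?thesis using c[of a x] by linarith
  qed
  moreover have "1 \<le> C" by (simp add: C_def sum_nonneg)
  ultimately show ?thesis using that by blast
qed

text \<open>The multi-index a counts derivatives per coordinate: this is the a-th partial derivative
  of the product of the x \<mapsto> \<open>bump 0 (l * x j)\<close>, chain-rule powers of l
  included, so the family is closed under differentiation.\<close>

definition bump_prod :: "nat \<Rightarrow> real \<Rightarrow> (nat \<Rightarrow> nat) \<Rightarrow> (nat \<Rightarrow> real) \<Rightarrow> real" where
  "bump_prod J l a x = (\<Prod>j<J. l ^ a j * bump (a j) (l * x j))"

lemma bump_prod_deriv:
  assumes "i < J"
  shows "((\<lambda>t. bump_prod J l a (x(i := t))) has_real_derivative bump_prod J l (a(i := Suc (a i)))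
      (x(i := t))) (at t)"
proof -
  let ?c = "\<Prod>j\<in>{..<J} - {i}. l ^ a j * bump (a j) (l * x j)"
  have split: "(\<Prod>j<J. f j) = f i * (\<Prod>j\<in>{..<J} - {i}. f j)" for f :: "nat \<Rightarrow> real"
    using assms by (intro prod.remove) auto
  have 1: "bump_prod J l a (x(i := t)) = l ^ a i * bump (a i) (l * t) * ?c" for t
    unfolding bump_prod_def split by (auto intro!: arg_cong2[where f="(*)"] prod.cong)
  have 2: "bump_prod J l (a(i := Suc (a i))) (x(i := t)) = l ^ Suc (a i) * bump (Suc (a i)) (l * t) * ?c"
    unfolding bump_prod_def split by (auto intro!: arg_cong2[where f="(*)"] prod.cong)
  have "((\<lambda>t. bump (a i) (l * t)) has_real_derivative bump (Suc (a i)) (l * t) * l) (at t)"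
    by (rule DERIV_chain2[OF bump_deriv]) (auto intro!: derivative_eq_intros)
  then show ?thesis unfolding 1 2 by (auto intro!: derivative_eq_intros)
qed

lemma iter_partial_bump_prod:
  assumes "set is \<subseteq> {..<J}"
  shows "iter_partial is (bump_prod J l (\<lambda>_. 0)) = bump_prod J l (count_list is)"
  using assms
proof (induction "is")
  case (Cons i "is")
  have "count_list (i # is) = (count_list is)(i := Suc (count_list is i))" by (auto simp: fun_eq_iff)
  moreover have "partial i (bump_prod J l (count_list is))
      = bump_prod J l ((count_list is)(i := Suc (count_list is i)))"
  proof
    fix x
    show "partial i (bump_prod J l (count_list is)) x
        = bump_prod J l ((count_list is)(i := Suc (count_list is i))) x"
      unfolding partial_def using DERIV_imp_deriv[OF bump_prod_deriv[of i J l "count_list is" x "x i"]]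
        Cons.prems by simp
  qed
  moreover have "iter_partial is (bump_prod J l (\<lambda>_. 0)) = bump_prod J l (count_list is)"
    using Cons by simp
  ultimately show ?case by (simp only: iter_partial_Cons)
qed (simp add: iter_partial_Nil bump_prod_def fun_eq_iff)

lemma count_list_sum: "set is \<subseteq> {..<J::nat} \<Longrightarrow> (\<Sum>j<J. count_list is j) = length is"
  using sum_count_set[of "is" "{..<J}"] by simp

text \<open>Only the number of derivatives matters, not the coordinates on which they fall: the
  exponents of l add up to the length of the list.\<close>

lemma bump_prod_bound:
  assumes C: "1 \<le> C" "\<forall>a\<le>k. \<forall>x. \<bar>bump a x\<bar> \<le> C * exp (- x\<^sup>2 / 2)" and "0 \<le> l"
    and "is": "set is \<subseteq> {..<J}" "length is \<le> k"
  shows "\<bar>bump_prod J l (count_list is) x\<bar> \<le> l ^ length is * C ^ J * (\<Prod>j<J. exp (- (l * x j)\<^sup>2 / 2))"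
proof -
  have ck: "count_list is j \<le> k" for j using count_le_length[of "is" j] "is"(2) by simp
  have "\<bar>bump_prod J l (count_list is) x\<bar>
      = (\<Prod>j<J. l ^ count_list is j * \<bar>bump (count_list is j) (l * x j)\<bar>)"
    unfolding bump_prod_def abs_prod using \<open>0 \<le> l\<close> by (simp add: abs_mult)
  also have "\<dots> \<le> (\<Prod>j<J. l ^ count_list is j * (C * exp (- (l * x j)\<^sup>2 / 2)))"
    using C(2) ck \<open>0 \<le> l\<close> by (intro prod_mono conjI mult_left_mono) auto
  also have "\<dots> = l ^ length is * C ^ J * (\<Prod>j<J. exp (- (l * x j)\<^sup>2 / 2))"
    unfolding count_list_sum[OF "is"(1), symmetric] by (simp add: prod.distrib power_sum)
  finally show ?thesis .
qed

lemma bump_prod_continuous: "continuous_on UNIV (bump_prod J l a)"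
  unfolding bump_prod_def[abs_def]
  by (intro continuous_intros continuous_on_compose2[OF bump_continuous]) auto

lemma bump_prod_smooth:
  assumes "0 \<le> l"
  shows "smooth_poly_growth J (bump_prod J l (\<lambda>_. 0))"
proof (rule smooth_poly_growthI)
  fix "is" :: "nat list" assume "is": "set is \<subseteq> {..<J}"
  show "continuous_on UNIV (iter_partial is (bump_prod J l (\<lambda>_. 0)))"
    unfolding iter_partial_bump_prod[OF "is"] by (rule bump_prod_continuous)
  show "(\<lambda>t. iter_partial is (bump_prod J l (\<lambda>_. 0)) (x(i := t))) differentiable (at (x i))" if "i < J"
      for i x
    unfolding iter_partial_bump_prod[OF "is"]
    using bump_prod_deriv[OF that] real_differentiable_def by blast
  obtain C where C: "1 \<le> C" "\<forall>a\<le>length is. \<forall>x. \<bar>bump a x\<bar> \<le> C * exp (- x\<^sup>2 / 2)"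
      by (rule bump_bound_uniform)
  have "\<bar>iter_partial is (bump_prod J l (\<lambda>_. 0)) x\<bar> \<le> (l ^ length is * C ^ J) * (1 + (\<Sum>i<J. \<bar>x i\<bar>)) ^ 0"
      for x
  proof -
    have "\<bar>bump_prod J l (count_list is) x\<bar> \<le> l ^ length is * C ^ J * (\<Prod>j<J. exp (- (l * x j)\<^sup>2 / 2))"
      by (rule bump_prod_bound[OF C assms "is"]) simp
    also have "\<dots> \<le> l ^ length is * C ^ J * 1"
      using C(1) assms by (intro mult_left_mono prod_le_1) auto
    finally show ?thesis unfolding iter_partial_bump_prod[OF "is"] by simp
  qed
  then show "\<exists>C N. \<forall>x. \<bar>iter_partial is (bump_prod J l (\<lambda>_. 0)) x\<bar> \<le> C * (1 + (\<Sum>i<J. \<bar>x i\<bar>)) ^ N" by blast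
qed (simp add: bump_prod_def)

lemma bump_ge_1: "\<bar>x\<bar> \<le> 1 \<Longrightarrow> 1 \<le> bump 0 x"
proof -
  assume "\<bar>x\<bar> \<le> 1"
  then have "x\<^sup>2 \<le> 1" by (simp add: abs_square_le_1)
  then show ?thesis by (simp add: bump_def mult_exp_exp)
qed

lemma bump_prod_ge_1:
  assumes "0 < l" "\<forall>j<J. \<bar>x j\<bar> \<le> 1 / l"
  shows "1 \<le> bump_prod J l (\<lambda>_. 0) x"
  unfolding bump_prod_def
proof (rule prod_ge_1)
  fix j assume "j \<in> {..<J}"
  then have "\<bar>l * x j\<bar> \<le> 1" using assms by (auto simp: abs_mult field_simps)
  then show "1 \<le> l ^ 0 * bump 0 (l * x j)" using bump_ge_1 by simp
qed

lemma bump_prod_nonneg: "0 \<le> bump_prod J l (\<lambda>_. 0) x"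
  unfolding bump_prod_def by (intro prod_nonneg) (simp add: bump_def)

definition bump_data :: "nat \<Rightarrow> real \<Rightarrow> (nat \<Rightarrow> path) \<Rightarrow> (nat \<Rightarrow> path \<Rightarrow> real) \<Rightarrow> smooth_data" where
  "bump_data J l h X = \<lparr>arity = J, outer = bump_prod J l (\<lambda>_. 0), dir = h, gauss = X\<rparr>"

text \<open>
  A chain of Wiener integrals \<open>X\<^sub>j\<close> of \<open>g\<^sub>j\<close> in which each new integrand carries mass at least \<open>v\<close>
  on an interval that none of the preceding ones sees.
\<close>

definition nondegenerate_chain ::
    "path measure \<Rightarrow> nat \<Rightarrow> real \<Rightarrow> real \<Rightarrow> (nat \<Rightarrow> real) \<Rightarrow> (nat \<Rightarrow> real \<Rightarrow> real) \<Rightarrow> (nat \<Rightarrow> path \<Rightarrow> real) \<Rightarrow>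
      (nat \<Rightarrow> path) \<Rightarrow> bool" where
  "nondegenerate_chain P J V v t g X h \<longleftrightarrow> 0 \<le> t 0 \<and> 0 < v \<and>
     (\<forall>j<J. t j < t (Suc j) \<and> wiener_integral P (g j) (X j) \<and> (\<forall>s. t (Suc j) < s \<longrightarrow> g j s = 0) \<and>
        v \<le> (\<integral>s. indicator {t j<..t (Suc j)} s * (half (g j) s)\<^sup>2 \<partial>lborel) \<and>
        h j \<in> cameron_martin \<and> wiener_integral P (deriv (coord (h j))) (X j) \<and> cm_inner (h j) (h j) \<le> V)"

context wiener_space
begin

text \<open>Pointwise 2 |a b| \<le> a^2 + b^2, so bounding the diagonal of the Gram matrix bounds
  all of it.\<close>

lemma cm_inner_le:
  fixes V :: real
  assumes "L2_density h" "L2_density g" "cm_inner h h \<le> V" "cm_inner g g \<le> V"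
  shows "\<bar>cm_inner h g\<bar> \<le> V"
proof -
  let ?h = "cm_density h" and ?g = "cm_density g"
  have [measurable]: "?h \<in> borel_measurable borel" "?g \<in> borel_measurable borel"
    and i: "integrable lborel (\<lambda>s. (?h s)\<^sup>2)" "integrable lborel (\<lambda>s. (?g s)\<^sup>2)"
    using assms by (auto simp: L2_density_def)
  have le: "\<bar>a * b\<bar> \<le> (a\<^sup>2 + b\<^sup>2) / 2" for a b :: real
    using sum_squares_bound[of "\<bar>a\<bar>" "\<bar>b\<bar>"] by (simp add: abs_mult)
  have m: "integrable lborel (\<lambda>s. ?h s * ?g s)" using i by (intro integrable_mult_L2) auto
  have "\<bar>cm_inner h g\<bar> \<le> (\<integral>s. \<bar>?h s * ?g s\<bar> \<partial>lborel)"
    unfolding cm_inner_eq using integral_norm_bound[of lborel "\<lambda>s. ?h s * ?g s"] by simp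
  also have "\<dots> \<le> (\<integral>s. ((?h s)\<^sup>2 + (?g s)\<^sup>2) / 2 \<partial>lborel)"
    using i m le by (intro integral_mono) auto
  also have "\<dots> = (cm_inner h h + cm_inner g g) / 2"
    unfolding cm_inner_eq using i by (simp add: power2_eq_square)
  also have "\<dots> \<le> (V + V) / 2" using assms(3,4) by (intro divide_right_mono add_mono) auto
  finally show ?thesis by simp
qed

text \<open>A is fixed before the chain and l are, so one constant serves every grid position and
  every scale. As l \<ge> 1, orders below r cost no more than l^r; there are J^k multi-indices of
  order k.\<close>

lemma bump_functional_norm:
  fixes V p :: real
  assumes p: "1 < p" and V: "0 \<le> V"
  obtains A where "0 < A"
    "\<forall>v t g X h l. nondegenerate_chain P J V v t g X h \<and> 1 \<le> l \<longrightarrow> smooth_functional P (bump_data J l h X) \<and>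
      smooth_norm P p r (bump_data J l h X) \<le> A * l ^ r * ((1 / (l * sqrt v)) ^ J) powr (1 / p)"
proof -
  obtain C where C: "1 \<le> C" "\<forall>a\<le>r. \<forall>x. \<bar>bump a x\<bar> \<le> C * exp (- x\<^sup>2 / 2)" by (rule bump_bound_uniform)
  define D where "D = 1 + (\<Sum>k\<le>r. sqrt (V ^ k) * (real J ^ k * C ^ J))"
  have D0: "1 \<le> D" using V C unfolding D_def by (simp add: sum_nonneg)
  define A where "A = real (Suc r) powr (1 / p) * D"
  have A: "0 < A" using D0 by (simp add: A_def)
  show ?thesis
  proof (rule that[OF A], intro allI impI, elim conjE)
    fix t :: "nat \<Rightarrow> real" and g :: "nat \<Rightarrow> real \<Rightarrow> real" and X :: "nat \<Rightarrow> path \<Rightarrow> real" and h :: "nat \<Rightarrow> path"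
      and l v :: real
    assume chain: "nondegenerate_chain P J V v t g X h" and l: "1 \<le> l"
    have t: "0 \<le> t 0" "\<forall>j<J. t j < t (Suc j)" and W: "\<forall>j<J. wiener_integral P (g j) (X j)"
      and g0: "\<forall>j<J. \<forall>s. t (Suc j) < s \<longrightarrow> g j s = 0" and v: "0 < v"
      and vle: "\<forall>j<J. v \<le> (\<integral>s. indicator {t j<..t (Suc j)} s * (half (g j) s)\<^sup>2 \<partial>lborel)"
      and h: "\<forall>j<J. h j \<in> cameron_martin \<and> wiener_integral P (deriv (coord (h j))) (X j)
          \<and> cm_inner (h j) (h j) \<le> V"
      using chain unfolding nondegenerate_chain_def by simp_all
    let ?F = "\<lparr>arity = J, outer = bump_prod J l (\<lambda>_. 0), dir = h, gauss = X\<rparr>"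
    have F: "smooth_functional P ?F"
      unfolding smooth_functional_def using h l bump_prod_smooth[of l J] by simp
    have Vb: "\<forall>i<arity ?F. \<forall>j<arity ?F. \<bar>cm_inner (dir ?F i) (dir ?F j)\<bar> \<le> V"
      using smooth_functional_L2_density[OF F] h by (auto intro!: cm_inner_le)
    let ?E = "\<lambda>w. \<Prod>j<J. exp (- (l * X j w)\<^sup>2 / 2)"
    have E01: "0 \<le> ?E w" "?E w \<le> 1" for w by (auto intro!: prod_nonneg prod_le_1)
    have Em: "?E \<in> borel_measurable P"
      using W unfolding wiener_integral_iff by (intro borel_measurable_prod) auto
    have Ei: "integrable P ?E"
    proof (rule integrable_const_bound[where B=1])
      show "AE w in P. norm (?E w) \<le> 1"
          by (rule AE_I2) (simp only: real_norm_def abs_of_nonneg[OF E01(1)] E01(2))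
    qed (rule Em)
    have small: "expectation ?E \<le> (1 / (l * sqrt v)) ^ J"
      by (rule wiener_small_ball[of t J g X v l]) (use t W g0 v vle l in auto)
    have bnd: "deriv_norm k ?F w \<le> D * l ^ r * ?E w" if k: "k \<le> r" for k w
    proof -
      let ?I = "{is. set is \<subseteq> {..<J} \<and> length is = k}"
      have "deriv_norm k ?F w \<le> sqrt (V ^ k)
          * (\<Sum>is\<in>?I. \<bar>iter_partial is (bump_prod J l (\<lambda>_. 0)) (\<lambda>i. X i w)\<bar>)"
        using deriv_norm_le[OF F Vb V, of k w] by simp
      also have "\<dots> \<le> sqrt (V ^ k) * (\<Sum>is\<in>?I. l ^ r * C ^ J * ?E w)"
      proof (intro mult_left_mono sum_mono)
        fix "is" assume "is": "is \<in> ?I"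
        have "\<bar>iter_partial is (bump_prod J l (\<lambda>_. 0)) (\<lambda>i. X i w)\<bar> \<le> l ^ length is * C ^ J * ?E w"
          using bump_prod_bound[OF C, of l "is" J "\<lambda>i. X i w"] "is" l k
            by (simp add: iter_partial_bump_prod)
        also have "\<dots> \<le> l ^ r * C ^ J * ?E w"
          using l C(1) "is" k E01(1) by (intro mult_right_mono power_increasing) auto
        finally show "\<bar>iter_partial is (bump_prod J l (\<lambda>_. 0)) (\<lambda>i. X i w)\<bar> \<le> l ^ r * C ^ J * ?E w" .
      qed (use V in simp)
      also have "\<dots> = sqrt (V ^ k) * (real J ^ k * C ^ J) * (l ^ r * ?E w)"
        using card_lists_length_eq[of "{..<J}" k] by simp
      also have "\<dots> \<le> D * (l ^ r * ?E w)"
      proof (rule mult_right_mono)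
        have "sqrt (V ^ k) * (real J ^ k * C ^ J) \<le> (\<Sum>k\<le>r. sqrt (V ^ k) * (real J ^ k * C ^ J))"
          using k V C(1) by (intro member_le_sum) auto
        then show "sqrt (V ^ k) * (real J ^ k * C ^ J) \<le> D" by (simp add: D_def)
        show "0 \<le> l ^ r * ?E w" using l E01(1) by simp
      qed
      finally show ?thesis by (simp add: mult.assoc)
    qed
    have pw: "deriv_norm k ?F w powr p \<le> (D * l ^ r) powr p * ?E w" if k: "k \<le> r" for k w
    proof -
      have "deriv_norm k ?F w powr p \<le> (D * l ^ r * ?E w) powr p"
        using bnd[OF k, of w] deriv_norm_nonneg[OF F, of k w] p by (intro powr_mono2) auto
      also have "\<dots> = (D * l ^ r) powr p * ?E w powr p" by (rule powr_mult)
      \<comment> \<open>As 0 \<le> E \<le> 1 the p-th power is dropped and the small-ball estimate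
        for E itself applies. The price is the exponent J / p in the norm, which a larger J makes
        good.\<close>
      also have "?E w powr p \<le> ?E w powr 1"
        using E01 p by (intro powr_mono') auto
      finally show ?thesis using E01(1)[of w] by (simp add: mult_left_mono)
    qed
    have "(\<Sum>k\<le>r. \<integral>w. deriv_norm k ?F w powr p \<partial>P) \<le> (\<Sum>k\<le>r. (D * l ^ r) powr p * (1 / (l * sqrt v)) ^ J)"
    proof (rule sum_mono)
      fix k assume "k \<in> {..r}"
      then have "(\<integral>w. deriv_norm k ?F w powr p \<partial>P) \<le> (\<integral>w. (D * l ^ r) powr p * ?E w \<partial>P)"
        using deriv_norm_integrable[OF F] p Ei pw by (intro integral_mono) auto
      also have "\<dots> \<le> (D * l ^ r) powr p * (1 / (l * sqrt v)) ^ J"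
        using small by (simp add: mult_left_mono)
      finally show "(\<integral>w. deriv_norm k ?F w powr p \<partial>P) \<le> (D * l ^ r) powr p * (1 / (l * sqrt v)) ^ J" .
    qed
    also have "\<dots> = real (Suc r) * ((D * l ^ r) powr p * (1 / (l * sqrt v)) ^ J)" by simp
    finally have "smooth_norm P p r ?F \<le> (real (Suc r) * ((D * l ^ r) powr p * (1 / (l * sqrt v)) ^ J))
        powr (1 / p)"
      unfolding smooth_norm_eq using p by (intro powr_mono2) (auto intro!: sum_nonneg)
    also have "\<dots> = real (Suc r) powr (1 / p) * ((D * l ^ r) powr p) powr (1 / p)
        * ((1 / (l * sqrt v)) ^ J) powr (1 / p)"
      by (simp only: powr_mult mult.assoc)
    also have "((D * l ^ r) powr p) powr (1 / p) = D * l ^ r"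
      using p D0 l by (simp add: powr_powr)
    finally have "smooth_norm P p r ?F \<le> A * l ^ r * ((1 / (l * sqrt v)) ^ J) powr (1 / p)"
      by (simp add: A_def mult.assoc)
    then show "smooth_functional P (bump_data J l h X) \<and>
        smooth_norm P p r (bump_data J l h X) \<le> A * l ^ r * ((1 / (l * sqrt v)) ^ J) powr (1 / p)"
      unfolding bump_data_def using F by blast
  qed
qed

end

section \<open>Capacity of the exceptional set\<close>

text \<open>Off O' the sublevel set is the trace of an open set A; whatever A does inside O' is
  absorbed by the union.\<close>

lemma open_Un_sublevel:
  fixes f :: "'a::topological_space \<Rightarrow> real"
  assumes "open O'" "continuous_on (- O') f"
  shows "open (O' \<union> {w. \<bar>f w\<bar> < e})"
proof -
  have "open {- e<..<e}" by simp
  then obtain A where A: "open A" "A \<inter> - O' = f -` {- e<..<e} \<inter> - O'"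
    using assms(2) unfolding continuous_on_open_invariant by blast
  have mem: "w \<in> A \<longleftrightarrow> \<bar>f w\<bar> < e" if "w \<notin> O'" for w
  proof -
    have "w \<in> A \<inter> - O' \<longleftrightarrow> w \<in> f -` {- e<..<e} \<inter> - O'" by (simp only: A(2))
    then show ?thesis using that by (auto simp: abs_less_iff)
  qed
  have "w \<in> O' \<union> {w. \<bar>f w\<bar> < e} \<longleftrightarrow> w \<in> O' \<union> A" for w using mem[of w] by blast
  then have "O' \<union> {w. \<bar>f w\<bar> < e} = O' \<union> A" by blast
  then show ?thesis using A(1) assms(1) by (simp add: open_Un)
qed

text \<open>Exchanges \<open>capacity\<close>, an infimum over open supersets, for
  \<open>open_capacity\<close> of one such superset; enlarging the exceptional set does not hurt
  continuity off it.\<close>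

lemma quasi_continuous_open:
  assumes "quasi_continuous P X" "1 \<le> r" "1 < p" "0 < e"
  shows "\<exists>V. open V \<and> open_capacity P p r V < ennreal e \<and> continuous_on (- V) X"
proof -
  obtain U where U: "open U" "capacity P p r U < ennreal e" "continuous_on (- U) X"
    using assms unfolding quasi_continuous_def by blast
  then obtain V where "open V" "U \<subseteq> V" "open_capacity P p r V < ennreal e"
    unfolding capacity_def INF_less_iff by blast
  then show ?thesis using U(3) by (meson Compl_anti_mono continuous_on_subset)
qed

context wiener_space
begin

lemma sobolev_smooth:
  assumes F: "smooth_functional P F" and p: "1 < p"
  shows "sobolev P p r (sval F) (smooth_norm P p r F)"
proof -
  have "smooth_dist P p r F F = smooth_norm P p r data_zero"
    unfolding smooth_dist_eq[OF F F]
    by (rule smooth_norm_cong[where P=P])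
      (use F in \<open>simp_all add: smooth_rules smooth_data_zero smooth_simps deriv_fun_zero\<close>)
  then have d: "smooth_dist P p r F F = 0" using p by (simp add: smooth_norm_zero)
  show ?thesis
    unfolding sobolev_def
    using sval_measurable[OF F] sval_integrable[OF F, of p] p F
    by (intro conjI exI[of _ "\<lambda>_. F"]) (simp_all add: d)
qed

lemma open_capacity_smooth:
  assumes F: "smooth_functional P F" and p: "1 < p"
    and "AE w in P. w \<in> U \<longrightarrow> 1 \<le> sval F w" "AE w in P. 0 \<le> sval F w"
  shows "open_capacity P p r U \<le> ennreal (smooth_norm P p r F)"
  unfolding open_capacity_def
  by (rule Inf_lower) (intro CollectI exI[of _ "smooth_norm P p r F"] exI[of _ "sval F"] conjI refl
    sobolev_smooth assms)

lemma open_capacity_empty: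
  assumes "1 < p"
  shows "open_capacity P p r {} = 0"
proof -
  have "open_capacity P p r {} \<le> ennreal (smooth_norm P p r data_zero)"
    using assms by (intro open_capacity_smooth smooth_data_zero) (auto simp: sval_zero)
  then show ?thesis using assms by (simp add: smooth_norm_zero)
qed

lemma open_capacity_finite_union:
  assumes p: "1 < p" and e: "0 < e" and cap: "\<And>i. i < n \<Longrightarrow> open_capacity P p r (U i) < ennreal e"
  shows "open_capacity P p r (\<Union>i<n. U i) \<le> ennreal (real (n + 1) * e)"
proof -
  define U' where "U' i = (if i < n then U i else {})" for i
  \<comment> \<open>Countable subadditivity wants a strict bound for every set, including the empty
    ones used as padding. They share a geometric tail of total e, whence n + 1 in place of
    n.\<close>
  define e' where "e' i = (if i \<in> {..<n} then e else 0) + e / 2 * (1 / 2) ^ i" for i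
  have "(\<lambda>i. e / 2 * (1 / 2) ^ i) sums (e / 2 * (1 / (1 - 1 / 2)))"
    by (intro sums_mult geometric_sums) simp
  then have s: "e' sums ((\<Sum>i<n. e) + e)"
    unfolding e'_def using sums_add[OF sums_If_finite_set[of "{..<n}" "\<lambda>_. e"]] by simp
  have c: "open_capacity P p r (U' i) < ennreal (e' i)" for i
  proof (cases "i < n")
    case True
    have "ennreal e \<le> ennreal (e' i)" using True e by (intro ennreal_leI) (simp add: e'_def)
    then show ?thesis using cap[OF True] True by (simp add: U'_def)
  next
    case False
    then show ?thesis using e by (simp add: U'_def e'_def open_capacity_empty[OF p])
  qed
  have "open_capacity P p r (\<Union>i. U' i) \<le> ennreal (\<Sum>i. e' i)"
    by (rule open_capacity_UN[OF p c sums_summable[OF s]])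
  moreover have "(\<Union>i. U' i) = (\<Union>i<n. U i)" by (auto simp: U'_def split: if_splits)
  moreover have "(\<Sum>i. e' i) = real (n + 1) * e" using sums_unique[OF s] by (simp add: distrib_right)
  ultimately show ?thesis by simp
qed

text \<open>With v = c n^(-2H) the factor 1 / (l sqrt v) is n^H / l up to a constant, and C depends
  neither on the position i nor on the mesh nor on l. The set need not be open: the a.e. condition
  in \<open>open_capacity\<close> is what gets verified.\<close>

lemma fbm_increments_capacity:
  assumes H: "0 < H" "H < 1" and p: "1 < p"
    and Y: "\<And>t. 0 \<le> t \<Longrightarrow> wiener_integral P (fbm_integrand H t) (Y t)"
  obtains C where "0 < C" "\<forall>n i. \<forall>l::real. 1 \<le> n \<and> i < n + 2 \<and> 1 \<le> l \<longrightarrow>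
      open_capacity P p r {w. \<forall>j<J. \<bar>Y (real (i + Suc j) / real n) w - Y (real (i + j) / real n) w\<bar> < 1 / l}
        \<le> ennreal (C * l ^ r * ((real n powr H / l) ^ J) powr (1 / p))"
proof -
  define V1 where "V1 = (\<integral>s. (fbm_integrand H 1 s)\<^sup>2 \<partial>lborel)"
  \<comment> \<open>An increment has at most twice the sum of the two variances, and all times in
    play are at most J + 3.\<close>
  define V where "V = 4 * (real J + 3) powr (2 * H) * V1"
  have V1: "0 \<le> V1" by (simp add: V1_def)
  then have V: "0 \<le> V" by (simp add: V_def)
  obtain A where A: "0 < A" and AB: "\<forall>v t g X h l. nondegenerate_chain P J V v t g X h \<and> 1 \<le> l \<longrightarrow>
      smooth_functional P (bump_data J l h X) \<and>
      smooth_norm P p r (bump_data J l h X) \<le> A * l ^ r * ((1 / (l * sqrt v)) ^ J) powr (1 / p)"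
    by (rule bump_functional_norm[OF p V, of J r])
  obtain c where c: "0 < c" and cB:
      "\<forall>t h. 0 \<le> t \<and> 0 < h \<and> integrable lborel
      (\<lambda>s. indicator {t<..t + h} s * (fbm_integrand H (t + h) s)\<^sup>2) \<longrightarrow>
      c * h powr (2 * H) \<le> (\<integral>s. indicator {t<..t + h} s * (fbm_integrand H (t + h) s)\<^sup>2 \<partial>lborel)"
    by (rule fbm_local_variance[OF H])
  define C where "C = A * ((1 / sqrt c) ^ J) powr (1 / p)"
  have C: "0 < C" using A c by (simp add: C_def)
  have half: "half (fbm_integrand H t) = fbm_integrand H t" for t
    by (auto simp: half_def fbm_integrand_def indicator_def fun_eq_iff)
  have fm[measurable]: "fbm_integrand H t \<in> borel_measurable borel"
      and fi: "integrable lborel (\<lambda>s. (fbm_integrand H t s)\<^sup>2)" if "0 \<le> t" for t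
    using Y[OF that] unfolding wiener_integral_iff half by auto
  have fv: "(\<integral>s. (fbm_integrand H t s)\<^sup>2 \<partial>lborel) \<le> (real J + 3) powr (2 * H) * V1"
      if "0 \<le> t" "t \<le> real J + 3" for t
  proof (cases "t = 0")
    case True
    then show ?thesis using V1 by (simp add: fbm_integrand_def)
  next
    case False
    then show ?thesis
      using that H V1 by (subst fbm_integrand_variance)
        (auto simp: V1_def intro!: mult_right_mono powr_mono2)
  qed
  show ?thesis
  proof (rule that[OF C], intro allI impI, elim conjE)
    fix n i :: nat and l :: real
    assume n: "1 \<le> n" and i: "i < n + 2" and l: "1 \<le> l"
    define t where "t j = real (i + j) / real n" for j
    have t0: "0 \<le> t j" for j by (simp add: t_def)
    have tS: "t (Suc j) = t j + 1 / real n" for j by (simp add: t_def add_divide_distrib)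
    have tlt: "t j < t (Suc j)" for j using n by (simp add: tS)
    have tJ: "t j \<le> real J + 3" if "j \<le> J" for j
    proof -
      have "real (i + j) \<le> real n + 1 + real J" using i that by linarith
      also have "\<dots> \<le> real n * (real J + 3)"
      proof -
        have "real J * 1 \<le> real J * real n" using n by (intro mult_left_mono) auto
        then show ?thesis using n by (simp add: distrib_left mult.commute)
      qed
      finally show ?thesis using n by (simp add: t_def pos_divide_le_eq mult.commute)
    qed
    define g where "g j s = fbm_integrand H (t (Suc j)) s - fbm_integrand H (t j) s" for j s
    define X where "X j w = Y (t (Suc j)) w - Y (t j) w" for j w
    have W: "wiener_integral P (g j) (X j)" for j
      unfolding g_def[abs_def] X_def[abs_def] by (intro wiener_diff Y t0)
    have gs: "g j s = 0" if "s \<notin> {0<..<t (Suc j)}" for j s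
      using that tlt[of j] by (auto simp: g_def fbm_integrand_def indicator_def)
    have gc: "isCont (g j) s" if "s \<notin> {0, t j, t (Suc j)}" for j s
      unfolding g_def[abs_def] using that t0 by (intro continuous_diff fbm_integrand_continuous[OF H]) auto
    have ex: "\<exists>h. h \<in> cameron_martin \<and> wiener_integral P (deriv (coord h)) (X j) \<and> cm_inner h h \<le> V"
        if j: "j < J" for j
    proof -
      have T: "0 < t (Suc j)" using t0[of j] tlt[of j] by simp
      have gcj: "isCont (g j) s" if "s \<notin> {0, t j, t (Suc j)}" for s by (rule gc[OF that])
      obtain h where h: "h \<in> cameron_martin" "wiener_integral P (deriv (coord h)) (X j)"
          "cm_inner h h = (\<integral>s. (g j s)\<^sup>2 \<partial>lborel)"
        by (rule wiener_integral_direction[where Z="{0, t j, t (Suc j)}", OF W gs T _ gcj]) simp_all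
      have "(\<integral>s. (g j s)\<^sup>2 \<partial>lborel) \<le> 2 * (\<integral>s. (fbm_integrand H (t (Suc j)) s)\<^sup>2 \<partial>lborel) + 2
          * (\<integral>s. (fbm_integrand H (t j) s)\<^sup>2 \<partial>lborel)"
        unfolding g_def using fm[OF t0] fi[OF t0] by (intro L2_diff(2)) auto
      also have "\<dots> \<le> V" using fv[OF t0 tJ, of "Suc j"] fv[OF t0 tJ, of j] j by (simp add: V_def)
      finally show ?thesis using h by auto
    qed
    have "\<forall>j\<in>{..<J}. \<exists>h. h \<in> cameron_martin \<and> wiener_integral P (deriv (coord h)) (X j) \<and> cm_inner h h \<le> V"
      using ex by simp
    from bchoice[OF this] obtain h where h:
        "\<forall>j\<in>{..<J}. h j \<in> cameron_martin \<and> wiener_integral P (deriv (coord (h j))) (X j)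
        \<and> cm_inner (h j) (h j) \<le> V"
      by (rule exE)
    define v where "v = c * (1 / real n) powr (2 * H)"
    have v: "0 < v" using c n by (simp add: v_def)
    \<comment> \<open>On its own interval the integrand of the earlier time vanishes, so the
      increment carries there the full near-diagonal part of the later kernel.\<close>
    have vle: "v \<le> (\<integral>s. indicator {t j<..t (Suc j)} s * (half (g j) s)\<^sup>2 \<partial>lborel)" for j
    proof -
      have "integrable lborel (\<lambda>s. indicator {t j<..t (Suc j)} s * (fbm_integrand H (t (Suc j)) s)\<^sup>2)"
        using integrable_real_mult_indicator[OF _ fi[OF t0], of "{t j<..t (Suc j)}" "Suc j"]
          by (simp add: mult.commute)
      then have "v \<le> (\<integral>s. indicator {t j<..t (Suc j)} s * (fbm_integrand H (t (Suc j)) s)\<^sup>2 \<partial>lborel)"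
        unfolding v_def tS using n by (intro cB[rule_format]) (simp add: t0)
      also have "\<dots> = (\<integral>s. indicator {t j<..t (Suc j)} s * (half (g j) s)\<^sup>2 \<partial>lborel)"
        using t0[of j] by (intro Bochner_Integration.integral_cong)
          (auto simp: half_def g_def fbm_integrand_def indicator_def)
      finally show ?thesis .
    qed
    let ?F = "bump_data J l h X"
    have "nondegenerate_chain P J V v t g X h"
      unfolding nondegenerate_chain_def using t0 tlt W gs v vle h by auto
    then have F: "smooth_functional P ?F \<and> smooth_norm P p r ?F \<le> A * l ^ r * ((1 / (l * sqrt v)) ^ J)
        powr (1 / p)"
      using AB l by blast
    have eq: "A * l ^ r * ((1 / (l * sqrt v)) ^ J) powr (1 / p) = C * l ^ r * ((real n powr H / l) ^ J)
        powr (1 / p)"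
    proof -
      have "sqrt v = sqrt c * (1 / real n) powr H"
      proof -
        have "(1 / real n) powr (2 * H) = ((1 / real n) powr H)\<^sup>2"
          by (simp add: power2_eq_square powr_add[symmetric])
        then show ?thesis by (simp add: v_def real_sqrt_mult)
      qed
      then have "1 / (l * sqrt v) = (1 / sqrt c) * (real n powr H / l)"
        using n by (simp add: powr_divide)
      then have "((1 / (l * sqrt v)) ^ J) powr (1 / p) = ((1 / sqrt c) ^ J) powr (1 / p)
          * ((real n powr H / l) ^ J) powr (1 / p)"
        by (simp only: power_mult_distrib powr_mult)
      then show ?thesis by (simp only: C_def mult_ac)
    qed
    have sv: "sval ?F w = bump_prod J l (\<lambda>_. 0) (\<lambda>j. X j w)" for w by (simp add: sval_def bump_data_def)
    have "open_capacity P p r {w. \<forall>j<J. \<bar>X j w\<bar> < 1 / l} \<le> ennreal (smooth_norm P p r ?F)"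
    proof (rule open_capacity_smooth[OF _ p])
      show "AE w in P. w \<in> {w. \<forall>j<J. \<bar>X j w\<bar> < 1 / l} \<longrightarrow> 1 \<le> sval ?F w"
        unfolding sv by (intro AE_I2 impI bump_prod_ge_1) (use l in \<open>auto intro: less_imp_le\<close>)
      show "AE w in P. 0 \<le> sval ?F w" unfolding sv by (auto intro!: AE_I2 bump_prod_nonneg)
    qed (use F in blast)
    also have "\<dots> \<le> ennreal (C * l ^ r * ((real n powr H / l) ^ J) powr (1 / p))"
      using F unfolding eq by (intro ennreal_leI) blast
    finally show "open_capacity P p r
        {w. \<forall>j<J. \<bar>Y (real (i + Suc j) / real n) w - Y (real (i + j) / real n) w\<bar> < 1 / l}
        \<le> ennreal (C * l ^ r * ((real n powr H / l) ^ J) powr (1 / p))"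
      by (simp add: X_def t_def)
  qed
qed

end

section \<open>Covering the points of Lipschitz behaviour by open sets of small capacity\<close>

lemma open_capacity_AE_mono:
  assumes "AE w in P. w \<in> U \<longrightarrow> w \<in> V"
  shows "open_capacity P p r U \<le> open_capacity P p r V"
  unfolding open_capacity_def
proof (rule Inf_superset_mono, safe)
  fix c \<phi> assume s: "sobolev P p r \<phi> c" "AE w in P. w \<in> V \<longrightarrow> 1 \<le> \<phi> w" "AE w in P. 0 \<le> \<phi> w"
  have "AE w in P. w \<in> U \<longrightarrow> 1 \<le> \<phi> w" using assms s(2) by eventually_elim simp
  then show "\<exists>c' \<phi>. ennreal c = ennreal c' \<and> sobolev P p r \<phi> c' \<and> (AE w in P. w \<in> U \<longrightarrow> 1 \<le> \<phi> w)
      \<and> (AE w in P. 0 \<le> \<phi> w)"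
    using s by blast
qed

text \<open>The exponents of n are 1 for the number of positions, r for the derivatives and -(1 - H)
  J / p for the small ball; the lower bound on J makes their sum less than -1.\<close>

lemma capacity_rate:
  fixes H p C L D :: real and J r :: nat
  assumes "0 < H" "H < 1" "1 < p" "p * (real r + 2) / (1 - H) < real J" "0 < C" "0 < L" "0 < e"
  shows "\<forall>\<^sub>F n in sequentially. D * real n
      * (C * (real n / L) ^ r * ((real n powr H / (real n / L)) ^ J) powr (1 / p)) < e"
proof -
  define q where "q = (1 - H) * real J / p - real r - 1"
  have q: "0 < q"
  proof -
    have "p * (real r + 2) < real J * (1 - H)" using assms by (simp add: pos_divide_less_eq)
    then have "real r + 2 < (1 - H) * real J / p" using assms by (simp add: pos_less_divide_eq mult.commute)
    then show ?thesis by (simp add: q_def)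
  qed
  define K where "K = D * C * (1 / L) ^ r * (L ^ J) powr (1 / p)"
  have eq: "D * real n * (C * (real n / L) ^ r * ((real n powr H / (real n / L)) ^ J) powr (1 / p)) = K
      * real n powr (- q)"
    if n: "1 \<le> n" for n :: nat
  proof -
    have "real n powr H / (real n / L) = L * real n powr (H - 1)" using n assms by (simp add: powr_diff)
    then have "(real n powr H / (real n / L)) ^ J = L ^ J * real n powr ((H - 1) * real J)"
      using n by (simp add: power_mult_distrib powr_realpow[symmetric] powr_powr)
    then have "((real n powr H / (real n / L)) ^ J) powr (1 / p) = (L ^ J) powr (1 / p)
        * real n powr ((H - 1) * real J / p)"
      by (simp add: powr_mult powr_powr)
    moreover have "(real n / L) ^ r = (1 / L) ^ r * real n powr real r"
      using n by (simp add: powr_realpow power_divide)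
    moreover have "real n * real n powr real r * real n powr ((H - 1) * real J / p) = real n powr (- q)"
    proof -
      have "real n * real n powr real r * real n powr ((H - 1) * real J / p)
          = real n powr (1 + real r + (H - 1) * real J / p)"
        using n by (simp add: powr_add)
      also have "1 + real r + (H - 1) * real J / p = - q"
        using assms by (simp add: q_def field_simps)
      finally show ?thesis .
    qed
    ultimately show ?thesis unfolding K_def by (simp only: mult.assoc mult.left_commute) (simp add: mult_ac)
  qed
  have "((\<lambda>n. K * real n powr (- q)) \<longlongrightarrow> K * 0) sequentially"
    by (intro tendsto_mult tendsto_const tendsto_neg_powr filterlim_real_sequentially) (use q in simp)
  then have "\<forall>\<^sub>F n in sequentially. K * real n powr (- q) < e"
    using assms by (intro order_tendstoD(2)) auto
  then show ?thesis using eventually_ge_at_top[of 1] by eventually_elim (simp only: eq)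
qed

text \<open>The cover depends on r and p, through J and the exceptional sets of quasi-continuity.
  The integer M is at once the slope and the inverse of the radius.\<close>

lemma Lipschitz_point_cover:
  assumes H: "0 < H" "H < 1" and P: "wiener_measure P" and B: "fbm_version H P B"
    and r: "1 \<le> r" and p: "1 < p" and M: "1 \<le> M" and e: "0 < e"
  shows "\<exists>U. open U \<and> {w. \<exists>t\<in>{0..1}. \<forall>h. 0 < h \<and> h < 1 / real M \<longrightarrow> \<bar>B (t + h) w - B t w\<bar> \<le> real M * h} \<subseteq> U \<and>
    open_capacity P p r U < ennreal e"
proof -
  interpret wiener_space P by standard (rule P)
  have "\<forall>t\<in>{0..}. \<exists>Y. wiener_integral P (fbm_integrand H t) Y \<and> (AE w in P. B t w = Y w)"
    using B unfolding fbm_version_def fbm_integrand_def[abs_def] by simp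
  from bchoice[OF this] obtain Y where
    Y': "\<forall>t\<in>{0..}. wiener_integral P (fbm_integrand H t) (Y t) \<and> (AE w in P. B t w = Y t w)" by (rule exE)
  have Y: "wiener_integral P (fbm_integrand H t) (Y t)" and YB: "AE w in P. B t w = Y t w" if "0 \<le> t" for t
    using Y' that by auto
  have qc: "quasi_continuous P (B t)" if "0 \<le> t" for t
    using B that unfolding fbm_version_def by blast
  obtain J :: nat where J: "p * (real r + 2) / (1 - H) < real J" using reals_Archimedean2 by blast
  obtain C where C: "0 < C" and CB: "\<forall>n i. \<forall>l::real. 1 \<le> n \<and> i < n + 2 \<and> 1 \<le> l \<longrightarrow>
      open_capacity P p r {w. \<forall>j<J. \<bar>Y (real (i + Suc j) / real n) w - Y (real (i + j) / real n) w\<bar> < 1 / l}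
        \<le> ennreal (C * l ^ r * ((real n powr H / l) ^ J) powr (1 / p))"
    by (rule fbm_increments_capacity[OF H p Y, of r J])
  \<comment> \<open>Two neighbouring grid points within (J + 1) / n of t have values within 2 M (J +
    1) / n of each other; the extra 1 makes the inequality strict, so that the sets come out
    open.\<close>
  define L where "L = real (2 * M * (J + 1) + 1)"
  have L: "0 < L" unfolding L_def of_nat_0_less_iff by simp
  define a where "a n = C * (real n / L) ^ r * ((real n powr H / (real n / L)) ^ J) powr (1 / p)"
      for n :: nat
  \<comment> \<open>Pays for the 2 n + J + 5 sets below, plus the spare one of the finite union,
    each with bound 2 a n.\<close>
  define D where "D = 2 * (real J + 8)"
  have "\<forall>\<^sub>F n in sequentially. D * real n * a n < e"
    unfolding a_def by (rule capacity_rate[OF H p J C L e])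
  \<comment> \<open>n \<ge> L gives the scale n / L \<ge> 1, and n > M (J + 1) keeps the grid points
    in use within 1 / M of t.\<close>
  moreover have "\<forall>\<^sub>F n in sequentially. nat \<lceil>L\<rceil> + M * (J + 1) + 1 \<le> n" by (rule eventually_ge_at_top)
  ultimately have "\<forall>\<^sub>F n in sequentially. D * real n * a n < e \<and> nat \<lceil>L\<rceil> + M * (J + 1) + 1 \<le> n"
      by (rule eventually_conj)
  then obtain n where n: "D * real n * a n < e" "nat \<lceil>L\<rceil> + M * (J + 1) + 1 \<le> n"
    using eventually_happens'[OF sequentially_bot] by blast
  have n1: "1 \<le> n" and nM: "M * (J + 1) < n" and nL: "L \<le> real n"
  proof -
    show "1 \<le> n" "M * (J + 1) < n" using n(2) by linarith+
    have "real (nat \<lceil>L\<rceil>) \<le> real n" using n(2) by linarith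
    then show "L \<le> real n" using real_nat_ceiling_ge[of L] by linarith
  qed
  have a0: "0 < a n" using C L n1 by (simp add: a_def)
  define s where "s m = real m / real n" for m :: nat
  have s0: "0 \<le> s m" for m by (simp add: s_def)
  \<comment> \<open>Exceeds every grid index i + j that occurs, since i \<le> n + 1 and j \<le>
    J.\<close>
  define N where "N = n + J + 3"
  have "\<forall>m\<in>UNIV. \<exists>V. open V \<and> open_capacity P p r V < ennreal (2 * a n) \<and> continuous_on (- V) (B (s m))"
    using quasi_continuous_open[OF qc[OF s0] r p, of "2 * a n"] a0 by simp
  from bchoice[OF this] obtain V where
    V: "\<forall>m\<in>UNIV. open (V m) \<and> open_capacity P p r (V m) < ennreal (2 * a n)
      \<and> continuous_on (- V m) (B (s m))" by (rule exE)
  define G where "G i = {w. \<forall>j<J. \<bar>B (s (i + Suc j)) w - B (s (i + j)) w\<bar> < L / real n}" for i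
  have Gcap: "open_capacity P p r (G i) < ennreal (2 * a n)" if i: "i < n + 2" for i
  proof -
    \<comment> \<open>Two demands meet here: openness needs the quasi-continuous B, the smooth
      functional needs the measurable integrals Y. The capacity sees sets up to null sets, so the
      estimate transfers.\<close>
    have "AE w in P. \<forall>m. B (s m) w = Y (s m) w" using YB[OF s0] by (simp add: AE_all_countable)
    then have "AE w in P. w \<in> G i \<longrightarrow> w \<in>
        {w. \<forall>j<J. \<bar>Y (s (i + Suc j)) w - Y (s (i + j)) w\<bar> < 1 / (real n / L)}"
      by eventually_elim (simp add: G_def)
    then have "open_capacity P p r (G i)
        \<le> open_capacity P p r {w. \<forall>j<J. \<bar>Y (s (i + Suc j)) w - Y (s (i + j)) w\<bar> < 1 / (real n / L)}"
      by (rule open_capacity_AE_mono)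
    also have "\<dots> \<le> ennreal (a n)"
      unfolding s_def a_def by (rule CB[rule_format]) (use n1 i nL L in simp)
    also have "\<dots> < ennreal (2 * a n)" using a0 by (intro ennreal_lessI) auto
    finally show ?thesis .
  qed
  \<comment> \<open>The N exceptional sets followed by the n + 2 sets of small increments, so that
    one finite union suffices.\<close>
  define S where "S k = (if k < N then V k else G (k - N))" for k
  define U where "U = (\<Union>k<N + (n + 2). S k)"
  define Q where "Q = (\<Union>m<N. V m)"
  have openQ: "open Q" unfolding Q_def using V by (intro open_UN) auto
  have cQ: "continuous_on (- Q) (B (s m))" if "m < N" for m
  proof (rule continuous_on_subset)
    show "continuous_on (- V m) (B (s m))" using V by simp
    show "- Q \<subseteq> - V m" unfolding Q_def using that by blast
  qed
  \<comment> \<open>Adding Q to each G i leaves the union unchanged but makes every piece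
    open.\<close>
  have Ueq: "U = Q \<union> (\<Union>i<n + 2. Q \<union> G i)"
  proof (intro set_eqI iffI)
    fix w assume "w \<in> U"
    then obtain k where k: "k < N + (n + 2)" "w \<in> S k" unfolding U_def by blast
    show "w \<in> Q \<union> (\<Union>i<n + 2. Q \<union> G i)"
    proof (cases "k < N")
      case True
      then have "w \<in> V k" using k(2) by (simp add: S_def)
      then show ?thesis unfolding Q_def using True by blast
    next
      case False
      then have "w \<in> G (k - N)" "k - N < n + 2" using k by (simp_all add: S_def)
      then show ?thesis by blast
    qed
  next
    fix w assume "w \<in> Q \<union> (\<Union>i<n + 2. Q \<union> G i)"
    then consider (1) m where "m < N" "w \<in> V m" | (2) i where "i < n + 2" "w \<in> G i"
      unfolding Q_def by blast
    then show "w \<in> U"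
    proof cases
      case 1
      then have "w \<in> S m" "m < N + (n + 2)" by (simp_all add: S_def)
      then show ?thesis unfolding U_def by blast
    next
      case 2
      then have "w \<in> S (i + N)" "i + N < N + (n + 2)" by (simp_all add: S_def)
      then show ?thesis unfolding U_def by blast
    qed
  qed
  have "open (Q \<union> G i)" if i: "i < n + 2" for i
  proof -
    \<comment> \<open>For J = 0 the condition defining G i is vacuous, and the intersection over no
      indices is kept apart.\<close>
    have "Q \<union> G i = (if J = 0 then UNIV else
        (\<Inter>j<J. Q \<union> {w. \<bar>B (s (i + Suc j)) w - B (s (i + j)) w\<bar> < L / real n}))"
      by (auto simp: G_def)
    also have "open \<dots>"
    proof (cases "J = 0")
      case False
      have "open (\<Inter>j<J. Q \<union> {w. \<bar>B (s (i + Suc j)) w - B (s (i + j)) w\<bar> < L / real n})"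
        using i by (intro open_INT open_Un_sublevel[OF openQ] ballI continuous_on_diff cQ)
          (auto simp: N_def)
      then show ?thesis using False by simp
    qed simp
    finally show ?thesis .
  qed
  then have openU: "open U" unfolding Ueq using openQ by (intro open_Un open_UN) auto
  have Scap: "open_capacity P p r (S k) < ennreal (2 * a n)" if "k < N + (n + 2)" for k
    using V Gcap[of "k - N"] that by (auto simp: S_def)
  have "open_capacity P p r U \<le> ennreal (real (N + (n + 2) + 1) * (2 * a n))"
    unfolding U_def using a0 by (intro open_capacity_finite_union[OF p] Scap) auto
  also have "\<dots> \<le> ennreal (D * real n * a n)"
  proof -
    have "real J * 1 \<le> real J * real n" using n1 by (intro mult_left_mono) auto
    then have "real (N + (n + 2) + 1) * 2 \<le> D * real n" using n1 by (simp add: N_def D_def algebra_simps)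
    then have "real (N + (n + 2) + 1) * 2 * a n \<le> D * real n * a n" using a0 by (intro mult_right_mono) auto
    then show ?thesis by (intro ennreal_leI) (simp only: mult.assoc)
  qed
  also have "\<dots> < ennreal e" using n(1) e by (intro ennreal_lessI) auto
  finally have capU: "open_capacity P p r U < ennreal e" .
  have "w \<in> U" if w: "t \<in> {0..1}" "\<forall>h. 0 < h \<and> h < 1 / real M \<longrightarrow> \<bar>B (t + h) w - B t w\<bar> \<le> real M * h" for w t
  proof -
    \<comment> \<open>The first grid point strictly to the right of t, since the Lipschitz bound
      concerns h > 0 only; t = 1 gives i = n + 1, hence the range i < n + 2.\<close>
    define i where "i = Suc (nat \<lfloor>t * real n\<rfloor>)"
    have fl: "real (nat \<lfloor>t * real n\<rfloor>) \<le> t * real n" "t * real n < real (nat \<lfloor>t * real n\<rfloor>) + 1"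
      using w(1) by (auto simp: of_nat_nat)
    have "t * real n \<le> 1 * real n" using w(1) by (intro mult_right_mono) auto
    then have i: "i < n + 2" using fl(1) unfolding i_def by linarith
    have b: "\<bar>B (s (i + j)) w - B t w\<bar> \<le> real M * (real (J + 1) / real n)" if "j \<le> J" for j
    proof -
      have lo: "t < s (i + j)"
      proof -
        have "t * real n < real (i + j)" using fl(2) by (simp add: i_def)
        then show ?thesis using n1 by (simp add: s_def pos_less_divide_eq)
      qed
      have hi: "s (i + j) - t \<le> real (J + 1) / real n"
      proof -
        have "real (i + j) - t * real n \<le> real (J + 1)" using fl(1) that by (simp add: i_def)
        then have "(real (i + j) - t * real n) / real n \<le> real (J + 1) / real n" using n1
            by (intro divide_right_mono) auto
        then show ?thesis using n1 by (simp add: s_def diff_divide_distrib)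
      qed
      have "real (J + 1) / real n < 1 / real M"
      proof -
        have "real (M * (J + 1)) < real n" using nM by (simp only: of_nat_less_iff)
        then have "real (J + 1) * real M < 1 * real n" by (simp only: of_nat_mult mult.commute mult_1_left)
        then have "real (J + 1) < real n / real M" using M by (simp add: pos_less_divide_eq)
        then have "real (J + 1) / real n < real n / real M / real n" using n1
            by (intro divide_strict_right_mono) auto
        then show ?thesis using n1 by simp
      qed
      then have "\<bar>B (t + (s (i + j) - t)) w - B t w\<bar> \<le> real M * (s (i + j) - t)"
        using lo hi by (intro w(2)[rule_format]) auto
      also have "\<dots> \<le> real M * (real (J + 1) / real n)" using hi by (intro mult_left_mono) auto
      finally show ?thesis by simp
    qed
    have "\<bar>B (s (i + Suc j)) w - B (s (i + j)) w\<bar> < L / real n" if "j < J" for j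
    proof -
      have "\<bar>B (s (i + Suc j)) w - B (s (i + j)) w\<bar> \<le> 2 * (real M * (real (J + 1) / real n))"
        using b[of "Suc j"] b[of j] that by linarith
      also have "\<dots> < L / real n"
      proof -
        have "2 * (real M * (real (J + 1) / real n)) = real (2 * M * (J + 1)) / real n"
          by (simp only: of_nat_mult of_nat_numeral times_divide_eq_right mult.assoc)
        also have "\<dots> < L / real n" unfolding L_def using n1
            by (intro divide_strict_right_mono) (simp_all del: of_nat_mult of_nat_add)
        finally show ?thesis .
      qed
      finally show ?thesis .
    qed
    then have "w \<in> G i" by (simp add: G_def)
    then show "w \<in> U" unfolding Ueq using i by blast
  qed
  then show ?thesis using openU capU by (intro exI[of _ U]) auto
qed

text \<open>Taking the maximum lets one integer serve as slope and as inverse radius, so that the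
  exceptional set becomes a countable union over M alone.\<close>

lemma Limsup_finite_Lipschitz:
  fixes f :: "real \<Rightarrow> real"
  assumes "Limsup (at_right 0) (\<lambda>h. ereal (\<bar>f h\<bar> / h)) \<noteq> \<infinity>"
  obtains M :: nat where "1 \<le> M" "\<forall>h. 0 < h \<and> h < 1 / real M \<longrightarrow> \<bar>f h\<bar> \<le> real M * h"
proof -
  obtain k :: nat where "Limsup (at_right 0) (\<lambda>h. ereal (\<bar>f h\<bar> / h)) < ereal (real k)"
    using assms less_PInf_Ex_of_nat by blast
  then have "\<forall>\<^sub>F h in at_right 0. ereal (\<bar>f h\<bar> / h) < ereal (real k)" by (rule Limsup_lessD)
  then obtain b where b: "0 < b" "\<forall>h. 0 < h \<and> h < b \<longrightarrow> \<bar>f h\<bar> / h < real k"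
    unfolding eventually_at_right_field by auto
  obtain m :: nat where m: "1 / b < real m" using reals_Archimedean2 by blast
  define M where "M = max 1 (max k m)"
  show ?thesis
  proof (rule that[of M], simp add: M_def, intro allI impI, elim conjE)
    fix h :: real assume h: "0 < h" "h < 1 / real M"
    have "1 / real M \<le> b"
    proof -
      have "1 / b \<le> real M" using m by (simp add: M_def)
      moreover have "0 < real M" by (simp add: M_def)
      ultimately show ?thesis using b(1) by (simp add: field_simps)
    qed
    then have "\<bar>f h\<bar> / h < real k" using b(2) h by simp
    then have "\<bar>f h\<bar> \<le> real k * h" using h by (simp add: pos_divide_less_eq)
    also have "\<dots> \<le> real M * h" using h by (intro mult_right_mono) (auto simp: M_def)
    finally show "\<bar>f h\<bar> \<le> real M * h" .
  qed
qed

theorem theorem5p1: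
  fixes H :: real and P :: "path measure" and B :: "real \<Rightarrow> path \<Rightarrow> real"
  assumes "0 < H" and "H < 1"
    and "wiener_measure P"
    and "fbm_version H P B"
  shows "quasi_surely P (\<lambda>w. \<forall>t\<in>{0..1}.
           Limsup (at_right 0) (\<lambda>h. ereal (\<bar>B (t + h) w - B t w\<bar> / h)) = \<infinity>)"
  unfolding quasi_surely_def slim_def
proof (intro allI impI)
  interpret wiener_space P by standard (rule assms)
  fix r :: nat and p :: real
  assume r: "1 \<le> r" and p: "1 < p"
  let ?N = "{w. \<not> (\<forall>t\<in>{0..1}. Limsup (at_right 0) (\<lambda>h. ereal (\<bar>B (t + h) w - B t w\<bar> / h)) = \<infinity>)}"
  let ?A = "\<lambda>M. {w. \<exists>t\<in>{0..1}. \<forall>h. 0 < h \<and> h < 1 / real M \<longrightarrow> \<bar>B (t + h) w - B t w\<bar> \<le> real M * h}"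
  have cover: "?N \<subseteq> (\<Union>M. ?A (Suc M))"
  proof
    fix w assume "w \<in> ?N"
    then obtain t where t: "t \<in> {0..1}" "Limsup (at_right 0) (\<lambda>h. ereal (\<bar>B (t + h) w - B t w\<bar> / h)) \<noteq> \<infinity>"
        by blast
    obtain M :: nat where M: "1 \<le> M" "\<forall>h. 0 < h \<and> h < 1 / real M \<longrightarrow> \<bar>B (t + h) w - B t w\<bar> \<le> real M * h"
      by (rule Limsup_finite_Lipschitz[OF t(2)])
    \<comment> \<open>The countable family starts at 1, so M \<ge> 1 is reached as Suc (M -
      1).\<close>
    then have "w \<in> ?A (Suc (M - 1))" using t(1) by auto
    then show "w \<in> (\<Union>M. ?A (Suc M))" by blast
  qed
  have "capacity P p r ?N \<le> ennreal e" if e: "0 < e" for e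
  proof -
    \<comment> \<open>Geometric shares, adding up to e under countable subadditivity.\<close>
    have "\<forall>M\<in>UNIV. \<exists>U. open U \<and> ?A (Suc M) \<subseteq> U \<and> open_capacity P p r U < ennreal (e / 2 * (1 / 2) ^ M)"
      by (intro ballI Lipschitz_point_cover[OF assms r p]) (use e in auto)
    from bchoice[OF this] obtain U where
      U: "\<forall>M\<in>UNIV. open (U M) \<and> ?A (Suc M) \<subseteq> U M \<and> open_capacity P p r (U M)
        < ennreal (e / 2 * (1 / 2) ^ M)" by (rule exE)
    have s: "(\<lambda>M. e / 2 * (1 / 2) ^ M) sums (e / 2 * (1 / (1 - 1 / 2)))"
      by (intro sums_mult geometric_sums) simp
    have "?N \<subseteq> (\<Union>M. U M)"
      by (rule subset_trans[OF cover UN_mono]) (use U in simp_all)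
    moreover have "open (\<Union>M. U M)" using U by (intro open_UN) auto
    ultimately have "capacity P p r ?N \<le> open_capacity P p r (\<Union>M. U M)"
      unfolding capacity_def by (intro INF_lower) simp
    also have "\<dots> \<le> ennreal (\<Sum>M. e / 2 * (1 / 2) ^ M)"
      using U by (intro open_capacity_UN[OF p _ sums_summable[OF s]]) simp
    also have "(\<Sum>M. e / 2 * (1 / 2) ^ M) = e" using sums_unique[OF s] by simp
    finally show ?thesis .
  qed
  note bound = this
  have "capacity P p r ?N \<le> 0"
  proof (rule ennreal_le_epsilon)
    fix e :: real assume "0 < e"
    then have "capacity P p r ?N \<le> ennreal e" by (rule bound)
    then show "capacity P p r ?N \<le> 0 + ennreal e" by (simp only: add_0)
  qed
  then show "capacity P p r ?N = 0" unfolding le_zero_eq .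
qed

end
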